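(* Define, for $\operatorname{Re}\lambda>0$, $$\Upsilon(\lambda)=\frac{1}{\lambda+\bar\lambda}\,\frac{2\sqrt{\lambda}\,\overline{\sqrt{\lambda}}}{(\sqrt{\lambda}+\overline{\sqrt{\lambda}})^2},$$ with the principal branch of $\sqrt{\lambda}$. Then for every $\lambda$ with $\operatorname{Re}\lambda>0$: (i) $\displaystyle\lim_{\ell\to\infty}e^{-\ell\operatorname{Re}\lambda}\,A_\ell(-\lambda^2;\mathbb R_+)\,2|\lambda|=\Upsilon(\lambda)$; (ii) with $z=2\frac{\lambda^2+1}{\lambda^2-1}$, $\displaystyle\lim_{n\to\infty}\left|\frac{\lambda-1}{\lambda+1}\right|^n A_n(z;[-2,2])\left|\frac{dz}{d\lambda}\right|=\Upsilon(\lambda)$; (iii) for any fixed $y_0>0$, with $z$ as in (ii), $\zeta=\frac{z-iy_0}{z+iy_0}$, $\lambda_0$ the root with $\operatorname{Re}\lambda_0>0$ of $\lambda_0^2=\frac{iy_0-2}{iy_0+2}$, and $E_T=\{\frac{x-iy_0}{x+iy_0}: x\in[-2,2]\}$, one has $\displaystyle\lim_{n\to\infty}\left|\frac{\lambda-\lambda_0}{\lambda+\bar\lambda_0}\right|^n A_n(\zeta;E_T)\left|\frac{d\zeta}{d\lambda}\right|=\Upsilon(\lambda)$.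
   Context: For a compact set $E\subset\mathbb C$ and $n\in\mathbb N$, let $\mathcal P_n(E)$ be the set of complex polynomials of degree at most $n$ with $|P|\le1$ on $E$, and for $w\notin E$ set $A_n(w;E)=\sup\{|P'(w)|: P\in\mathcal P_n(E),\ P(w)=0\}$. For $\ell>0$, let $\mathcal E_\ell(\mathbb R_+)$ be the set of entire functions $F$ such that for every $\ell'>\ell$ there is $C(\ell')$ with $|F(z)|\le C(\ell')e^{\ell'\sqrt{|z|}}$ on $\mathbb C$, and $|F(x)|\le 1$ for $x\in\mathbb R_+=[0,\infty)$; for $z\in\mathbb C\setminus\mathbb R_+$ set $A_\ell(z;\mathbb R_+)=\sup\{|F'(z)|: F\in\mathcal E_\ell(\mathbb R_+),\ F(z)=0\}$. Note that $\lambda\mapsto-\lambda^2$ maps the right half-plane onto $\mathbb C\setminus\mathbb R_+$, and $\lambda\mapsto 2\frac{\lambda^2+1}{\lambda^2-1}$ maps it onto $\mathbb C\setminus[-2,2]$.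
   Formalization: In (ii) the point λ=1 is excluded, since z is infinite there; in (iii) the point λ=λ_0 is excluded, since z=-iy_0 and ζ is infinite there, while at λ=1 ζ is given its limiting value 1. *)

theory Defs
  imports "HOL-Analysis.Analysis" "HOL-Computational_Algebra.Polynomial"
begin

definition polys_bdd :: "nat \<Rightarrow> complex set \<Rightarrow> complex poly set" where
  "polys_bdd n E = {P. degree P \<le> n \<and> (\<forall>x\<in>E. norm (poly P x) \<le> 1)}"

definition A_poly :: "nat \<Rightarrow> complex \<Rightarrow> complex set \<Rightarrow> real" where
  "A_poly n w E = Sup {norm (poly (pderiv P) w) | P. P \<in> polys_bdd n E \<and> poly P w = 0}"

definition entire_bdd :: "real \<Rightarrow> (complex \<Rightarrow> complex) set" where
  "entire_bdd l = {F. F holomorphic_on UNIV \<and>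
      (\<forall>l'>l. \<exists>C::real. \<forall>z. norm (F z) \<le> C * exp (l' * sqrt (norm z))) \<and>
      (\<forall>x::real. x \<ge> 0 \<longrightarrow> norm (F (complex_of_real x)) \<le> 1)}"

definition A_entire :: "real \<Rightarrow> complex \<Rightarrow> real" where
  "A_entire l z = Sup {norm (deriv F z) | F. F \<in> entire_bdd l \<and> F z = 0}"

definition Upsilon :: "complex \<Rightarrow> complex" where
  "Upsilon l = (1 / (l + cnj l)) *
     (2 * csqrt l * cnj (csqrt l) / (csqrt l + cnj (csqrt l))^2)"

definition zmap :: "complex \<Rightarrow> complex" where
  "zmap l = 2 * (l^2 + 1) / (l^2 - 1)"

text \<open>zeta = (z - i y0)/(z + i y0) with z = zmap l, written with the factor (l^2 - 1)
  cleared so that it is also defined at l = 1 (where z = infinity, zeta = 1).\<close>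
definition zetamap :: "real \<Rightarrow> complex \<Rightarrow> complex" where
  "zetamap y0 l = (2 * (l^2 + 1) - \<i> * of_real y0 * (l^2 - 1)) /
                  (2 * (l^2 + 1) + \<i> * of_real y0 * (l^2 - 1))"

definition ET :: "real \<Rightarrow> complex set" where
  "ET y0 = {(complex_of_real x - \<i> * of_real y0) / (complex_of_real x + \<i> * of_real y0) | x. x \<in> {-2..2}}"

end

theory Submission
  imports Defs "HOL-Complex_Analysis.Complex_Analysis" "HOL-Real_Asymp.Real_Asymp"
begin

text \<open>
  All three problems become the same problem on the right half-plane for even functions \<open>f\<close> which are
  bounded by \<open>1\<close> on the imaginary axis, vanish at \<open>\<lambda>\<close>, and for which \<open>\<beta> f\<close> is bounded by \<open>1\<close> in the
  half-plane, \<open>\<beta>\<close> being the inner function \<open>exp (- t s)\<close> or a power of a Blaschke factor. In the limit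
  \<open>f\<close> behaves like \<open>a(s) / \<beta>(s) + a(-s) / \<beta>(-s)\<close> with \<open>a\<close> bounded and holomorphic; the two phases
  decouple, so that \<open>|f| \<le> 1\<close> turns into \<open>|a(s)| + |a(-s)| \<le> 1\<close> on the axis. Maximising \<open>|a'(\<lambda>)|\<close> under
  this constraint is solved by
  \<open>a(s) = (s - \<lambda>) (s + \<lambda>)^2 / (2 (s + cnj \<lambda>) (s + |\<lambda>|)^2)\<close>.

  Upper bound: \<open>f\<close> is integrated against the dual extremal density
  \<open>\<beta>(s) (s + |\<lambda>|)^2 / (s^2 - \<lambda>^2)^2\<close> times a Fejer kernel in the phase
  \<open>((s - |\<lambda>|) / (s + |\<lambda>|))^2 \<beta>(-s) / \<beta>(s)\<close>; after moving the contour into the half-plane all but two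
  terms are negligible, and these two are equal by evenness. Lower bound: the poles of \<open>a\<close> are removed
  by exponentially small modifications, and \<open>a(s) / \<beta>(s) + a(-s) / \<beta>(-s)\<close> becomes admissible up to
  a small constant.
\<close>

section \<open>Phragmen-Lindelof theorems\<close>

text \<open>The Fejer kernel is responsible for the sharp constant. The dual density alone bounds
  the derivative by twice the extremal value. With \<open>N\<close> powers of the phase the
  derivative is picked up \<open>2N - 1\<close> times, from \<open>N\<close> diagonal terms and
  \<open>N - 1\<close> neighbours that evenness makes equal to them, against a mass of
  \<open>N\<close>; and \<open>N/(2N - 1)\<close> tends to \<open>1/2\<close>. For fixed
  \<open>N\<close> the remaining terms only require \<open>\<beta>\<close> to be small on one
  compact set depending on \<open>\<lambda>\<close> and \<open>\<epsilon>\<close>. This is how a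
  single estimate serves exponentials and Blaschke powers alike. The number
  \<open>|\<lambda>|\<close> enters as the centre of a Cayley transform: it sends
  \<open>\<lambda>\<close> to an imaginary point \<open>i r\<close>, and
  \<open>s \<mapsto> -s\<close> to \<open>w \<mapsto> 1/w\<close>, which is conjugation on the unit
  circle. It also gives \<open>|s + |\<lambda>||^2 = |s|^2 + |\<lambda>|^2\<close> on the axis, so
  that the constraint on \<open>a\<close> becomes an equality by the parallelogram law. Both
  extremal problems prescribe a bound on the boundary and a growth rate only; that
  \<open>\<beta> f\<close> is bounded by 1 inside the half-plane has to be derived by
  Phragmen-Lindelof arguments.\<close>

lemma Phragmen_Lindelof:
  fixes G \<psi> :: "complex \<Rightarrow> complex"
  assumes Q: "open Q"
    and G: "G holomorphic_on Q" "continuous_on (closure Q) G"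
    and \<psi>: "\<psi> holomorphic_on Q" "continuous_on (closure Q) \<psi>"
    and frontier: "\<And>s. s \<in> frontier Q \<Longrightarrow> norm (G s) \<le> M"
    and \<psi>_nonneg: "\<And>s. s \<in> closure Q \<Longrightarrow> 0 \<le> Re (\<psi> s)"
    and growth: "\<And>\<epsilon>. \<epsilon> > 0 \<Longrightarrow> \<exists>R. \<forall>s\<in>closure Q. R \<le> norm s \<longrightarrow> norm (G s) \<le> M * exp (\<epsilon> * Re (\<psi> s))"
    and s: "s \<in> Q"
  shows "norm (G s) \<le> M"
proof -
  have bound: "norm (G s) \<le> M * exp (\<epsilon> * Re (\<psi> s))" if \<epsilon>: "\<epsilon> > 0" for \<epsilon>
  proof -
    obtain R0 where R0: "\<And>s. s \<in> closure Q \<Longrightarrow> R0 \<le> norm s \<Longrightarrow> norm (G s) \<le> M * exp (\<epsilon> * Re (\<psi> s))"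
      using growth[OF \<epsilon>] by blast
    define R where "R = max R0 (norm s + 1)"
    define S where "S = Q \<inter> ball 0 R"
    \<comment> \<open>Damping by \<open>exp (- \<epsilon> \<psi>)\<close>: on a large circle the
      growth assumption for the same \<open>\<epsilon>\<close> gives the bound \<open>M\<close>, on
      the frontier of \<open>Q\<close> the damping can only help, so the maximum principle applies
      on the bounded set \<open>S\<close>.\<close>
    define H where "H = (\<lambda>s. G s * exp (- (of_real \<epsilon> * \<psi> s)))"
    have cl: "closure S \<subseteq> closure Q \<inter> cball 0 R"
      unfolding S_def by (intro Int_greatest closure_mono closure_minimal) auto
    have norm_H: "norm (H z) = norm (G z) * exp (- (\<epsilon> * Re (\<psi> z)))" for z
      by (simp add: H_def norm_mult)
    have le: "norm (H z) \<le> M" if "z \<in> frontier S" for z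
    proof -
      have zc: "z \<in> closure Q" "norm z \<le> R" using that cl by (auto simp: frontier_def)
      have zn: "z \<notin> S" using that Q by (auto simp: frontier_def S_def interior_open)
      show ?thesis
      proof (cases "norm z = R")
        case True
        then have "norm (G z) \<le> M * exp (\<epsilon> * Re (\<psi> z))" using R0 zc by (simp add: R_def)
        then have "norm (G z) * exp (- (\<epsilon> * Re (\<psi> z))) \<le> (M * exp (\<epsilon> * Re (\<psi> z))) * exp (- (\<epsilon> * Re (\<psi> z)))"
          by (intro mult_right_mono) auto
        then show ?thesis by (simp add: norm_H exp_minus field_simps)
      next
        case False
        then have "z \<in> frontier Q" using zn zc Q by (auto simp: S_def frontier_def interior_open)
        then have "norm (G z) \<le> M" by (rule frontier)
        moreover have "exp (- (\<epsilon> * Re (\<psi> z))) \<le> 1" using \<psi>_nonneg[OF zc(1)] \<epsilon> by simp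
        ultimately show ?thesis unfolding norm_H
          by (meson exp_ge_zero mult_right_le_one_le norm_ge_zero order_trans)
      qed
    qed
    have "norm (H s) \<le> M"
    proof (rule maximum_modulus_frontier[where f=H and S=S and B=M])
      show "H holomorphic_on interior S"
        using Q G \<psi> unfolding H_def S_def
        by (auto intro!: holomorphic_intros elim!: holomorphic_on_subset simp: interior_open)
      show "continuous_on (closure S) H"
        unfolding H_def using cl
        by (intro continuous_intros continuous_on_subset[OF G(2)] continuous_on_subset[OF \<psi>(2)]) auto
      show "bounded S" by (auto simp: S_def)
      show "s \<in> S" using s by (auto simp: S_def R_def)
    qed (use le in auto)
    then have "norm (H s) * exp (\<epsilon> * Re (\<psi> s)) \<le> M * exp (\<epsilon> * Re (\<psi> s))"
      by (intro mult_right_mono) auto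
    then show ?thesis by (simp add: norm_H exp_minus field_simps)
  qed
  have "((\<lambda>\<epsilon>. M * exp (\<epsilon> * Re (\<psi> s))) \<longlongrightarrow> M * exp (0 * Re (\<psi> s))) (at_right 0)"
    by (intro tendsto_intros)
  then have lim: "((\<lambda>\<epsilon>. M * exp (\<epsilon> * Re (\<psi> s))) \<longlongrightarrow> M) (at_right 0)" by simp
  show ?thesis
    by (rule tendsto_lowerbound[OF lim])
      (auto simp: eventually_at_right_less intro!: eventually_mono[OF eventually_at_right_less] bound)
qed

lemma closure_right_half_plane: "closure {s. Re s > 0} = {s. Re s \<ge> 0}"
  using closure_halfspace_gt[of "1::complex" 0] by simp

lemma frontier_right_half_plane: "frontier {s. Re s > 0} = {s. Re s = 0}"
  using frontier_halfspace_gt[of "1::complex" 0] by simp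

text \<open>\<open>Re (Ln (1 + s)) = ln |1 + s|\<close> is nonnegative and unbounded on the
  half-plane, so every positive multiple of it finally absorbs the a priori constant
  \<open>C\<close>. The shift by 1 keeps the logarithm away from its cut.\<close>

lemma Phragmen_Lindelof_half_plane_bounded:
  fixes G :: "complex \<Rightarrow> complex"
  assumes G: "G holomorphic_on {s. Re s > 0}" "continuous_on {s. Re s \<ge> 0} G"
    and bounded: "\<And>s. Re s \<ge> 0 \<Longrightarrow> norm (G s) \<le> C"
    and axis: "\<And>s. Re s = 0 \<Longrightarrow> norm (G s) \<le> 1"
    and s: "Re s \<ge> 0"
  shows "norm (G s) \<le> 1"
proof (cases "Re s = 0")
  case False
  define Q where "Q = {s::complex. Re s > 0}"
  have cl: "closure Q = {s. Re s \<ge> 0}" "frontier Q = {s. Re s = 0}"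
    by (simp_all add: Q_def closure_right_half_plane frontier_right_half_plane)
  have nonpos: "1 + z \<notin> \<real>\<^sub>\<le>\<^sub>0" if "Re z \<ge> 0" for z
    using that by (auto simp: complex_nonpos_Reals_iff)
  have ne: "1 + z \<noteq> 0" if "Re z \<ge> 0" for z using nonpos[OF that] by auto
  have ReLn: "Re (Ln (1 + z)) = ln (norm (1 + z))" if "Re z \<ge> 0" for z
    using ne[OF that] by simp
  have ge1: "1 \<le> norm (1 + z)" if "Re z \<ge> 0" for z
    using complex_Re_le_cmod[of "1+z"] that by simp
  show ?thesis
  proof (rule Phragmen_Lindelof[of Q G "\<lambda>s. Ln (1 + s)"])
    show "open Q" by (simp add: Q_def open_halfspace_Re_gt)
    show "G holomorphic_on Q" using G by (simp add: Q_def)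
    show "continuous_on (closure Q) G" using G by (simp add: cl)
    show "(\<lambda>s. Ln (1 + s)) holomorphic_on Q"
      by (intro holomorphic_intros) (use nonpos in \<open>force simp: Q_def\<close>)
    show "continuous_on (closure Q) (\<lambda>s. Ln (1 + s))"
      by (intro continuous_intros) (auto simp: cl nonpos)
    show "0 \<le> Re (Ln (1 + z))" if "z \<in> closure Q" for z
      using that ge1[of z] by (auto simp: cl ReLn)
    show "s \<in> Q" using False s by (auto simp: Q_def)
  next
    fix \<epsilon> :: real assume \<epsilon>: "\<epsilon> > 0"
    define C' where "C' = max C 1"
    show "\<exists>R. \<forall>z\<in>closure Q. R \<le> norm z \<longrightarrow> norm (G z) \<le> 1 * exp (\<epsilon> * Re (Ln (1 + z)))"
    proof (intro exI[of _ "1 + exp (ln C' / \<epsilon>)"] ballI impI)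
      fix z assume z: "z \<in> closure Q" "1 + exp (ln C' / \<epsilon>) \<le> norm z"
      have rez: "Re z \<ge> 0" using z by (simp add: cl)
      have "norm z - 1 \<le> norm (1 + z)" using norm_triangle_ineq2[of z "-1"] by (simp add: add.commute)
      then have "exp (ln C' / \<epsilon>) \<le> norm (1 + z)" using z by simp
      then have "ln (exp (ln C' / \<epsilon>)) \<le> ln (norm (1 + z))" using ge1[OF rez] by (subst ln_le_cancel_iff) auto
      then have "ln C' \<le> \<epsilon> * ln (norm (1 + z))" using \<epsilon> by (simp add: field_simps)
      then have "exp (ln C') \<le> exp (\<epsilon> * Re (Ln (1 + z)))" by (simp add: ReLn[OF rez])
      then have "C' \<le> exp (\<epsilon> * Re (Ln (1 + z)))" by (simp add: C'_def)
      then show "norm (G z) \<le> 1 * exp (\<epsilon> * Re (Ln (1 + z)))"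
        using bounded[OF rez] by (simp add: C'_def)
    qed
  qed (use axis in \<open>auto simp: cl\<close>)
qed (use axis in auto)

text \<open>Geometrically, \<open>|arg (c^2)| \<le> \<pi>/4\<close> forces
  \<open>|arg c| \<le> \<pi>/8\<close>, hence \<open>|arg (c^3)| \<le> 3\<pi>/8\<close>, which stays
  away from the imaginary axis. The constant 1/8 is not sharp; the algebra uses only
  \<open>|b| \<le> a/2\<close>.\<close>

lemma Re_cube_ge:
  assumes "Re c \<ge> 0" "\<bar>Im (c\<^sup>2)\<bar> \<le> Re (c\<^sup>2)"
  shows "Re (c ^ 3) \<ge> norm c ^ 3 / 8"
proof -
  obtain a b where c: "c = Complex a b" by (cases c)
  have a: "a \<ge> 0" and ab: "2 * a * \<bar>b\<bar> \<le> a\<^sup>2 - b\<^sup>2"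
    using assms by (auto simp: c power2_eq_square abs_mult)
  have b: "2 * \<bar>b\<bar> \<le> a"
  proof (rule ccontr)
    assume "\<not> 2 * \<bar>b\<bar> \<le> a"
    then have *: "a < 2 * \<bar>b\<bar>" by simp
    have "a * a \<le> a * (2 * \<bar>b\<bar>)" using * a by (intro mult_left_mono) auto
    moreover have "b\<^sup>2 > 0" using * a by auto
    ultimately show False using ab by (simp add: power2_eq_square)
  qed
  have b2: "4 * b\<^sup>2 \<le> a\<^sup>2" using power_mono[OF b, of 2] by (simp add: power_mult_distrib)
  have "norm c \<le> a + \<bar>b\<bar>" using cmod_le[of c] a by (simp add: c)
  then have norm_le: "norm c \<le> 3/2 * a" using b by simp
  have n2: "norm c ^ 2 = a\<^sup>2 + b\<^sup>2" by (simp add: c cmod_power2)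
  have key: "3/2 * (a\<^sup>2 + b\<^sup>2) \<le> 8 * (a\<^sup>2 - 3 * b\<^sup>2)"
  proof -
    have "3/2 * (A + B) \<le> 8 * (A - 3 * B)" if "4 * B \<le> A" "0 \<le> B" for A B :: real
    proof -
      have "13 * (4 * B) \<le> 13 * A" using that by simp
      then show ?thesis using that by simp
    qed
    from this[OF b2 zero_le_power2] show ?thesis .
  qed
  have "norm c ^ 3 = norm c ^ 2 * norm c" by (simp add: power3_eq_cube power2_eq_square)
  also have "\<dots> \<le> norm c ^ 2 * (3/2 * a)" using norm_le by (intro mult_left_mono) auto
  also have "\<dots> = (3/2 * norm c ^ 2) * a" by simp
  also have "\<dots> \<le> (8 * (a\<^sup>2 - 3 * b\<^sup>2)) * a"
    using a key unfolding n2 by (intro mult_right_mono) auto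
  also have "\<dots> = 8 * Re (c ^ 3)"
    by (simp add: c power3_eq_cube power2_eq_square algebra_simps)
  finally show ?thesis by simp
qed

text \<open>Growth of order 1 lies below the critical order 2 of a quadrant, so a comparison
  function of the intermediate order 3/2 works, namely \<open>(1 + (1 - i) s)^(3/2)\<close>. The
  factor \<open>1 - i\<close> turns the quadrant into the sector of half-angle
  \<open>\<pi>/4\<close>, where \<open>Re_cube_ge\<close> applies to the square root; the added 1
  avoids the branch point.\<close>

lemma Phragmen_Lindelof_quadrant:
  fixes G :: "complex \<Rightarrow> complex"
  assumes G: "G holomorphic_on {s. Re s > 0 \<and> Im s > 0}" "continuous_on {s. Re s \<ge> 0 \<and> Im s \<ge> 0} G"
    and growth: "\<And>s. Re s \<ge> 0 \<Longrightarrow> Im s \<ge> 0 \<Longrightarrow> norm (G s) \<le> C * exp (L * norm s)"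
    and "L \<ge> 0" "M \<ge> 1"
    and sides: "\<And>s. Re s = 0 \<Longrightarrow> Im s \<ge> 0 \<Longrightarrow> norm (G s) \<le> M" "\<And>s. Im s = 0 \<Longrightarrow> Re s \<ge> 0 \<Longrightarrow> norm (G s) \<le> M"
    and s: "Re s \<ge> 0" "Im s \<ge> 0"
  shows "norm (G s) \<le> M"
proof (cases "Re s = 0 \<or> Im s = 0")
  case False
  define Q where "Q = {s::complex. Re s > 0 \<and> Im s > 0}"
  have Q_eq: "Q = {s. Re s > 0} \<inter> {s. Im s > 0}" by (auto simp: Q_def)
  have op: "open Q" unfolding Q_eq by (intro open_Int open_halfspace_Re_gt open_halfspace_Im_gt)
  have "closed ({s::complex. Re s \<ge> 0} \<inter> {s. Im s \<ge> 0})"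
    by (intro closed_Int closed_halfspace_Re_ge closed_halfspace_Im_ge)
  then have cl: "closure Q \<subseteq> {s. Re s \<ge> 0 \<and> Im s \<ge> 0}"
    by (intro closure_minimal) (auto simp: Q_def Collect_conj_eq)
  define c where "c = (\<lambda>s. csqrt (1 + (1 - \<i>) * s))"
  have c2: "c z ^ 2 = 1 + (1 - \<i>) * z" for z by (simp add: c_def)
  have Re_c: "Re (c z) \<ge> 0" for z unfolding c_def using csqrt_principal[of "1 + (1 - \<i>) * z"] by auto
  have nonpos: "1 + (1 - \<i>) * z \<notin> \<real>\<^sub>\<le>\<^sub>0" if "z \<in> closure Q" for z
    using that cl by (auto simp: complex_nonpos_Reals_iff)
  have cube: "Re (c z ^ 3) \<ge> norm (c z) ^ 3 / 8" if "z \<in> closure Q" for z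
    using that cl by (intro Re_cube_ge Re_c) (auto simp: c2)
  have norm_c: "norm (c z) ^ 2 \<ge> norm z - 1" for z
  proof -
    have "norm (c z) ^ 2 = norm (1 + (1 - \<i>) * z)" by (metis c2 norm_power)
    moreover have "norm (1 + (1 - \<i>) * z) \<ge> norm ((1 - \<i>) * z) - 1"
      using norm_triangle_ineq2[of "(1 - \<i>) * z" "-1"] by (simp add: add.commute)
    moreover have "norm ((1 - \<i>) * z) \<ge> 1 * norm z"
      unfolding norm_mult using complex_Re_le_cmod[of "1-\<i>"] by (intro mult_right_mono) auto
    ultimately show ?thesis by simp
  qed
  show ?thesis
  proof (rule Phragmen_Lindelof[of Q G "\<lambda>s. c s ^ 3"])
    show "G holomorphic_on Q" using G by (simp add: Q_def)
    show "continuous_on (closure Q) G" using G(2) cl by (rule continuous_on_subset)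
    show "(\<lambda>s. c s ^ 3) holomorphic_on Q"
      unfolding c_def using nonpos closure_subset[of Q] by (intro holomorphic_intros) auto
    show "continuous_on (closure Q) (\<lambda>s. c s ^ 3)"
      unfolding c_def using nonpos
      by (intro continuous_on_power continuous_on_compose2[OF continuous_on_csqrt] continuous_intros) auto
    show "0 \<le> Re (c z ^ 3)" if "z \<in> closure Q" for z
      using cube[OF that] by (meson divide_nonneg_pos norm_ge_zero order_trans zero_le_power zero_less_numeral)
    show "s \<in> Q" using False s by (auto simp: Q_def)
    show "norm (G z) \<le> M" if "z \<in> frontier Q" for z
    proof -
      have "z \<in> closure Q" "z \<notin> Q" using that op by (auto simp: frontier_def interior_open)
      then have "Re z \<ge> 0" "Im z \<ge> 0" "\<not> (Re z > 0 \<and> Im z > 0)" using cl by (auto simp: Q_def)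
      then show ?thesis using sides[of z] by linarith
    qed
  next
    fix \<epsilon> :: real assume \<epsilon>: "\<epsilon> > 0"
    define C' where "C' = max C 1"
    \<comment> \<open>Chosen so that \<open>\<epsilon> K / 8 = L + 1\<close>; the surplus over
      \<open>L\<close> absorbs \<open>ln C'\<close> and the loss in \<open>norm_c\<close>.\<close>
    define K where "K = 8 * (L + 1) / \<epsilon>"
    have K: "K > 0" using \<epsilon> \<open>L \<ge> 0\<close> by (simp add: K_def)
    show "\<exists>R. \<forall>z\<in>closure Q. R \<le> norm z \<longrightarrow> norm (G z) \<le> M * exp (\<epsilon> * Re (c z ^ 3))"
    proof (intro exI[of _ "max (K\<^sup>2 + 1) (L + 1 + ln C')"] ballI impI)
      fix z assume z: "z \<in> closure Q" "max (K\<^sup>2 + 1) (L + 1 + ln C') \<le> norm z"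
      have "K ^ 2 \<le> norm (c z) ^ 2" using z norm_c[of z] by simp
      then have Kc: "K \<le> norm (c z)" using K by (intro power2_le_imp_le[of K]) auto
      have "L * norm z + ln C' \<le> (L + 1) * (norm z - 1)" using z by (simp add: algebra_simps)
      also have "\<dots> \<le> (L + 1) * norm (c z) ^ 2" using norm_c \<open>L \<ge> 0\<close> by (intro mult_left_mono) auto
      also have "\<dots> = \<epsilon> / 8 * (norm (c z) ^ 2 * K)" using \<epsilon> by (simp add: K_def)
      also have "\<dots> \<le> \<epsilon> / 8 * (norm (c z) ^ 2 * norm (c z))"
        using Kc \<epsilon> by (intro mult_left_mono) auto
      also have "\<dots> = \<epsilon> * (norm (c z) ^ 3 / 8)" by (simp add: power3_eq_cube power2_eq_square)
      also have "\<dots> \<le> \<epsilon> * Re (c z ^ 3)" using cube[OF z(1)] \<epsilon> by (intro mult_left_mono) auto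
      finally have *: "ln C' + L * norm z \<le> \<epsilon> * Re (c z ^ 3)" by simp
      have "norm (G z) \<le> C' * exp (L * norm z)"
      proof -
        have "norm (G z) \<le> C * exp (L * norm z)" using growth[of z] z(1) cl by auto
        also have "\<dots> \<le> C' * exp (L * norm z)" by (intro mult_right_mono) (auto simp: C'_def)
        finally show ?thesis .
      qed
      also have "\<dots> = exp (ln C' + L * norm z)" by (simp add: exp_add C'_def)
      also have "\<dots> \<le> exp (\<epsilon> * Re (c z ^ 3))" using * by simp
      also have "\<dots> \<le> M * exp (\<epsilon> * Re (c z ^ 3))" using \<open>M \<ge> 1\<close> by simp
      finally show "norm (G z) \<le> M * exp (\<epsilon> * Re (c z ^ 3))" .
    qed
  qed (use op in auto)
qed (use sides s in auto)

text \<open>For \<open>L > t\<close> the function \<open>exp (- L s) f\<close> is bounded on the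
  positive ray as well as on the imaginary axis, so each quadrant gives a bound by some constant,
  which the half-plane version improves to 1. Letting \<open>L\<close> decrease to \<open>t\<close>
  recovers the exact type.\<close>

lemma Phragmen_Lindelof_exponential_type:
  fixes f :: "complex \<Rightarrow> complex"
  assumes f: "f holomorphic_on UNIV"
    and type: "\<And>L. L > t \<Longrightarrow> \<exists>C. \<forall>s. norm (f s) \<le> C * exp (L * norm s)"
    and axis: "\<And>s. Re s = 0 \<Longrightarrow> norm (f s) \<le> 1"
    and "t \<ge> 0" and s: "Re s \<ge> 0"
  shows "norm (f s) \<le> exp (t * Re s)"
proof -
  have bound: "norm (f s) \<le> exp (L * Re s)" if L: "L > t" for L
  proof -
    obtain C where C: "\<And>s. norm (f s) \<le> C * exp (L * norm s)" using type[OF L] by blast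
    define G where "G = (\<lambda>s. f s * exp (- (of_real L * s)))"
    have norm_G: "norm (G z) = norm (f z) * exp (- (L * Re z))" for z
      by (simp add: G_def norm_mult)
    have holG: "G holomorphic_on S" for S
      unfolding G_def using f by (auto intro!: holomorphic_intros elim: holomorphic_on_subset)
    have contG: "continuous_on S G" for S
      using holG holomorphic_on_imp_continuous_on by blast
    have ax: "norm (G z) \<le> 1" if "Re z = 0" for z using axis[OF that] that by (simp add: norm_G)
    have ray: "norm (G z) \<le> max C 1" if "Im z = 0" "Re z \<ge> 0" for z
    proof -
      have "norm z = Re z" using that by (simp add: cmod_eq_Re)
      then have "norm (G z) \<le> (C * exp (L * Re z)) * exp (- (L * Re z))"
        unfolding norm_G using C[of z] by (intro mult_right_mono) auto
      then show ?thesis by (simp add: exp_minus field_simps)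
    qed
    have gr: "norm (G z) \<le> C * exp (L * norm z)" if "Re z \<ge> 0" for z
    proof -
      have "exp (- (L * Re z)) \<le> 1" using that L \<open>t \<ge> 0\<close> by simp
      then have "norm (G z) \<le> norm (f z)" unfolding norm_G by (simp add: mult_left_le)
      then show ?thesis using C[of z] by simp
    qed
    have up: "norm (G z) \<le> max C 1" if "Re z \<ge> 0" "Im z \<ge> 0" for z
      by (rule Phragmen_Lindelof_quadrant[OF holG contG gr])
        (use that L \<open>t \<ge> 0\<close> ax ray in \<open>auto simp: le_max_iff_disj\<close>)
    \<comment> \<open>Reflection in the real axis carries the lower quadrant to the upper
      one.\<close>
    define G' where "G' = (\<lambda>s. cnj (G (cnj s)))"
    have holG': "G' holomorphic_on S" for S
      using holomorphic_on_compose_cnj_cnj[OF holG, of UNIV]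
      by (auto simp: G'_def o_def elim: holomorphic_on_subset)
    have contG': "continuous_on S G'" for S
      using holG' holomorphic_on_imp_continuous_on by blast
    have gr': "norm (G' z) \<le> C * exp (L * norm z)" if "Re z \<ge> 0" for z
      using gr[of "cnj z"] that by (simp add: G'_def)
    have down: "norm (G' z) \<le> max C 1" if "Re z \<ge> 0" "Im z \<ge> 0" for z
      by (rule Phragmen_Lindelof_quadrant[OF holG' contG' gr'])
        (use that L \<open>t \<ge> 0\<close> ax ray in \<open>auto simp: G'_def le_max_iff_disj\<close>)
    have all: "norm (G z) \<le> max C 1" if "Re z \<ge> 0" for z
      using up[of z] down[of "cnj z"] that by (cases "Im z \<ge> 0") (auto simp: G'_def)
    have "norm (G s) \<le> 1"
      by (rule Phragmen_Lindelof_half_plane_bounded[OF holG contG all ax s])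
    then have "norm (G s) * exp (L * Re s) \<le> 1 * exp (L * Re s)"
      by (intro mult_right_mono) auto
    then show ?thesis by (simp add: norm_G exp_minus field_simps)
  qed
  have lim: "((\<lambda>L. exp (L * Re s)) \<longlongrightarrow> exp (t * Re s)) (at_right t)"
    by (intro tendsto_intros)
  show ?thesis
    by (rule tendsto_lowerbound[OF lim])
      (auto intro!: eventually_mono[OF eventually_at_right_less] bound)
qed

section \<open>Means over circles\<close>

definition unit_circle :: "real \<Rightarrow> complex" where
  "unit_circle x = exp (2 * of_real pi * \<i> * of_real x)"

lemma norm_unit_circle [simp]: "norm (unit_circle x) = 1"
  by (simp add: unit_circle_def)

lemma unit_circle_neq_1: "0 < x \<Longrightarrow> x < 1 \<Longrightarrow> unit_circle x \<noteq> 1"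
proof
  assume x: "0 < x" "x < 1" and "unit_circle x = 1"
  then obtain n :: int where "2 * pi * x = of_int (2 * n) * pi"
    by (auto simp: unit_circle_def exp_eq_1)
  then have "x = of_int n" by (simp add: field_simps)
  then show False using x by simp
qed

lemma unit_circle_one_minus: "unit_circle (1 - x) = cnj (unit_circle x)"
proof -
  have "unit_circle (1 - x) = exp (2 * of_real pi * \<i>) * exp (- (2 * of_real pi * \<i> * of_real x))"
    unfolding unit_circle_def exp_add[symmetric] by (simp add: algebra_simps)
  then show ?thesis by (simp add: unit_circle_def exp_cnj)
qed

lemma continuous_on_unit_circle [continuous_intros]: "continuous_on S unit_circle"
  unfolding unit_circle_def by (intro continuous_intros)

text \<open>The integral of \<open>q\<close> against \<open>dw / (2 \<pi> i w)\<close>. The open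
  interval leaves out the point \<open>w = a\<close>, so for \<open>a = 1\<close> nothing is asked
  at \<open>w = 1\<close>, the image of infinity.\<close>

definition circle_mean :: "(complex \<Rightarrow> complex) \<Rightarrow> real \<Rightarrow> complex" where
  "circle_mean q a = integral {0<..<1} (\<lambda>x. q (of_real a * unit_circle x))"

lemma circle_mean_eq_contour_integral:
  assumes "\<And>w. norm w = a \<Longrightarrow> q w = w * f w" "a \<ge> 0"
  shows "circle_mean q a = contour_integral (circlepath 0 a) f / (2 * of_real pi * \<i>)"
proof -
  have "contour_integral (circlepath 0 a) f
      = integral {0..1} (\<lambda>x. (2 * of_real pi * \<i>) * q (of_real a * unit_circle x))"
    unfolding contour_integral_integral
  proof (intro integral_cong)
    fix x :: real
    have "circlepath 0 a x = of_real a * unit_circle x" by (simp add: circlepath unit_circle_def)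
    then show "f (circlepath 0 a x) * vector_derivative (circlepath 0 a) (at x)
        = (2 * of_real pi * \<i>) * q (of_real a * unit_circle x)"
      using assms by (simp add: vector_derivative_circlepath norm_mult flip: unit_circle_def)
  qed
  also have "\<dots> = (2 * of_real pi * \<i>) * circle_mean q a"
    by (simp add: circle_mean_def integral_open_interval_real)
  finally show ?thesis by simp
qed

lemma circle_mean_annulus:
  assumes q: "q holomorphic_on {w. b < norm w \<and> norm w < c}"
    and "0 \<le> b" "b < a" "a < c" "b < a'" "a' < c"
  shows "circle_mean q a = circle_mean q a'"
proof -
  define S where "S = {w::complex. b < norm w \<and> norm w < c}"
  have op: "open S"
    unfolding S_def by (intro open_Collect_conj open_Collect_less continuous_intros)
  have hol: "(\<lambda>w. q w / w) holomorphic_on S"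
    using q \<open>0 \<le> b\<close> unfolding S_def by (auto intro!: holomorphic_intros)
  have seg: "closed_segment (of_real a * u) (of_real a' * u) \<subseteq> S" if "norm u = 1" for u :: complex
  proof
    fix w assume "w \<in> closed_segment (of_real a * u) (of_real a' * u)"
    then obtain t where t: "0 \<le> t" "t \<le> 1" "w = (1 - t) *\<^sub>R (of_real a * u) + t *\<^sub>R (of_real a' * u)"
      by (auto simp: in_segment)
    have w: "w = of_real ((1 - t) * a + t * a') * u"
      by (simp add: t(3) scaleR_conv_of_real algebra_simps)
    have "b < (1 - t) * a + t * a'" using convex_bound_lt[of "-a" "-b" "-a'" "1-t" t] t assms by simp
    moreover have "(1 - t) * a + t * a' < c" using convex_bound_lt[of a c a' "1-t" t] t assms by simp
    ultimately show "w \<in> S" using \<open>0 \<le> b\<close> that by (simp add: S_def w norm_mult del: of_real_add of_real_mult)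
  qed
  have "contour_integral (circlepath 0 a) (\<lambda>w. q w / w) = contour_integral (circlepath 0 a') (\<lambda>w. q w / w)"
  proof (rule Cauchy_theorem_homotopic_loops[OF _ op hol])
    show "homotopic_loops S (circlepath 0 a) (circlepath 0 a')"
    proof (rule homotopic_loops_linear)
      fix t :: real
      have "norm (exp (2 * of_real pi * \<i> * of_real t)) = 1" by simp
      from seg[OF this] show "closed_segment (circlepath 0 a t) (circlepath 0 a' t) \<subseteq> S"
        by (simp add: circlepath)
    qed auto
  qed auto
  then show ?thesis
    using assms by (subst (1 2) circle_mean_eq_contour_integral[where f="\<lambda>w. q w / w"]) auto
qed

lemma integrable_on_unit_interval:
  fixes f :: "real \<Rightarrow> 'a::euclidean_space"
  assumes "continuous_on {0<..<1} f" "\<And>x. 0 < x \<Longrightarrow> x < 1 \<Longrightarrow> norm (f x) \<le> C"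
  shows "f integrable_on {0<..<1}"
proof (rule measurable_bounded_by_integrable_imp_integrable[where g="\<lambda>_. C"])
  show "f \<in> borel_measurable (lebesgue_on {0<..<1})"
    by (rule continuous_imp_measurable_on_sets_lebesgue[OF assms(1)]) auto
  show "(\<lambda>_. C) integrable_on {0<..<1::real}"
    using integrable_const_ivl[of C 0 "1::real"] by (simp add: integrable_on_Icc_iff_Ioo)
qed (use assms in auto)

lemma integral_unit_interval_reflect:
  fixes f :: "real \<Rightarrow> 'a::euclidean_space"
  shows "integral {0<..<1} (\<lambda>x. f (1 - x)) = integral {0<..<1} f"
proof -
  have "integral {-1..0} (\<lambda>x. f (- x)) = integral {0..1} f"
    using Henstock_Kurzweil_Integration.integral_reflect_real[of 1 0 f] by simp
  moreover have "integral {0..1} (\<lambda>x. f (1 - x)) = integral {-1..0} (\<lambda>x. f (- x))"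
    using integral_shift_Icc_real[of 0 1 "\<lambda>x. f (-x)" "-1"] by (simp add: o_def)
  ultimately show ?thesis by (simp add: integral_open_interval_real)
qed

text \<open>Boundedness near the exceptional point replaces continuity there: the means over circles
  of radius \<open>\<rho> n\<close> are all equal, and dominated convergence passes to the unit
  circle.\<close>

lemma circle_mean_boundary:
  assumes q: "q holomorphic_on {w. b < norm w \<and> norm w < 1}"
    and cont: "continuous_on ({w. b < norm w \<and> norm w \<le> 1} - {1}) q"
    and b: "0 \<le> b" "b < a" "a < 1"
    and bound: "\<And>w. a \<le> norm w \<Longrightarrow> norm w \<le> 1 \<Longrightarrow> w \<noteq> 1 \<Longrightarrow> norm (q w) \<le> C"
  shows "circle_mean q 1 = circle_mean q a"
proof -
  define \<rho> where "\<rho> = (\<lambda>n. 1 - (1 - a) / real (Suc n))"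
  have \<rho>: "a \<le> \<rho> n" "\<rho> n < 1" for n
  proof -
    have "(1 - a) / real (Suc n) \<le> (1 - a) / 1" using b by (intro divide_left_mono) auto
    then show "a \<le> \<rho> n" by (simp add: \<rho>_def)
    show "\<rho> n < 1" using b by (simp add: \<rho>_def)
  qed
  have \<rho>0: "0 \<le> \<rho> n" for n using \<rho>(1)[of n] b by simp
  have "(\<lambda>n. (1 - a) * inverse (real (Suc n))) \<longlonglongrightarrow> (1 - a) * 0"
    by (intro tendsto_intros LIMSEQ_inverse_real_of_nat)
  from tendsto_diff[OF tendsto_const[of 1] this] have lim\<rho>: "\<rho> \<longlonglongrightarrow> 1"
    by (simp add: \<rho>_def divide_inverse)
  define f where "f = (\<lambda>n x. q (of_real (\<rho> n) * unit_circle x))"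
  have norm_w: "norm (of_real (\<rho> n) * unit_circle x) = \<rho> n" for n x
    using \<rho>0[of n] by (simp add: norm_mult)
  have cq: "continuous_on {w. b < norm w \<and> norm w < 1} q"
    using q by (rule holomorphic_on_imp_continuous_on)
  have fb: "norm (f n x) \<le> C" for n x
    unfolding f_def using norm_w[of n x] \<rho>[of n] by (intro bound) auto
  have int: "f n integrable_on {0<..<1}" for n
  proof (rule integrable_on_unit_interval)
    show "continuous_on {0<..<1} (f n)"
      unfolding f_def
      by (rule continuous_on_compose2[OF cq]) (use norm_w \<rho> b in \<open>auto intro!: continuous_intros intro: less_le_trans\<close>)
  qed (use fb in auto)
  have pt: "(\<lambda>n. f n x) \<longlonglongrightarrow> q (unit_circle x)" if x: "x \<in> {0<..<1}" for x
    unfolding f_def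
  proof (rule continuous_on_tendsto_compose[OF cont])
    have "(\<lambda>n. of_real (\<rho> n) * unit_circle x) \<longlonglongrightarrow> of_real 1 * unit_circle x"
      by (intro tendsto_intros lim\<rho>)
    then show "(\<lambda>n. of_real (\<rho> n) * unit_circle x) \<longlonglongrightarrow> unit_circle x" by simp
    show "unit_circle x \<in> {w. b < norm w \<and> norm w \<le> 1} - {1}"
      using x b unit_circle_neq_1[of x] by auto
    show "\<forall>\<^sub>F n in sequentially. of_real (\<rho> n) * unit_circle x \<in> {w. b < norm w \<and> norm w \<le> 1} - {1}"
    proof (intro always_eventually allI)
      fix n show "of_real (\<rho> n) * unit_circle x \<in> {w. b < norm w \<and> norm w \<le> 1} - {1}"
        using norm_w[of n x] \<rho>[of n] b by auto
    qed
  qed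
  have "(\<lambda>n. integral {0<..<1} (f n)) \<longlonglongrightarrow> integral {0<..<1} (\<lambda>x. q (unit_circle x))"
  proof (rule dominated_convergence(2)[where h="\<lambda>_. C"])
    show "(\<lambda>_. C) integrable_on {0<..<1::real}"
      using integrable_const_ivl[of C 0 "1::real"] by (simp add: integrable_on_Icc_iff_Ioo)
  qed (use int fb pt in auto)
  moreover have "integral {0<..<1} (f n) = circle_mean q a" for n
    using circle_mean_annulus[OF q, of "\<rho> n" a] \<rho>[of n] b by (simp add: circle_mean_def f_def)
  ultimately show ?thesis
    by (simp add: circle_mean_def tendsto_const_iff LIMSEQ_const_iff)
qed

lemma norm_circle_mean_le:
  assumes "\<And>w. norm w = a \<Longrightarrow> norm (q w) \<le> C" "a \<ge> 0"
    and "continuous_on (sphere 0 a) q"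
  shows "norm (circle_mean q a) \<le> C"
proof -
  have "norm (circle_mean q a) \<le> integral {0<..<1::real} (\<lambda>_. C)"
    unfolding circle_mean_def
  proof (rule integral_norm_bound_integral)
    show "(\<lambda>x. q (of_real a * unit_circle x)) integrable_on {0<..<1}"
    proof (rule integrable_on_unit_interval)
      show "continuous_on {0<..<1} (\<lambda>x. q (of_real a * unit_circle x))"
        by (rule continuous_on_compose2[OF assms(3)])
          (use assms in \<open>auto intro!: continuous_intros simp: norm_mult\<close>)
      show "norm (q (of_real a * unit_circle x)) \<le> C" for x
        using assms by (auto simp: norm_mult)
    qed
    show "(\<lambda>_. C) integrable_on {0<..<1::real}"
      using integrable_const_ivl[of C 0 "1::real"] by (simp add: integrable_on_Icc_iff_Ioo)
  qed (use assms in \<open>auto simp: norm_mult\<close>)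
  also have "\<dots> = C"
    using integral_open_interval_real[of 0 1 "\<lambda>_. C"] by simp
  finally show ?thesis .
qed

section \<open>The upper bound\<close>

lemma norm_sum_sum_minus_le:
  fixes F :: "nat \<Rightarrow> nat \<Rightarrow> complex"
  assumes "\<And>j l. j < N \<Longrightarrow> l < N \<Longrightarrow> norm (F j l - (if P j l then c else 0)) \<le> e"
  shows "norm ((\<Sum>j<N. \<Sum>l<N. F j l) - (\<Sum>j<N. \<Sum>l<N. if P j l then c else 0)) \<le> real N * (real N * e)"
proof -
  have "norm (\<Sum>j<N. \<Sum>l<N. F j l - (if P j l then c else 0)) \<le> (\<Sum>j<N. \<Sum>l<N. e)"
    using assms by (intro sum_norm_le) auto
  then show ?thesis by (simp add: sum_subtractf)
qed

text \<open>\<open>g\<close> stands for \<open>\<beta> f\<close> with \<open>f\<close> even. On the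
  unit circle the reflection \<open>s \<mapsto> -s\<close> is conjugation, and \<open>sym\<close> is
  \<open>f (cnj w) = f w\<close> multiplied by both values of \<open>\<beta>\<close>. The point 1 is
  infinity and \<open>\<i> * r\<close> is \<open>\<lambda>\<close>. The exponent of
  \<open>\<beta>\<close> is seen only through \<open>\<delta>\<close>.\<close>

locale symmetric_boundary =
  fixes r \<rho> \<delta> :: real and g \<beta> :: "complex \<Rightarrow> complex"
  assumes r\<rho>: "\<bar>r\<bar> < \<rho>" "\<rho> < 1"
    and holg: "g holomorphic_on ball 0 1" and contg: "continuous_on (cball 0 1 - {1}) g"
    and hol\<beta>: "\<beta> holomorphic_on ball 0 1" and cont\<beta>: "continuous_on (cball 0 1 - {1}) \<beta>"
    and norm_g: "\<And>w. norm w \<le> 1 \<Longrightarrow> w \<noteq> 1 \<Longrightarrow> norm (g w) \<le> 1"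
    and norm_\<beta>: "\<And>w. norm w \<le> 1 \<Longrightarrow> w \<noteq> 1 \<Longrightarrow> norm (\<beta> w) \<le> 1"
    and inner: "\<And>w. norm w = 1 \<Longrightarrow> w \<noteq> 1 \<Longrightarrow> norm (\<beta> w) = 1"
    and sym: "\<And>w. norm w = 1 \<Longrightarrow> w \<noteq> 1 \<Longrightarrow> g (cnj w) * \<beta> w = g w * \<beta> (cnj w)"
    and zero: "g (\<i> * of_real r) = 0"
    and small: "\<And>w. norm w \<le> \<rho> \<Longrightarrow> norm (\<beta> w) \<le> \<delta>"
    and \<delta>: "\<delta> \<le> 1"
begin

section \<open>Kernel, phase and weight on an annulus\<close>

definition "w0 = \<i> * complex_of_real r"
text \<open>For \<open>r \<noteq> 0\<close> its zeros \<open>w0\<close> and \<open>1/w0\<close> are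
  the images of \<open>\<lambda>\<close> and \<open>-\<lambda>\<close>. Using both makes
  \<open>D\<close> reproduce itself, up to \<open>w^2\<close>, under
  \<open>w \<mapsto> 1/w\<close>.\<close>

definition "D w = (w - w0) * (1 - w * w0)"
text \<open>The mirror image of \<open>D\<close>: on the unit circle
  \<open>cnj (D w) = D' w / w^2\<close>.\<close>

definition "D' w = (w + w0) * (1 + w * w0)"
text \<open>On the circle this is the unimodular phase
  \<open>\<beta> w / (\<beta> (cnj w) w^2)\<close>; \<open>cnj (\<beta> (cnj w))\<close> is the form
  that stays holomorphic inside. The power \<open>w^2\<close> is forced by
  \<open>K_cnj\<close>.\<close>

definition "V w = \<beta> w * cnj (\<beta> (cnj w)) / w\<^sup>2"
text \<open>The factor \<open>w\<close> cancels the \<open>1/w\<close> of the circle mean, so the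
  mean of \<open>K\<close> is the contour integral of \<open>g / D^2\<close> over
  \<open>2 \<pi> i\<close>. In the half-plane this is integration against the dual density.\<close>

definition "K w = g w * w / (D w)\<^sup>2"
text \<open>The holomorphic continuation of \<open>1 / |D|^2\<close>, which dominates
  \<open>|K|\<close> on the unit circle.\<close>

definition "M w = w\<^sup>2 / (D w * D' w)"
definition "d = (\<rho> - \<bar>r\<bar>) * (1 - \<bar>r\<bar>)"

lemma norm_w0: "norm w0 = \<bar>r\<bar>" by (simp add: w0_def norm_mult)

lemma r1: "\<bar>r\<bar> < 1" "0 < \<rho>" using r\<rho> by auto

lemma \<delta>_nonneg: "0 \<le> \<delta>"
  using order_trans[OF norm_ge_zero small[of 0]] r1 by simp

lemma d_pos: "d > 0" using r\<rho> by (simp add: d_def)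

lemma D_bounds:
  assumes "\<rho> \<le> norm w" "norm w \<le> 1"
  shows "d \<le> norm (D w)" "d \<le> norm (D' w)"
proof -
  have *: "d \<le> norm (w + z * w0) * norm (1 + z * (w * w0))" if "norm z = 1" for z
    unfolding d_def
  proof (rule mult_mono)
    show "\<rho> - \<bar>r\<bar> \<le> norm (w + z * w0)"
      using norm_triangle_ineq2[of w "- (z * w0)"] assms that by (simp add: norm_mult norm_w0)
    have "norm (w * w0) \<le> \<bar>r\<bar>" using assms by (simp add: norm_mult norm_w0 mult_left_le_one_le)
    then show "1 - \<bar>r\<bar> \<le> norm (1 + z * (w * w0))"
      using norm_triangle_ineq2[of 1 "- (z * (w * w0))"] that by (simp add: norm_mult[of z])
  qed (use r\<rho> in auto)
  show "d \<le> norm (D w)" using *[of "-1"] by (simp add: D_def norm_mult)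
  show "d \<le> norm (D' w)" using *[of 1] by (simp add: D'_def norm_mult)
qed

lemma D_nonzero:
  assumes "\<bar>r\<bar> < norm w" "norm w \<le> 1"
  shows "D w \<noteq> 0" "D' w \<noteq> 0"
proof -
  have "norm w * \<bar>r\<bar> \<le> 1 * \<bar>r\<bar>" using assms by (intro mult_right_mono) auto
  then have "norm (w * w0) < 1" using r1 by (simp add: norm_mult norm_w0)
  then have "w * w0 \<noteq> 1" "w * w0 \<noteq> -1" by auto
  moreover have "w \<noteq> w0" "w \<noteq> - w0" using assms norm_w0 by auto
  ultimately show "D w \<noteq> 0" "D' w \<noteq> 0"
    by (auto simp: D_def D'_def eq_neg_iff_add_eq_0 add.commute)
qed

abbreviation "annulus \<equiv> {w::complex. \<bar>r\<bar> < norm w \<and> norm w < 1}"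
abbreviation "cannulus \<equiv> {w::complex. \<bar>r\<bar> < norm w \<and> norm w \<le> 1} - {1}"

lemma hol_V: "V holomorphic_on annulus"
proof -
  have "(cnj \<circ> \<beta> \<circ> cnj) holomorphic_on ball 0 1"
    using hol\<beta> by (intro holomorphic_on_compose_cnj_cnj) (auto elim: holomorphic_on_subset)
  then have "(\<lambda>w. cnj (\<beta> (cnj w))) holomorphic_on annulus"
    by (auto simp: o_def elim: holomorphic_on_subset)
  moreover have "\<beta> holomorphic_on annulus" using hol\<beta> by (auto elim: holomorphic_on_subset)
  ultimately show ?thesis unfolding V_def by (intro holomorphic_intros) auto
qed

lemma hol_K: "K holomorphic_on annulus"
  unfolding K_def D_def
  by (intro holomorphic_intros holomorphic_on_subset[OF holg]) (use D_nonzero in \<open>auto simp: D_def\<close>)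

lemma hol_M: "M holomorphic_on annulus"
  unfolding M_def D_def D'_def
  by (intro holomorphic_intros) (use D_nonzero in \<open>auto simp: D_def D'_def\<close>)

lemma cont_V: "continuous_on cannulus V"
proof -
  have 1: "continuous_on cannulus \<beta>" using cont\<beta> by (auto elim: continuous_on_subset)
  have "continuous_on cannulus (\<lambda>w. \<beta> (cnj w))"
    by (rule continuous_on_compose2[OF cont\<beta>]) (auto intro!: continuous_intros simp: complex_cnj_cancel_iff[of _ 1, simplified])
  then show ?thesis unfolding V_def using 1 by (intro continuous_intros) auto
qed

lemma cont_K: "continuous_on cannulus K"
  unfolding K_def D_def
  by (intro continuous_intros continuous_on_subset[OF contg]) (use D_nonzero in \<open>auto simp: D_def\<close>)

lemma cont_M: "continuous_on cannulus M"
  unfolding M_def D_def D'_def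
  by (intro continuous_intros) (use D_nonzero in \<open>auto simp: D_def D'_def\<close>)

lemma cnj_neq_1: "w \<noteq> 1 \<Longrightarrow> cnj w \<noteq> 1"
  by (metis complex_cnj_cnj complex_cnj_one)

lemma norm_V_le:
  assumes "\<rho> \<le> norm w" "norm w \<le> 1" "w \<noteq> 1"
  shows "norm (V w) \<le> 1 / \<rho>\<^sup>2"
proof -
  have "norm (\<beta> w) * norm (\<beta> (cnj w)) \<le> 1 * 1"
    using assms cnj_neq_1 by (intro mult_mono norm_\<beta>) auto
  moreover have "\<rho>\<^sup>2 \<le> (norm w)\<^sup>2" using assms r1 by (intro power_mono) auto
  ultimately show ?thesis unfolding V_def norm_divide norm_mult norm_power complex_mod_cnj
    using r1 by (intro frac_le) auto
qed

lemma norm_V_small: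
  assumes "norm w = \<rho>"
  shows "norm (V w) \<le> \<delta> / \<rho>\<^sup>2"
proof -
  have "norm (\<beta> w) * norm (\<beta> (cnj w)) \<le> \<delta> * 1"
    using assms r\<rho> \<delta>_nonneg small[of w] cnj_neq_1[of w] by (intro mult_mono norm_\<beta>) auto
  then show ?thesis unfolding V_def norm_divide norm_mult norm_power complex_mod_cnj assms
    by (intro divide_right_mono) auto
qed

lemma norm_K_le:
  assumes "\<rho> \<le> norm w" "norm w \<le> 1" "w \<noteq> 1"
  shows "norm (K w) \<le> 1 / d\<^sup>2"
proof -
  have "norm (g w) * norm w \<le> 1 * 1" using assms by (intro mult_mono norm_g) auto
  moreover have "d\<^sup>2 \<le> (norm (D w))\<^sup>2" using D_bounds assms d_pos by (intro power_mono) auto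
  ultimately show ?thesis unfolding K_def norm_divide norm_mult norm_power
    using d_pos by (intro frac_le) auto
qed

lemma norm_M_le:
  assumes "\<rho> \<le> norm w" "norm w \<le> 1"
  shows "norm (M w) \<le> 1 / d\<^sup>2"
proof -
  have "(norm w)\<^sup>2 \<le> 1" using assms by (simp add: power_le_one)
  moreover have "d\<^sup>2 \<le> norm (D w) * norm (D' w)" unfolding power2_eq_square
    using D_bounds assms d_pos by (intro mult_mono) auto
  ultimately show ?thesis unfolding M_def norm_divide norm_mult norm_power
    using d_pos by (intro frac_le) auto
qed

text \<open>The contour may shrink to radius \<open>\<rho>\<close>, where every \<open>V\<close>
  carries a factor \<open>\<delta>\<close>. One such factor suffices, hence
  \<open>k \<ge> 1\<close>, and \<open>k \<le> N\<close> keeps the loss \<open>\<rho>^(-2k)\<close>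
  under control.\<close>

lemma circle_mean_power_small:
  assumes G: "G holomorphic_on annulus" "continuous_on cannulus G"
    and bound: "\<And>w. \<rho> \<le> norm w \<Longrightarrow> norm w \<le> 1 \<Longrightarrow> w \<noteq> 1 \<Longrightarrow> norm (G w) \<le> 1 / d\<^sup>2"
    and k: "1 \<le> k" "k \<le> N"
  shows "norm (circle_mean (\<lambda>w. G w * V w ^ k) 1) \<le> \<delta> / (d\<^sup>2 * \<rho> ^ (2 * N))"
proof -
  have "circle_mean (\<lambda>w. G w * V w ^ k) 1 = circle_mean (\<lambda>w. G w * V w ^ k) \<rho>"
  proof (rule circle_mean_boundary[where b="\<bar>r\<bar>" and C="1 / d\<^sup>2 * (1 / \<rho>\<^sup>2) ^ k"])
    show "norm (G w * V w ^ k) \<le> 1 / d\<^sup>2 * (1 / \<rho>\<^sup>2) ^ k" if "\<rho> \<le> norm w" "norm w \<le> 1" "w \<noteq> 1" for w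
      unfolding norm_mult norm_power using that
      by (intro mult_mono power_mono bound norm_V_le) auto
  qed (use G hol_V cont_V r\<rho> in \<open>auto intro!: holomorphic_intros continuous_intros\<close>)
  moreover have "norm (circle_mean (\<lambda>w. G w * V w ^ k) \<rho>) \<le> 1 / d\<^sup>2 * (\<delta> / \<rho>\<^sup>2) ^ k"
  proof (rule norm_circle_mean_le)
    show "norm (G w * V w ^ k) \<le> 1 / d\<^sup>2 * (\<delta> / \<rho>\<^sup>2) ^ k" if "norm w = \<rho>" for w
      unfolding norm_mult norm_power using that r\<rho>
      by (intro mult_mono power_mono bound norm_V_small) auto
    show "continuous_on (sphere 0 \<rho>) (\<lambda>w. G w * V w ^ k)"
      using G(2) cont_V r\<rho> by (intro continuous_intros) (auto elim!: continuous_on_subset)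
  qed (use r1 in auto)
  moreover have "1 / d\<^sup>2 * (\<delta> / \<rho>\<^sup>2) ^ k \<le> \<delta> / (d\<^sup>2 * \<rho> ^ (2 * N))"
  proof -
    have "\<delta> ^ k \<le> \<delta> ^ 1" using \<delta> \<delta>_nonneg k by (intro power_decreasing) auto
    moreover have "\<rho> ^ (2 * N) \<le> \<rho> ^ (2 * k)" using r\<rho> r1 k by (intro power_decreasing) auto
    ultimately have "\<delta> ^ k / (d\<^sup>2 * \<rho> ^ (2 * k)) \<le> \<delta> / (d\<^sup>2 * \<rho> ^ (2 * N))"
      using d_pos r1 \<delta>_nonneg by (intro frac_le mult_left_mono mult_pos_pos) auto
    then show ?thesis by (simp add: power_divide power_mult)
  qed
  ultimately show ?thesis by simp
qed

text \<open>The double pole at \<open>w0\<close> produces the derivative of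
  \<open>g / (1 - u w0)^2\<close>. As \<open>g\<close> vanishes at \<open>w0\<close>, only
  \<open>g'\<close> survives, over \<open>(1 - w0^2)^2 = (1 + r^2)^2\<close>.\<close>

lemma circle_mean_K: "circle_mean K 1 = deriv g w0 / (of_real ((1 + r\<^sup>2)\<^sup>2))"
proof -
  have "circle_mean K 1 = circle_mean K \<rho>"
    by (rule circle_mean_boundary[where b="\<bar>r\<bar>"]) (use hol_K cont_K norm_K_le r\<rho> in auto)
  also have "\<dots> = contour_integral (circlepath 0 \<rho>) (\<lambda>u. (g u / (1 - u * w0)\<^sup>2) / (u - w0)\<^sup>2) / (2 * of_real pi * \<i>)"
    by (rule circle_mean_eq_contour_integral) (use r1 in \<open>auto simp: K_def D_def power_mult_distrib mult_ac\<close>)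
  also have "\<dots> = deriv (\<lambda>u. g u / (1 - u * w0)\<^sup>2) w0"
  proof -
    have ne: "1 - u * w0 \<noteq> 0" if "norm u < 1" for u
    proof
      assume "1 - u * w0 = 0"
      then have "norm (u * w0) = 1" by simp
      then show False using that r1 mult_strict_mono[of "norm u" 1 "\<bar>r\<bar>" 1] by (simp add: norm_mult norm_w0)
    qed
    have hol: "(\<lambda>u. g u / (1 - u * w0)\<^sup>2) holomorphic_on ball 0 1"
      by (intro holomorphic_intros holg) (use ne in auto)
    have "((\<lambda>u. g u / (1 - u * w0)\<^sup>2) has_field_derivative
        1 / (2 * of_real pi * \<i>) * contour_integral (circlepath 0 \<rho>) (\<lambda>u. (g u / (1 - u * w0)\<^sup>2) / (u - w0)\<^sup>2)) (at w0)"
      using hol r\<rho> norm_w0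
      by (intro Cauchy_derivative_integral_circlepath(2))
        (auto intro!: holomorphic_on_imp_continuous_on elim!: holomorphic_on_subset)
    then show ?thesis by (simp add: DERIV_imp_deriv)
  qed
  also have "\<dots> = deriv g w0 / (of_real ((1 + r\<^sup>2)\<^sup>2))"
  proof -
    have "g field_differentiable at w0"
      using norm_w0 r1 by (intro holomorphic_on_imp_differentiable_at[OF holg]) auto
    then have g': "(g has_field_derivative deriv g w0) (at w0)" by (simp add: field_differentiable_derivI)
    have w02: "w0 * w0 = - of_real (r\<^sup>2)" by (simp add: w0_def complex_eq_iff power2_eq_square)
    have ne: "1 - w0 * w0 = of_real (1 + r\<^sup>2)" by (simp add: w02)
    have pos: "1 + r\<^sup>2 \<noteq> 0" by (smt (verit) zero_le_power2)
    have h': "((\<lambda>u. (1 - u * w0)\<^sup>2) has_field_derivative - 2 * w0 * (1 - w0 * w0)) (at w0)"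
      by (auto intro!: derivative_eq_intros)
    have "((\<lambda>u. g u / (1 - u * w0)\<^sup>2) has_field_derivative
        (deriv g w0 * (1 - w0 * w0)\<^sup>2 - g w0 * (- 2 * w0 * (1 - w0 * w0))) / ((1 - w0 * w0)\<^sup>2 * (1 - w0 * w0)\<^sup>2)) (at w0)"
      using pos by (intro DERIV_divide g' h') (simp add: ne del: of_real_add)
    then have "deriv (\<lambda>u. g u / (1 - u * w0)\<^sup>2) w0
        = (deriv g w0 * (1 - w0 * w0)\<^sup>2) / ((1 - w0 * w0)\<^sup>2 * (1 - w0 * w0)\<^sup>2)"
      using zero by (simp add: DERIV_imp_deriv w0_def)
    also have "\<dots> = deriv g w0 / (of_real ((1 + r\<^sup>2)\<^sup>2))"
    proof -
      have "of_real (1 + r\<^sup>2) \<noteq> (0::complex)" using pos by (simp del: of_real_add)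
      then show ?thesis unfolding ne by (simp add: field_simps del: of_real_add)
    qed
    finally show ?thesis .
  qed
  finally show ?thesis .
qed

text \<open>The auxiliary \<open>h\<close> splits \<open>M w / w\<close> into two Cauchy integrals,
  at \<open>w0\<close> and \<open>- w0\<close>, with equal values because \<open>h\<close> is even;
  \<open>w0^4 = r^4\<close> gives the result.\<close>

lemma circle_mean_M: "circle_mean M 1 = of_real (1 / (1 - r ^ 4))"
proof -
  define h where "h = (\<lambda>u. 1 / (2 * (1 - u\<^sup>2 * w0\<^sup>2)))"
  have w02: "w0\<^sup>2 = - of_real (r\<^sup>2)" by (simp add: w0_def power_mult_distrib)
  have ne: "1 - u\<^sup>2 * w0\<^sup>2 \<noteq> 0" if "norm u < 1" for u
  proof
    assume "1 - u\<^sup>2 * w0\<^sup>2 = 0"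
    then have "norm ((u * w0)\<^sup>2) = 1" by (simp add: power_mult_distrib)
    then have "norm (u * w0) = 1" by (simp add: norm_power power2_eq_1_iff) (smt (verit) norm_ge_zero)
    then show False using that r1 mult_strict_mono[of "norm u" 1 "\<bar>r\<bar>" 1] by (simp add: norm_mult norm_w0)
  qed
  have hol: "h holomorphic_on ball 0 1"
    unfolding h_def by (intro holomorphic_intros) (use ne in auto)
  have cont: "continuous_on (cball 0 \<rho>) h" "h holomorphic_on ball 0 \<rho>"
    using hol r\<rho> by (auto intro!: holomorphic_on_imp_continuous_on elim!: holomorphic_on_subset)
  have c: "((\<lambda>u. h u / (u - z)) has_contour_integral (2 * of_real pi * \<i> * h z)) (circlepath 0 \<rho>)"
    if "norm z = \<bar>r\<bar>" for z
    using that r\<rho> by (intro Cauchy_integral_circlepath cont) auto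
  have "circle_mean M 1 = circle_mean M \<rho>"
    by (rule circle_mean_boundary[where b="\<bar>r\<bar>"]) (use hol_M cont_M norm_M_le r\<rho> in auto)
  also have "\<dots> = contour_integral (circlepath 0 \<rho>) (\<lambda>u. h u / (u - w0) + h u / (u - (- w0))) / (2 * of_real pi * \<i>)"
  proof (rule circle_mean_eq_contour_integral)
    fix w :: complex assume w: "norm w = \<rho>"
    have nz: "w - w0 \<noteq> 0" "w + w0 \<noteq> 0" "1 - w * w0 \<noteq> 0" "1 + w * w0 \<noteq> 0"
      using D_nonzero[of w] w r\<rho> by (auto simp: D_def D'_def)
    have "1 - w\<^sup>2 * w0\<^sup>2 = (1 - w * w0) * (1 + w * w0)" by (simp add: power2_eq_square algebra_simps)
    then have h: "h w = 1 / (2 * ((1 - w * w0) * (1 + w * w0)))" unfolding h_def by (rule arg_cong)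
    have "h w / (w - w0) + h w / (w - - w0) = h w * (2 * w / ((w - w0) * (w + w0)))"
      using nz by (simp add: field_simps)
    then show "M w = w * (h w / (w - w0) + h w / (w - - w0))"
      using nz unfolding M_def D_def D'_def h by (simp add: power2_eq_square)
  qed (use r1 in auto)
  also have "\<dots> = h w0 + h (- w0)"
    using contour_integral_unique[OF has_contour_integral_add[OF c[of w0] c[of "-w0"]]] norm_w0
    by (simp add: field_simps)
  also have "\<dots> = of_real (1 / (1 - r ^ 4))"
  proof -
    have "w0\<^sup>2 * w0\<^sup>2 = of_real (r ^ 4)" by (simp add: w02 flip: of_real_mult power_add)
    then have "h w0 = 1 / (2 * of_real (1 - r ^ 4))" "h (- w0) = 1 / (2 * of_real (1 - r ^ 4))"
      by (simp_all add: h_def)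
    then have "h w0 + h (- w0) = 2 * (1 / (2 * of_real (1 - r ^ 4)))" by (simp only: mult_2)
    also have "\<dots> = 1 / of_real (1 - r ^ 4)"
    proof -
      have "2 * (1 / (2 * z)) = 1 / z" for z :: complex by simp
      then show ?thesis .
    qed
    also have "\<dots> = of_real (1 / (1 - r ^ 4))" by (simp only: of_real_divide of_real_1)
    finally show ?thesis .
  qed
  finally show ?thesis .
qed

section \<open>Reflection symmetries on the unit circle\<close>

lemma cnj_unit:
  assumes "norm w = 1"
  shows "cnj w = 1 / w"
proof -
  have "w * cnj w = 1" using complex_norm_square[of w] assms by simp
  moreover have "w \<noteq> 0" using assms by auto
  ultimately show ?thesis by (simp add: field_simps)
qed

lemma V_cnj: "V (cnj w) = cnj (V w)"
  by (simp add: V_def)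

lemma norm_V_circle:
  assumes "norm w = 1" "w \<noteq> 1"
  shows "norm (V w) = 1"
  using assms inner[of w] inner[of "cnj w"] cnj_neq_1[of w] by (simp add: V_def norm_divide norm_mult norm_power)

lemma D_cnj:
  assumes "norm w = 1"
  shows "cnj (D w) = D' w / w\<^sup>2" "D (cnj w) = D w / w\<^sup>2"
proof -
  have nz: "w \<noteq> 0" using assms by auto
  have c: "cnj w0 = - w0" by (simp add: w0_def)
  show "cnj (D w) = D' w / w\<^sup>2"
    using nz by (simp add: D_def D'_def c cnj_unit[OF assms] field_simps power2_eq_square)
  show "D (cnj w) = D w / w\<^sup>2"
    using nz by (simp add: D_def cnj_unit[OF assms] field_simps power2_eq_square)
qed

lemma M_circle:
  assumes "norm w = 1"
  shows "M w = of_real (1 / (norm (D w))\<^sup>2)"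
proof -
  have nz: "w \<noteq> 0" using assms by auto
  have "of_real ((norm (D w))\<^sup>2) = D w * (D' w / w\<^sup>2)"
    unfolding complex_norm_square D_cnj(1)[OF assms] ..
  then have "of_real (1 / (norm (D w))\<^sup>2) = 1 / (D w * (D' w / w\<^sup>2))"
    by simp
  then show ?thesis using nz by (simp add: M_def)
qed

lemma norm_K_circle:
  assumes "norm w = 1" "w \<noteq> 1"
  shows "norm (K w) \<le> 1 / (norm (D w))\<^sup>2"
  unfolding K_def norm_divide norm_mult norm_power
  using assms norm_g[of w] by (intro divide_right_mono) auto

text \<open>Evenness enters here: reflection multiplies the kernel by \<open>cnj V\<close>, the
  inverse of \<open>V\<close> on the circle, and so shifts the power of \<open>V\<close> by
  one.\<close>

lemma K_cnj:
  assumes "norm w = 1" "w \<noteq> 1"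
  shows "K (cnj w) = K w * cnj (V w)"
proof -
  have nz: "w \<noteq> 0" using assms by auto
  have D: "D w \<noteq> 0" using D_nonzero[of w] assms r1 by auto
  have b: "\<beta> w * cnj (\<beta> w) = 1" using inner[OF assms] complex_norm_square[of "\<beta> w"] by simp
  have g: "g (cnj w) = g w * \<beta> (cnj w) * cnj (\<beta> w)"
  proof -
    have "g (cnj w) = g (cnj w) * (\<beta> w * cnj (\<beta> w))" by (simp add: b)
    also have "\<dots> = (g (cnj w) * \<beta> w) * cnj (\<beta> w)" by simp
    finally show ?thesis by (simp add: sym[OF assms])
  qed
  show ?thesis
    unfolding K_def V_def D_cnj(2)[OF assms(1)] g
    using nz D by (simp add: cnj_unit[OF assms(1)] field_simps power2_eq_square)
qed

abbreviation "\<kappa> x \<equiv> K (unit_circle x)"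
abbreviation "v x \<equiv> V (unit_circle x)"
abbreviation "m x \<equiv> M (unit_circle x)"

lemma v_unit: "0 < x \<Longrightarrow> x < 1 \<Longrightarrow> v x * cnj (v x) = 1"
  using norm_V_circle[of "unit_circle x"] unit_circle_neq_1[of x] complex_norm_square[of "v x"] by simp

lemma v_power_cancel:
  assumes "0 < x" "x < 1"
  shows "v x ^ (l + i) * cnj (v x) ^ l = v x ^ i" "v x ^ l * cnj (v x) ^ (l + i) = cnj (v x) ^ i"
proof -
  have "v x ^ l * cnj (v x) ^ l = 1" using v_unit[OF assms] by (simp flip: power_mult_distrib)
  moreover have "v x ^ (l + i) * cnj (v x) ^ l = (v x ^ l * cnj (v x) ^ l) * v x ^ i"
    "v x ^ l * cnj (v x) ^ (l + i) = (v x ^ l * cnj (v x) ^ l) * cnj (v x) ^ i"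
    by (simp_all only: power_add mult_ac)
  ultimately show "v x ^ (l + i) * cnj (v x) ^ l = v x ^ i" "v x ^ l * cnj (v x) ^ (l + i) = cnj (v x) ^ i"
    by simp_all
qed

lemma integrable_boundary:
  assumes G: "continuous_on cannulus G" "\<And>w. norm w = 1 \<Longrightarrow> w \<noteq> 1 \<Longrightarrow> norm (G w) \<le> C"
  shows "(\<lambda>x. G (unit_circle x) * v x ^ j * cnj (v x) ^ l) integrable_on {0<..<1}"
proof (rule integrable_on_unit_interval)
  have *: "unit_circle ` {0<..<1} \<subseteq> cannulus" using unit_circle_neq_1 r1 by auto
  show "continuous_on {0<..<1} (\<lambda>x. G (unit_circle x) * v x ^ j * cnj (v x) ^ l)"
    by (intro continuous_intros continuous_on_compose2[OF G(1)] continuous_on_compose2[OF cont_V]) (use * in auto)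
  show "norm (G (unit_circle x) * v x ^ j * cnj (v x) ^ l) \<le> C" if "0 < x" "x < 1" for x
    using that G(2)[of "unit_circle x"] norm_V_circle[of "unit_circle x"] unit_circle_neq_1[of x]
    by (simp add: norm_mult norm_power)
qed

text \<open>On the circle \<open>cnj V\<close> is the inverse of \<open>V\<close>, so only the
  difference of the exponents counts; for \<open>l \<le> j\<close> no negative power remains and the
  contour can be moved.\<close>

lemma boundary_integral_ge:
  assumes "l \<le> j"
  shows "integral {0<..<1} (\<lambda>x. G (unit_circle x) * v x ^ j * cnj (v x) ^ l)
    = circle_mean (\<lambda>w. G w * V w ^ (j - l)) 1"
  unfolding circle_mean_def
proof (rule integral_cong)
  fix x :: real assume "x \<in> {0<..<1}"
  then show "G (unit_circle x) * v x ^ j * cnj (v x) ^ l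
      = G (of_real 1 * unit_circle x) * V (of_real 1 * unit_circle x) ^ (j - l)"
    using v_power_cancel(1)[of x l "j - l"] assms by (simp add: mult.assoc)
qed

text \<open>Negative powers of \<open>V\<close> do not become small on smaller circles. The
  reflection \<open>x \<mapsto> 1 - x\<close> makes the exponent positive, and \<open>K_cnj\<close>
  removes one factor. Hence \<open>l - j - 1\<close>: the case \<open>l = j + 1\<close> is not
  negligible but contributes the same mean as the diagonal.\<close>

lemma integral_K_less:
  assumes "j < l"
  shows "integral {0<..<1} (\<lambda>x. \<kappa> x * v x ^ j * cnj (v x) ^ l)
    = circle_mean (\<lambda>w. K w * V w ^ (l - j - 1)) 1"
proof -
  have "integral {0<..<1} (\<lambda>x. \<kappa> x * v x ^ j * cnj (v x) ^ l)
      = integral {0<..<1} (\<lambda>x. (\<lambda>x. \<kappa> x * v x ^ (l - j - 1)) (1 - x))"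
  proof (rule integral_cong)
    fix x :: real assume x: "x \<in> {0<..<1}"
    have "l - j = Suc (l - j - 1)" using assms by simp
    then have "cnj (v x) ^ (l - j) = cnj (v x) * cnj (v x) ^ (l - j - 1)" by (metis power_Suc)
    then show "\<kappa> x * v x ^ j * cnj (v x) ^ l = (\<lambda>x. \<kappa> x * v x ^ (l - j - 1)) (1 - x)"
      using v_power_cancel(2)[of x j "l - j"] assms x K_cnj[of "unit_circle x"] unit_circle_neq_1[of x]
      by (simp add: unit_circle_one_minus V_cnj mult.assoc)
  qed
  also have "\<dots> = circle_mean (\<lambda>w. K w * V w ^ (l - j - 1)) 1"
    using integral_unit_interval_reflect[of "\<lambda>x. \<kappa> x * v x ^ (l - j - 1)"] by (simp add: circle_mean_def)
  finally show ?thesis .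
qed

text \<open>The weight is real on the circle, so conjugation alone makes the exponent positive and
  no factor is lost; only the diagonal will survive.\<close>

lemma integral_M_less:
  assumes "j < l"
  shows "integral {0<..<1} (\<lambda>x. m x * v x ^ j * cnj (v x) ^ l)
    = cnj (circle_mean (\<lambda>w. M w * V w ^ (l - j)) 1)"
proof -
  have "integral {0<..<1} (\<lambda>x. m x * v x ^ j * cnj (v x) ^ l)
      = integral {0<..<1} (\<lambda>x. cnj (m x * v x ^ (l - j)))"
  proof (rule integral_cong)
    fix x :: real assume x: "x \<in> {0<..<1}"
    then show "m x * v x ^ j * cnj (v x) ^ l = cnj (m x * v x ^ (l - j))"
      using v_power_cancel(2)[of x j "l - j"] assms by (simp add: M_circle mult.assoc)
  qed
  also have "\<dots> = cnj (circle_mean (\<lambda>w. M w * V w ^ (l - j)) 1)"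
    unfolding circle_mean_def Henstock_Kurzweil_Integration.integral_cnj by simp
  finally show ?thesis .
qed

section \<open>Fejer averaging\<close>

definition "err N = \<delta> / (d\<^sup>2 * \<rho> ^ (2 * N))"

lemma err_nonneg: "0 \<le> err N"
  unfolding err_def using \<delta>_nonneg r1 by (intro divide_nonneg_nonneg mult_nonneg_nonneg) auto

lemma circle_mean_KV:
  assumes "k < N"
  shows "norm (circle_mean (\<lambda>w. K w * V w ^ k) 1 - (if k = 0 then circle_mean K 1 else 0)) \<le> err N"
  using circle_mean_power_small[of K k N] hol_K cont_K norm_K_le assms err_nonneg[of N]
  by (cases "k = 0") (auto simp: err_def)

lemma circle_mean_MV:
  assumes "k < N"
  shows "norm (circle_mean (\<lambda>w. M w * V w ^ k) 1 - (if k = 0 then circle_mean M 1 else 0)) \<le> err N"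
  using circle_mean_power_small[of M k N] hol_M cont_M norm_M_le assms err_nonneg[of N]
  by (cases "k = 0") (auto simp: err_def)

text \<open>The kernel \<open>\<kappa>\<close> is tested against the Fejer kernel of the unimodular function \<open>v\<close>: of all
  the powers of \<open>v\<close> only two contribute to the left-hand side, and only one to the right-hand side.\<close>
theorem deriv_le_Fejer:
  assumes N: "N \<ge> 1"
  shows "(2 * real N - 1) * (norm (deriv g w0) / (1 + r\<^sup>2)\<^sup>2)
    \<le> real N / (1 - r ^ 4) + 2 * (real N * (real N * err N))"
proof -
  define F where "F = (\<lambda>j l. integral {0<..<1} (\<lambda>x. \<kappa> x * v x ^ j * cnj (v x) ^ l))"
  define H where "H = (\<lambda>j l. integral {0<..<1} (\<lambda>x. m x * v x ^ j * cnj (v x) ^ l))"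
  \<comment> \<open>\<open>|S|^2 / N\<close> is the Fejer kernel in the phase
    \<open>v\<close>.\<close>
  define S where "S = (\<lambda>x. \<Sum>j<N. v x ^ j)"
  define T where "T = circle_mean K 1"
  have intF: "(\<lambda>x. \<kappa> x * v x ^ j * cnj (v x) ^ l) integrable_on {0<..<1}" for j l
    by (rule integrable_boundary[OF cont_K, of "1 / d\<^sup>2"]) (use norm_K_le r\<rho> in auto)
  have intH: "(\<lambda>x. m x * v x ^ j * cnj (v x) ^ l) integrable_on {0<..<1}" for j l
    by (rule integrable_boundary[OF cont_M, of "1 / d\<^sup>2"]) (use norm_M_le r\<rho> in auto)
  have SS: "y * (S x * cnj (S x)) = (\<Sum>j<N. \<Sum>l<N. y * v x ^ j * cnj (v x) ^ l)" for x y
  proof -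
    have "S x * cnj (S x) = (\<Sum>j<N. \<Sum>l<N. v x ^ j * cnj (v x) ^ l)"
      unfolding S_def cnj_sum complex_cnj_power by (rule sum_product)
    then show ?thesis by (simp add: sum_distrib_left mult.assoc)
  qed
  have sumF: "(\<Sum>j<N. \<Sum>l<N. F j l) = integral {0<..<1} (\<lambda>x. \<kappa> x * (S x * cnj (S x)))"
    unfolding SS F_def
    by (simp add: integral_sum integrable_sum intF)
  have sumH: "(\<Sum>j<N. \<Sum>l<N. H j l) = integral {0<..<1} (\<lambda>x. m x * (S x * cnj (S x)))"
    unfolding SS H_def
    by (simp add: integral_sum integrable_sum intH)
  have F: "norm (F j l - (if j = l \<or> l = Suc j then T else 0)) \<le> err N" if "j < N" "l < N" for j l
  proof (cases "l \<le> j")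
    case True
    then show ?thesis using circle_mean_KV[of "j - l" N] that
      by (auto simp: F_def T_def boundary_integral_ge)
  next
    case False
    then show ?thesis using circle_mean_KV[of "l - j - 1" N] that
      by (auto simp: F_def T_def integral_K_less split: if_splits)
  qed
  have H: "norm (H j l - (if j = l then circle_mean M 1 else 0)) \<le> err N" if "j < N" "l < N" for j l
  proof (cases "l \<le> j")
    case True
    then show ?thesis using circle_mean_MV[of "j - l" N] that
      by (auto simp: H_def boundary_integral_ge)
  next
    case False
    then show ?thesis using circle_mean_MV[of "l - j" N] that
      by (auto simp: H_def integral_M_less)
  qed
  have diag: "(\<Sum>j<N. \<Sum>l<N. if j = l then c else 0) = of_nat N * c" for c :: complex
    by (simp add: sum.delta)
  \<comment> \<open>The superdiagonal has only \<open>N - 1\<close> entries, since the last row has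
    no neighbour \<open>l = N\<close>.\<close>
  have offdiag: "(\<Sum>j<N. \<Sum>l<N. if j = l \<or> l = Suc j then c else 0) = of_real (2 * real N - 1) * c" for c :: complex
  proof -
    obtain n where n: "N = Suc n" using N by (cases N) auto
    have "(\<Sum>l<N. if j = l \<or> l = Suc j then c else 0) = c + (if j < n then c else 0)" if "j < N" for j
    proof -
      have "(\<Sum>l<N. if j = l \<or> l = Suc j then c else 0)
          = (\<Sum>l<N. (if l = j then c else 0) + (if l = Suc j then c else 0))"
        by (intro sum.cong) auto
      then show ?thesis using that n by (simp add: sum.distrib)
    qed
    then have "(\<Sum>j<N. \<Sum>l<N. if j = l \<or> l = Suc j then c else 0) = (\<Sum>j<N. c + (if j < n then c else 0))"
      by simp
    also have "\<dots> = of_nat N * c + of_nat n * c"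
      by (simp add: n sum.distrib)
    finally show ?thesis by (simp add: n algebra_simps)
  qed
  have "(2 * real N - 1) * norm T \<le> norm (\<Sum>j<N. \<Sum>l<N. F j l) + real N * (real N * err N)"
  proof -
    have "norm ((\<Sum>j<N. \<Sum>l<N. F j l) - of_real (2 * real N - 1) * T) \<le> real N * (real N * err N)"
      using norm_sum_sum_minus_le[of N F "\<lambda>j l. j = l \<or> l = Suc j" T "err N"] F by (simp only: offdiag)
    moreover have "norm (of_real (2 * real N - 1) * T) = (2 * real N - 1) * norm T"
      unfolding norm_mult norm_of_real using N by simp
    ultimately show ?thesis
      using norm_triangle_ineq2[of "of_real (2 * real N - 1) * T" "\<Sum>j<N. \<Sum>l<N. F j l"]
      by (simp only: norm_minus_commute)
  qed
  \<comment> \<open>On the circle \<open>|K| \<le> M\<close>, and \<open>|S|^2 \<ge> 0\<close>, so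
    the integrands compare pointwise.\<close>
  also have "norm (\<Sum>j<N. \<Sum>l<N. F j l) \<le> Re (\<Sum>j<N. \<Sum>l<N. H j l)"
  proof -
    have iF: "(\<lambda>x. \<kappa> x * (S x * cnj (S x))) integrable_on {0<..<1}"
      unfolding SS by (intro integrable_sum intF finite_lessThan)
    have iH: "(\<lambda>x. m x * (S x * cnj (S x))) integrable_on {0<..<1}"
      unfolding SS by (intro integrable_sum intH finite_lessThan)
    have "norm (\<Sum>j<N. \<Sum>l<N. F j l) \<le> integral {0<..<1} (\<lambda>x. Re (m x * (S x * cnj (S x))))"
      unfolding sumF
    proof (rule integral_norm_bound_integral[OF iF])
      show "(\<lambda>x. Re (m x * (S x * cnj (S x)))) integrable_on {0<..<1}"
        using integrable_linear[OF iH bounded_linear_Re] by (simp add: o_def)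
      fix x :: real assume x: "x \<in> {0<..<1}"
      have s: "S x * cnj (S x) = of_real ((norm (S x))\<^sup>2)" by (simp only: complex_norm_square)
      show "norm (\<kappa> x * (S x * cnj (S x))) \<le> Re (m x * (S x * cnj (S x)))"
        unfolding s norm_mult M_circle[OF norm_unit_circle]
        using mult_right_mono[OF norm_K_circle[of "unit_circle x"] zero_le_power2[of "norm (S x)"]]
          unit_circle_neq_1[of x] x
        by (simp del: of_real_power)
    qed
    also have "\<dots> = Re (\<Sum>j<N. \<Sum>l<N. H j l)"
      unfolding sumH using integral_linear[OF iH bounded_linear_Re] by (simp add: o_def)
    finally show ?thesis .
  qed
  also have "Re (\<Sum>j<N. \<Sum>l<N. H j l) \<le> real N / (1 - r ^ 4) + real N * (real N * err N)"
  proof -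
    have "norm ((\<Sum>j<N. \<Sum>l<N. H j l) - of_nat N * circle_mean M 1) \<le> real N * (real N * err N)"
      using norm_sum_sum_minus_le[of N H "\<lambda>j l. j = l" "circle_mean M 1" "err N"] H by (simp only: diag)
    moreover have "Re (of_nat N * circle_mean M 1) = real N / (1 - r ^ 4)"
      unfolding circle_mean_M by simp
    ultimately show ?thesis
      using complex_Re_le_cmod[of "(\<Sum>j<N. \<Sum>l<N. H j l) - of_nat N * circle_mean M 1"] by simp
  qed
  finally have "(2 * real N - 1) * norm T \<le> real N / (1 - r ^ 4) + 2 * (real N * (real N * err N))" by simp
  moreover have "norm T = norm (deriv g w0) / (1 + r\<^sup>2)\<^sup>2"
    unfolding T_def circle_mean_K norm_divide norm_of_real by simp
  ultimately show ?thesis by simp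
qed

end

text \<open>Dividing the Fejer estimate by \<open>2N - 1\<close> leaves \<open>Q/2\<close> up to a
  term of order \<open>1/N\<close>. The errors grow with \<open>N\<close> but are proportional to
  \<open>\<delta>\<close>, so \<open>N\<close> is fixed by \<open>\<epsilon>\<close> and
  \<open>\<delta>\<close> chosen afterwards, independently of \<open>g\<close> and
  \<open>\<beta>\<close>.\<close>

theorem symmetric_boundary_deriv_bound:
  assumes r: "\<bar>r\<bar> < \<rho>" "\<rho> < 1" and \<epsilon>: "\<epsilon> > 0"
  shows "\<exists>\<delta>>0. \<delta> \<le> 1 \<and> (\<forall>g \<beta>. symmetric_boundary r \<rho> \<delta> g \<beta> \<longrightarrow>
    norm (deriv g (\<i> * of_real r)) \<le> (1 + r\<^sup>2) / (2 * (1 - r\<^sup>2)) + \<epsilon>)"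
proof -
  have r2: "r\<^sup>2 < 1" using r by (simp add: abs_square_less_1)
  define Q where "Q = (1 + r\<^sup>2) / (1 - r\<^sup>2)"
  define c where "c = (1 + r\<^sup>2)\<^sup>2"
  have c: "c > 0" unfolding c_def using zero_le_power2[of r] by (intro zero_less_power) linarith
  have Q: "Q > 0" unfolding Q_def using r2 zero_le_power2[of r] by (intro divide_pos_pos) linarith+
  have cQ: "c / (1 - r ^ 4) = Q"
  proof -
    have "1 - r ^ 4 = (1 + r\<^sup>2) * (1 - r\<^sup>2)" by (simp add: algebra_simps power2_eq_square power4_eq_xxxx)
    moreover have "1 + r\<^sup>2 \<noteq> 0" "1 - r\<^sup>2 \<noteq> 0" using r2 zero_le_power2[of r] by linarith+
    ultimately show ?thesis unfolding c_def Q_def by (simp add: power2_eq_square[of "1 + _"])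
  qed
  obtain N where N: "N \<ge> 1" "Q / \<epsilon> \<le> real N"
    using real_arch_simple[of "max 1 (Q / \<epsilon>)"] by auto
  define B where "B = ((\<rho> - \<bar>r\<bar>) * (1 - \<bar>r\<bar>))\<^sup>2 * \<rho> ^ (2 * N)"
  have B: "B > 0" unfolding B_def using r by simp
  \<comment> \<open>With this choice the total error \<open>2 N^2 err N\<close>, multiplied by
    \<open>c\<close>, is at most \<open>\<epsilon>/2\<close>.\<close>
  define \<delta> where "\<delta> = min 1 (\<epsilon> * B / (4 * (real N)\<^sup>2 * c))"
  have \<delta>: "\<delta> > 0" unfolding \<delta>_def using B \<epsilon> c N by simp
  show ?thesis
  proof (intro exI[of _ \<delta>] conjI allI impI \<delta>)
    show "\<delta> \<le> 1" by (simp add: \<delta>_def)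
    fix g \<beta> assume "symmetric_boundary r \<rho> \<delta> g \<beta>"
    then interpret symmetric_boundary r \<rho> \<delta> g \<beta> .
    define A where "A = norm (deriv g w0)"
    have "err N = \<delta> / B" by (simp add: err_def B_def d_def)
    also have "\<dots> \<le> (\<epsilon> * B / (4 * (real N)\<^sup>2 * c)) / B"
      unfolding \<delta>_def using B by (intro divide_right_mono) auto
    also have "\<dots> = \<epsilon> / (4 * (real N)\<^sup>2 * c)" using B by simp
    finally have "c * (2 * (real N * (real N * err N))) \<le> c * (2 * (real N * (real N * (\<epsilon> / (4 * (real N)\<^sup>2 * c)))))"
      using c by (intro mult_left_mono) auto
    also have "\<dots> = \<epsilon> / 2" using c N by (simp add: power2_eq_square)
    finally have e: "c * (2 * (real N * (real N * err N))) \<le> \<epsilon> / 2" .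
    have "(2 * real N - 1) * A = c * ((2 * real N - 1) * (A / c))" using c by simp
    also have "\<dots> \<le> c * (real N / (1 - r ^ 4) + 2 * (real N * (real N * err N)))"
      using deriv_le_Fejer[OF N(1)] c unfolding A_def c_def by (intro mult_left_mono) auto
    also have "\<dots> = real N * Q + c * (2 * (real N * (real N * err N)))"
      using cQ by (simp add: algebra_simps flip: cQ)
    also have "\<dots> \<le> real N * Q + \<epsilon> / 2" using e by simp
    also have "\<dots> = (2 * real N - 1) * (Q / 2) + Q / 2 + \<epsilon> / 2" by (simp add: algebra_simps)
    also have "\<dots> \<le> (2 * real N - 1) * (Q / 2) + real N * \<epsilon> / 2 + \<epsilon> / 2"
      using N \<epsilon> by (simp add: field_simps)
    also have "\<dots> \<le> (2 * real N - 1) * (Q / 2 + \<epsilon>)"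
    proof -
      have "1 * \<epsilon> \<le> real N * \<epsilon>" using N \<epsilon> by (intro mult_right_mono) auto
      then show ?thesis by (simp add: algebra_simps)
    qed
    finally have "A \<le> Q / 2 + \<epsilon>"
      using N by (subst (asm) mult_le_cancel_left_pos) auto
    then show "norm (deriv g (\<i> * of_real r)) \<le> (1 + r\<^sup>2) / (2 * (1 - r\<^sup>2)) + \<epsilon>"
      by (simp add: A_def Q_def w0_def mult.commute)
  qed
qed

section \<open>Transfer to the half-plane\<close>

definition extremal_constant :: "complex \<Rightarrow> real" where
  "extremal_constant l = norm l / (2 * Re l * (norm l + Re l))"

text \<open>The Cayley map \<open>S\<close> carries the disc estimate over, and \<open>K\<close> is
  the image of the closed disc of radius \<open>\<rho>\<close>. As \<open>K\<close> and
  \<open>\<delta>\<close> depend on \<open>l\<close> and \<open>\<epsilon>\<close> only, the bound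
  applies to every family of inner functions tending to 0 locally uniformly.\<close>

theorem half_plane_deriv_bound:
  assumes l: "Re l > 0" and \<epsilon>: "\<epsilon> > 0"
  obtains K \<delta> where "compact K" "K \<subseteq> {s. Re s > 0}" "\<delta> > 0"
    and "\<And>g \<beta>. g holomorphic_on {s. Re s > 0} \<Longrightarrow> continuous_on {s. Re s \<ge> 0} g \<Longrightarrow>
      \<beta> holomorphic_on {s. Re s > 0} \<Longrightarrow> continuous_on {s. Re s \<ge> 0} \<beta> \<Longrightarrow>
      (\<And>s. Re s \<ge> 0 \<Longrightarrow> norm (g s) \<le> 1) \<Longrightarrow> (\<And>s. Re s \<ge> 0 \<Longrightarrow> norm (\<beta> s) \<le> 1) \<Longrightarrow>
      (\<And>s. Re s = 0 \<Longrightarrow> norm (\<beta> s) = 1) \<Longrightarrow>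
      (\<And>s. Re s = 0 \<Longrightarrow> g (- s) * \<beta> s = g s * \<beta> (- s)) \<Longrightarrow>
      g l = 0 \<Longrightarrow> (\<And>s. s \<in> K \<Longrightarrow> norm (\<beta> s) \<le> \<delta>) \<Longrightarrow>
      norm (deriv g l) \<le> extremal_constant l + \<epsilon>"
proof -
  define \<omega> where "\<omega> = norm l"
  define \<sigma> where "\<sigma> = Re l"
  \<comment> \<open>The tangent of half the argument of \<open>l\<close>. Sending the centre of the
    disc to \<open>|l|\<close> is what makes the preimage of \<open>l\<close> purely
    imaginary.\<close>
  define r where "r = Im l / (\<omega> + \<sigma>)"
  have \<sigma>: "0 < \<sigma>" "\<sigma> \<le> \<omega>" using l complex_Re_le_cmod[of l] by (auto simp: \<sigma>_def \<omega>_def)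
  have \<omega>: "\<omega> > 0" using \<sigma> by simp
  have Im2: "(Im l)\<^sup>2 = (\<omega> - \<sigma>) * (\<omega> + \<sigma>)"
    using cmod_power2[of l] by (simp add: \<omega>_def \<sigma>_def algebra_simps power2_eq_square)
  have r2: "r\<^sup>2 = (\<omega> - \<sigma>) / (\<omega> + \<sigma>)"
    unfolding r_def power_divide Im2 using \<sigma> by (simp add: power2_eq_square)
  have "r\<^sup>2 < 1" unfolding r2 using \<sigma> by simp
  then have r1: "\<bar>r\<bar> < 1" by (simp add: abs_square_less_1)
  define \<rho> where "\<rho> = (1 + \<bar>r\<bar>) / 2"
  have \<rho>: "\<bar>r\<bar> < \<rho>" "\<rho> < 1" using r1 by (auto simp: \<rho>_def)
  have ratio: "(1 + r\<^sup>2) / (2 * (1 - r\<^sup>2)) = \<omega> / (2 * \<sigma>)"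
  proof -
    have "1 + r\<^sup>2 = 2 * \<omega> / (\<omega> + \<sigma>)" "1 - r\<^sup>2 = 2 * \<sigma> / (\<omega> + \<sigma>)"
      unfolding r2 using \<sigma> by (simp_all add: field_simps)
    then show ?thesis using \<sigma> by simp
  qed
  \<comment> \<open>The tolerance is scaled by \<open>\<omega> + \<sigma>\<close>, the modulus of
    the derivative of \<open>S\<close> at the preimage of \<open>l\<close>, by which the disc
    estimate is divided at the end.\<close>
  obtain \<delta> where \<delta>: "\<delta> > 0" "\<delta> \<le> 1" and bound: "\<And>g \<beta>. symmetric_boundary r \<rho> \<delta> g \<beta> \<Longrightarrow>
      norm (deriv g (\<i> * of_real r)) \<le> (1 + r\<^sup>2) / (2 * (1 - r\<^sup>2)) + \<epsilon> * (\<omega> + \<sigma>)"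
    using symmetric_boundary_deriv_bound[OF \<rho>, of "\<epsilon> * (\<omega> + \<sigma>)"] \<epsilon> \<sigma> by auto
  define S where "S = (\<lambda>w. complex_of_real \<omega> * (1 + w) / (1 - w))"
  have ReS: "Re (S w) = \<omega> * (1 - (norm w)\<^sup>2) / (norm (1 - w))\<^sup>2" for w
  proof -
    have S_eq: "S w = of_real \<omega> * ((1 + w) * cnj (1 - w)) / of_real ((norm (1 - w))\<^sup>2)"
      unfolding S_def complex_norm_square by (cases "w = 1") auto
    have "Re (S w) = \<omega> * Re ((1 + w) * cnj (1 - w)) / (norm (1 - w))\<^sup>2"
    proof -
      have "Re (of_real \<omega> * q / of_real n) = \<omega> * Re q / n" for q n by simp
      then show ?thesis by (simp only: S_eq)
    qed
    moreover have "Re ((1 + w) * cnj (1 - w)) = 1 - (norm w)\<^sup>2"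
      unfolding cmod_power2 by (simp add: algebra_simps power2_eq_square)
    ultimately show ?thesis by simp
  qed
  have Re_ge: "Re (S w) \<ge> 0" if "norm w \<le> 1" for w
    unfolding ReS using that \<omega> by (intro divide_nonneg_nonneg mult_nonneg_nonneg) (auto simp: power_le_one)
  have Re_gt: "Re (S w) > 0" if "norm w < 1" for w
  proof -
    have "w \<noteq> 1" "(norm w)\<^sup>2 < 1" using that by (auto simp: abs_square_less_1)
    then show ?thesis unfolding ReS using \<omega> by (intro divide_pos_pos mult_pos_pos) auto
  qed
  have Re_eq: "Re (S w) = 0" if "norm w = 1" for w unfolding ReS using that by simp
  have S_cnj: "S (cnj w) = - S w" if "norm w = 1" for w
  proof -
    have "S (cnj w) = cnj (S w)" by (simp add: S_def)
    also have "\<dots> = - S w" using Re_eq[OF that] by (simp add: complex_eq_iff)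
    finally show ?thesis .
  qed
  have holS: "S holomorphic_on ball 0 1"
    unfolding S_def by (intro holomorphic_intros) auto
  have contS: "continuous_on (cball 0 1 - {1}) S"
    unfolding S_def by (intro continuous_intros) auto
  have lw: "of_real \<omega> + l \<noteq> 0" using \<sigma> by (auto simp: complex_eq_iff \<sigma>_def)
  have w0: "\<i> * of_real r = (l - of_real \<omega>) / (l + of_real \<omega>)"
  proof -
    have "(\<omega> + \<sigma>) * (l - of_real \<omega>) = \<i> * of_real (Im l) * (l + of_real \<omega>)"
      using Im2 by (auto simp: complex_eq_iff \<sigma>_def algebra_simps power2_eq_square)
    then show ?thesis using lw \<sigma>
      by (simp add: r_def field_simps flip: of_real_add) 
  qed
  have ne: "1 - \<i> * of_real r = 2 * of_real \<omega> / (l + of_real \<omega>)"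
    unfolding w0 using lw by (simp add: field_simps)
  have S_w0: "S (\<i> * of_real r) = l"
  proof -
    have "1 + \<i> * of_real r = 2 * l / (l + of_real \<omega>)"
      unfolding w0 using lw by (simp add: field_simps)
    then show ?thesis unfolding S_def ne using lw \<omega> by (simp add: add.commute)
  qed
  have S': "(S has_field_derivative (l + of_real \<omega>)\<^sup>2 / (2 * of_real \<omega>)) (at (\<i> * of_real r))"
  proof -
    have nz: "1 - \<i> * of_real r \<noteq> 0" unfolding ne using lw \<omega> by (simp add: add.commute)
    have "(S has_field_derivative 2 * of_real \<omega> / (1 - \<i> * of_real r)\<^sup>2) (at (\<i> * of_real r))"
      unfolding S_def using nz
      by (auto intro!: derivative_eq_intros simp: power2_eq_square) (simp add: field_simps)
    also have "2 * of_real \<omega> / (1 - \<i> * of_real r)\<^sup>2 = (l + of_real \<omega>)\<^sup>2 / (2 * of_real \<omega>)"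
      unfolding ne power_divide using lw \<omega> by (simp add: power2_eq_square)
    finally show ?thesis .
  qed
  have norm_S': "norm ((l + of_real \<omega>)\<^sup>2 / (2 * of_real \<omega>)) = \<omega> + \<sigma>"
  proof -
    have "(norm (l + of_real \<omega>))\<^sup>2 = 2 * \<omega> * (\<omega> + \<sigma>)"
      using Im2 unfolding cmod_power2 by (simp add: \<sigma>_def algebra_simps power2_eq_square)
    then show ?thesis using \<omega> by (simp add: norm_divide norm_power norm_mult)
  qed
  define K where "K = S ` cball 0 \<rho>"
  show ?thesis
  proof (rule that[of K \<delta>])
    show "compact K" unfolding K_def
      using contS \<rho> by (intro compact_continuous_image) (auto elim!: continuous_on_subset)
    show "K \<subseteq> {s. 0 < Re s}" unfolding K_def using Re_gt \<rho> by force
    show "\<delta> > 0" by fact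
    fix g \<beta> :: "complex \<Rightarrow> complex"
    assume g: "g holomorphic_on {s. Re s > 0}" "continuous_on {s. Re s \<ge> 0} g"
      and \<beta>: "\<beta> holomorphic_on {s. Re s > 0}" "continuous_on {s. Re s \<ge> 0} \<beta>"
      and le1: "\<And>s. Re s \<ge> 0 \<Longrightarrow> norm (g s) \<le> 1" "\<And>s. Re s \<ge> 0 \<Longrightarrow> norm (\<beta> s) \<le> 1"
      and ax: "\<And>s. Re s = 0 \<Longrightarrow> norm (\<beta> s) = 1" "\<And>s. Re s = 0 \<Longrightarrow> g (- s) * \<beta> s = g s * \<beta> (- s)"
      and gl: "g l = 0" and sm: "\<And>s. s \<in> K \<Longrightarrow> norm (\<beta> s) \<le> \<delta>"
    have "symmetric_boundary r \<rho> \<delta> (g \<circ> S) (\<beta> \<circ> S)"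
    proof
      show "(g \<circ> S) holomorphic_on ball 0 1" "(\<beta> \<circ> S) holomorphic_on ball 0 1"
        using Re_gt by (auto intro!: holomorphic_on_compose_gen[OF holS] g \<beta>)
      show "continuous_on (cball 0 1 - {1}) (g \<circ> S)" "continuous_on (cball 0 1 - {1}) (\<beta> \<circ> S)"
        using Re_ge unfolding o_def
        by (auto intro!: continuous_on_compose2[OF g(2) contS] continuous_on_compose2[OF \<beta>(2) contS])
      show "(g \<circ> S) (cnj w) * (\<beta> \<circ> S) w = (g \<circ> S) w * (\<beta> \<circ> S) (cnj w)" if "norm w = 1" for w
        using ax Re_eq[OF that] by (simp add: S_cnj[OF that])
      show "norm ((\<beta> \<circ> S) w) \<le> \<delta>" if "norm w \<le> \<rho>" for w
        using sm that by (auto simp: K_def)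
    qed (use \<rho> \<delta> le1 ax Re_ge Re_eq gl S_w0 in \<open>auto\<close>)
    from bound[OF this] have "norm (deriv (g \<circ> S) (\<i> * of_real r)) \<le> \<omega> / (2 * \<sigma>) + \<epsilon> * (\<omega> + \<sigma>)"
      unfolding ratio .
    moreover have "deriv (g \<circ> S) (\<i> * of_real r) = deriv g l * ((l + of_real \<omega>)\<^sup>2 / (2 * of_real \<omega>))"
    proof (rule DERIV_imp_deriv, rule DERIV_chain[OF _ S'])
      show "(g has_field_derivative deriv g l) (at (S (\<i> * of_real r)))"
        unfolding S_w0 using l
        by (intro holomorphic_derivI[OF g(1)]) (auto simp: open_halfspace_Re_gt)
    qed
    ultimately have "norm (deriv g l) * (\<omega> + \<sigma>) \<le> \<omega> / (2 * \<sigma>) + \<epsilon> * (\<omega> + \<sigma>)"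
      by (simp only: norm_mult norm_S')
    then have "norm (deriv g l) \<le> (\<omega> / (2 * \<sigma>) + \<epsilon> * (\<omega> + \<sigma>)) / (\<omega> + \<sigma>)"
      using \<sigma> by (subst pos_le_divide_eq) auto
    also have "\<dots> = extremal_constant l + \<epsilon>"
      using \<sigma> by (simp add: extremal_constant_def \<omega>_def \<sigma>_def add_divide_distrib)
    finally show "norm (deriv g l) \<le> extremal_constant l + \<epsilon>" .
  qed
qed

section \<open>The asymptotically extremal functions\<close>

text \<open>Written through the reciprocals \<open>1/(s + cnj l)\<close> and
  \<open>1/(s + |l|)\<close>: replacing each by an approximation without poles keeps the exact zero
  at \<open>l\<close>. The factor \<open>Re l\<close> normalises the difference to
  \<open>(s - l) / (2 (s + cnj l))\<close>.\<close>

definition extremal_factor :: "complex \<Rightarrow> complex \<Rightarrow> complex" where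
  "extremal_factor l s = of_real (Re l) * (1 / (l + cnj l) - 1 / (s + cnj l)) * (1 + (l - of_real (norm l)) * (1 / (s + of_real (norm l))))\<^sup>2"

lemma extremal_factor_eq:
  assumes l: "Re l > 0" and s: "Re s \<ge> 0"
  shows "extremal_factor l s = (s - l) / (s + cnj l) / 2 * ((s + l) / (s + of_real (norm l)))\<^sup>2"
proof -
  have n: "norm l > 0" using l by auto
  have "Re (s + of_real (norm l)) \<noteq> 0" using add_nonneg_pos[OF s n] by simp
  then have "s + of_real (norm l) \<noteq> 0" by (metis zero_complex.sel(1))
  then have 1: "1 + (l - of_real (norm l)) * (1 / (s + of_real (norm l))) = (s + l) / (s + of_real (norm l))"
    by (simp add: field_simps)
  have 2: "l + cnj l = of_real (2 * Re l)" by (simp add: complex_eq_iff)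
  have ne: "s + cnj l \<noteq> 0" using s l by (auto simp: complex_eq_iff)
  have "of_real (Re l) * (1 / (l + cnj l) - 1 / (s + cnj l)) = (s - l) / (s + cnj l) / 2"
  proof -
    have "1 / (l + cnj l) - 1 / (s + cnj l) = (s - l) / ((l + cnj l) * (s + cnj l))"
    proof -
      have "l + cnj l \<noteq> 0" using l by (auto simp: complex_eq_iff)
      from diff_frac_eq[OF this ne, of 1 1] show ?thesis by simp
    qed
    also have "\<dots> = (s - l) / (of_real (2 * Re l) * (s + cnj l))" by (simp only: 2)
    finally show ?thesis using l by simp
  qed
  then show ?thesis unfolding extremal_factor_def 1 by simp
qed

text \<open>On the axis \<open>|s - l| = |s + cnj l|\<close> and
  \<open>|s + |l||^2 = |s|^2 + |l|^2\<close>; what is left of the two moduli adds up to 1 by the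
  parallelogram law.\<close>

lemma norm_extremal_factor_axis:
  assumes l: "Re l > 0" and s: "Re s = 0"
  shows "norm (extremal_factor l s) + norm (extremal_factor l (- s)) = 1"
proof -
  have n: "norm l > 0" using l by auto
  have den: "(norm (u + of_real (norm l)))\<^sup>2 = (norm u)\<^sup>2 + (norm l)\<^sup>2" if "Re u = 0" for u
    using that unfolding cmod_power2[of "u + _"] cmod_power2[of u] by simp
  have norm_eq: "norm (extremal_factor l u) = (norm (u + l))\<^sup>2 / (2 * ((norm u)\<^sup>2 + (norm l)\<^sup>2))" if "Re u = 0" for u
  proof -
    have "norm (u - l) = norm (u + cnj l)"
      using that by (simp add: cmod_def power2_eq_square algebra_simps)
    moreover have "u + cnj l \<noteq> 0" using that l by (auto simp: complex_eq_iff)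
    moreover have "norm (extremal_factor l u) = norm (u - l) / norm (u + cnj l) / 2 * ((norm (u + l))\<^sup>2 / ((norm u)\<^sup>2 + (norm l)\<^sup>2))"
      unfolding den[OF that, symmetric] extremal_factor_eq[OF l eq_refl[OF that[symmetric]]]
        norm_mult norm_divide norm_power by (simp add: power_divide)
    ultimately show ?thesis by simp
  qed
  have "norm (extremal_factor l s) + norm (extremal_factor l (- s))
      = ((norm (s + l))\<^sup>2 + (norm (- s + l))\<^sup>2) / (2 * ((norm s)\<^sup>2 + (norm l)\<^sup>2))"
    using s by (simp add: norm_eq add_divide_distrib)
  also have "(norm (s + l))\<^sup>2 + (norm (- s + l))\<^sup>2 = 2 * ((norm s)\<^sup>2 + (norm l)\<^sup>2)"
    unfolding cmod_power2 by (simp add: power2_eq_square algebra_simps)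
  also have "\<dots> / \<dots> = 1" using n by (simp add: add_nonneg_pos less_imp_neq[symmetric])
  finally show ?thesis .
qed

text \<open>The first factor vanishes at \<open>l\<close>, so only its derivative counts;
  \<open>|l + |l||^2 = 2 |l| (|l| + Re l)\<close> turns the rest into the constant of the upper
  bound.\<close>

lemma extremal_factor_deriv:
  assumes l: "Re l > 0"
  shows "norm (deriv (extremal_factor l) l) = extremal_constant l"
proof -
  define \<omega> where "\<omega> = norm l"
  define \<sigma> where "\<sigma> = Re l"
  have \<sigma>: "\<sigma> > 0" "\<omega> > 0" using l by (auto simp: \<sigma>_def \<omega>_def)
  have c: "l + cnj l = of_real (2 * \<sigma>)" by (simp add: complex_eq_iff \<sigma>_def)
  have lw: "l + of_real \<omega> \<noteq> 0" using \<sigma> by (auto simp: complex_eq_iff \<sigma>_def)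
  have cne: "l + cnj l \<noteq> 0" unfolding c using \<sigma> by simp
  define X where "X = (\<lambda>s. of_real \<sigma> * (1 / (l + cnj l) - 1 / (s + cnj l)))"
  define Y where "Y = (\<lambda>s. (1 + (l - of_real \<omega>) * (1 / (s + of_real \<omega>)))\<^sup>2)"
  have X': "(X has_field_derivative of_real \<sigma> * (1 / (l + cnj l)\<^sup>2)) (at l)"
    unfolding X_def using cne by (auto intro!: derivative_eq_intros simp: power2_eq_square)
  have "(\<lambda>s. 1 + (l - of_real \<omega>) * (1 / (s + of_real \<omega>))) field_differentiable at l"
    using lw by (auto intro!: derivative_intros)
  then have "Y field_differentiable at l" unfolding Y_def by (intro field_differentiable_power)
  then obtain Y' where Y': "(Y has_field_derivative Y') (at l)" by (auto simp: field_differentiable_def)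
  have "(extremal_factor l has_field_derivative (of_real \<sigma> * (1 / (l + cnj l)\<^sup>2)) * Y l + Y' * X l) (at l)"
    using DERIV_mult[OF X' Y'] by (simp add: extremal_factor_def[abs_def] X_def Y_def \<omega>_def \<sigma>_def)
  then have "deriv (extremal_factor l) l = (of_real \<sigma> * (1 / (l + cnj l)\<^sup>2)) * Y l"
    by (simp add: DERIV_imp_deriv X_def)
  moreover have "Y l = (2 * l)\<^sup>2 / (l + of_real \<omega>)\<^sup>2"
    unfolding Y_def power_divide[symmetric] using lw by (simp add: field_simps)
  ultimately have "norm (deriv (extremal_factor l) l) = \<sigma> * (1 / (2 * \<sigma>)\<^sup>2) * ((2 * \<omega>)\<^sup>2 / (norm (l + of_real \<omega>))\<^sup>2)"
    using \<sigma> unfolding c by (simp add: norm_mult norm_divide norm_power \<omega>_def)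
  moreover have "(norm (l + of_real \<omega>))\<^sup>2 = 2 * \<omega> * (\<omega> + \<sigma>)"
  proof -
    have "\<omega>\<^sup>2 = (Re l)\<^sup>2 + (Im l)\<^sup>2" by (simp add: \<omega>_def cmod_power2)
    then show ?thesis unfolding cmod_power2 by (simp add: \<sigma>_def algebra_simps power2_eq_square)
  qed
  ultimately show ?thesis using \<sigma>
    by (simp add: extremal_constant_def power2_eq_square flip: \<omega>_def \<sigma>_def)
qed

lemma bounded_reciprocal_half_plane:
  assumes "Re p > 0"
  shows "bounded ((\<lambda>s. 1 / (s + p)) ` {s. Re s \<ge> 0})"
proof (rule boundedI)
  fix y assume "y \<in> (\<lambda>s. 1 / (s + p)) ` {s. Re s \<ge> 0}"
  then obtain s where s: "Re s \<ge> 0" "y = 1 / (s + p)" by auto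
  have "Re p \<le> norm (s + p)" using complex_Re_le_cmod[of "s + p"] s by simp
  then show "norm y \<le> 1 / Re p" using assms s by (simp add: norm_divide frac_le)
qed

text \<open>The common part of both lower bounds. \<open>h\<close> is the approximated extremal
  factor divided by the inner function \<open>\<beta>\<close>; \<open>h s + h (- s)\<close> is the
  even competitor, and since \<open>h l = 0\<close>, subtracting \<open>h (- l)\<close> restores the
  zero at \<open>l\<close>. The identity \<open>eq\<close> is asked only near \<open>l\<close> and
  on the axis because \<open>\<beta>\<close> may vanish elsewhere, as a Blaschke power does.\<close>

theorem extremal_family:
  fixes e1 e2 \<beta> h :: "'i \<Rightarrow> complex \<Rightarrow> complex"
  assumes l: "Re l > 0" and F: "F \<noteq> bot" and U: "open U" "l \<in> U" "U \<subseteq> {s. Re s \<ge> 0}"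
    and e1: "uniform_limit {s. Re s \<ge> 0} e1 (\<lambda>s. 1 / (s + cnj l)) F"
    and e2: "uniform_limit {s. Re s \<ge> 0} e2 (\<lambda>s. 1 / (s + of_real (norm l))) F"
    and hol: "\<And>t. e1 t holomorphic_on U" "\<And>t. e2 t holomorphic_on U"
      "\<And>t. \<beta> t holomorphic_on U" "\<And>t. h t holomorphic_on U" "\<And>t. (\<lambda>s. h t (- s)) holomorphic_on U"
    and h_neg: "uniform_limit U (\<lambda>t s. h t (- s)) (\<lambda>_. 0) F"
    and eq: "\<And>t s. s \<in> U \<or> Re s = 0 \<Longrightarrow>
      \<beta> t s * h t s = of_real (Re l) * (e1 t l - e1 t s) * (1 + (l - of_real (norm l)) * e2 t s)\<^sup>2"
    and inner: "\<And>t s. Re s = 0 \<Longrightarrow> norm (\<beta> t s) = 1" and \<beta>l: "\<forall>\<^sub>F t in F. norm (\<beta> t l) \<le> 1" "\<And>t. \<beta> t l \<noteq> 0"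
    and \<epsilon>: "\<epsilon> > 0"
  shows "\<forall>\<^sub>F t in F. (\<forall>s. Re s = 0 \<longrightarrow> norm (h t s + h t (- s) - h t (- l)) \<le> 1 + \<epsilon>) \<and>
    extremal_constant l - \<epsilon> \<le> norm (\<beta> t l) * norm (deriv (\<lambda>s. h t s + h t (- s)) l)"
proof -
  define H where "H = {s::complex. Re s \<ge> 0}"
  have lH: "l \<in> H" using l by (simp add: H_def)
  define a where "a = (\<lambda>t s. of_real (Re l) * (e1 t l - e1 t s) * (1 + (l - of_real (norm l)) * e2 t s)\<^sup>2)"
  have b1: "bounded ((\<lambda>s. 1 / (s + cnj l)) ` H)"
    unfolding H_def by (rule bounded_reciprocal_half_plane) (use l in auto)
  have b2: "bounded ((\<lambda>s. 1 / (s + of_real (norm l))) ` H)"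
    unfolding H_def by (rule bounded_reciprocal_half_plane) (use l in auto)
  have "((\<lambda>t. e1 t l) \<longlongrightarrow> 1 / (l + cnj l)) F"
    using tendsto_uniform_limitI[OF e1] l by simp
  then have e1l: "uniform_limit H (\<lambda>t s. e1 t l) (\<lambda>s. 1 / (l + cnj l)) F"
    unfolding uniform_limit_iff tendsto_iff by auto
  have u1: "uniform_limit H (\<lambda>t s. of_real (Re l) * (e1 t l - e1 t s)) (\<lambda>s. of_real (Re l) * (1 / (l + cnj l) - 1 / (s + cnj l))) F"
    using e1 e1l by (intro bounded_linear.uniform_limit[OF bounded_linear_mult_right] uniform_limit_minus) (auto simp: H_def)
  have u2: "uniform_limit H (\<lambda>t s. 1 + (l - of_real (norm l)) * e2 t s) (\<lambda>s. 1 + (l - of_real (norm l)) * (1 / (s + of_real (norm l)))) F"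
    using e2 by (intro bounded_linear.uniform_limit[OF bounded_linear_mult_right] uniform_limit_add uniform_limit_const) (auto simp: H_def)
  have B1: "bounded ((\<lambda>s. of_real (Re l) * (1 / (l + cnj l) - 1 / (s + cnj l))) ` H)"
  proof -
    have "bounded ((\<lambda>s. of_real (Re l) * (1 / (l + cnj l))) ` H)" by (rule bounded_subset[of "{of_real (Re l) * (1 / (l + cnj l))}"]) auto
    moreover have "bounded ((\<lambda>x. of_real (Re l) * x) ` (\<lambda>s. 1 / (s + cnj l)) ` H)"
      by (rule bounded_linear_image[OF b1 bounded_linear_mult_right])
    ultimately show ?thesis
      using bounded_minus_comp[of "\<lambda>s. of_real (Re l) * (1 / (l + cnj l))" H "\<lambda>s. of_real (Re l) * (1 / (s + cnj l))"]
      by (simp add: image_image right_diff_distrib)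
  qed
  have B2: "bounded ((\<lambda>s. 1 + (l - of_real (norm l)) * (1 / (s + of_real (norm l)))) ` H)"
  proof -
    have "bounded ((\<lambda>x. (l - of_real (norm l)) * x) ` (\<lambda>s. 1 / (s + of_real (norm l))) ` H)"
      by (rule bounded_linear_image[OF b2 bounded_linear_mult_right])
    moreover have "bounded ((\<lambda>s. 1::complex) ` H)" by (rule bounded_subset[of "{1}"]) auto
    ultimately show ?thesis
      using bounded_plus_comp[of "\<lambda>s. 1" H "\<lambda>s. (l - of_real (norm l)) * (1 / (s + of_real (norm l)))"]
      by (simp add: image_image)
  qed
  have u3: "uniform_limit H (\<lambda>t s. (1 + (l - of_real (norm l)) * e2 t s) * (1 + (l - of_real (norm l)) * e2 t s))
     (\<lambda>s. (1 + (l - of_real (norm l)) * (1 / (s + of_real (norm l)))) * (1 + (l - of_real (norm l)) * (1 / (s + of_real (norm l))))) F"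
    by (intro uniform_lim_mult u2 B2)
  have B3: "bounded ((\<lambda>s. (1 + (l - of_real (norm l)) * (1 / (s + of_real (norm l)))) * (1 + (l - of_real (norm l)) * (1 / (s + of_real (norm l))))) ` H)"
  proof -
    obtain C where C: "\<And>s. s \<in> H \<Longrightarrow> norm (1 + (l - of_real (norm l)) * (1 / (s + of_real (norm l)))) \<le> C"
      using B2 unfolding bounded_iff by blast
    then have "norm ((1 + (l - of_real (norm l)) * (1 / (s + of_real (norm l)))) * (1 + (l - of_real (norm l)) * (1 / (s + of_real (norm l))))) \<le> C * C"
      if "s \<in> H" for s
      unfolding norm_mult[of "1 + _"] using C[OF that] order_trans[OF norm_ge_zero C[OF that]] by (intro mult_mono) auto
    then show ?thesis by (intro boundedI) blast
  qed
  have a_lim: "uniform_limit H a (extremal_factor l) F"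
    using uniform_lim_mult[OF u1 u3 B1 B3]
    by (simp add: a_def extremal_factor_def[abs_def] power2_eq_square)
  have a_limU: "uniform_limit U a (extremal_factor l) F"
    using a_lim U by (auto simp: H_def intro: uniform_limit_on_subset)
  have hol_a: "a t holomorphic_on U" for t
    unfolding a_def by (intro holomorphic_intros hol)
  \<comment> \<open>Uniform convergence of holomorphic functions on the neighbourhood
    \<open>U\<close> passes to the derivatives at \<open>l\<close>.\<close>
  have da: "((\<lambda>t. deriv (a t) l) \<longlongrightarrow> deriv (extremal_factor l) l) F"
    using higher_deriv_complex_uniform_limit[OF a_limU _ F U(1,2), of 1] hol_a by simp
  have dh: "((\<lambda>t. deriv (\<lambda>s. h t (- s)) l) \<longlongrightarrow> 0) F"
    using higher_deriv_complex_uniform_limit[OF h_neg _ F U(1,2), of 1] hol by simp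
  have hl: "((\<lambda>t. h t (- l)) \<longlongrightarrow> 0) F"
    using tendsto_uniform_limitI[OF h_neg U(2)] by simp
  have ev1: "\<forall>\<^sub>F t in F. \<forall>s\<in>H. dist (a t s) (extremal_factor l s) < \<epsilon> / 3"
    by (rule uniform_limitD[OF a_lim]) (use \<epsilon> in simp)
  have ev2: "\<forall>\<^sub>F t in F. norm (h t (- l)) < \<epsilon> / 3"
    by (rule order_tendstoD(2)[OF tendsto_norm_zero[OF hl]]) (use \<epsilon> in simp)
  have ev3: "\<forall>\<^sub>F t in F. dist (norm (deriv (a t) l)) (extremal_constant l) < \<epsilon> / 2"
    using tendsto_norm[OF da] \<epsilon> unfolding tendsto_iff extremal_factor_deriv[OF l] by (meson half_gt_zero)
  have ev4: "\<forall>\<^sub>F t in F. norm (deriv (\<lambda>s. h t (- s)) l) < \<epsilon> / 2"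
    by (rule order_tendstoD(2)[OF tendsto_norm_zero[OF dh]]) (use \<epsilon> in simp)
  show ?thesis
    using ev1 ev2 ev3 ev4 \<beta>l(1)
  proof eventually_elim
    case (elim t)
    \<comment> \<open>Unimodularity of \<open>\<beta>\<close> on the axis turns the estimate for
      \<open>a\<close> into one for \<open>h\<close>; it is applied at \<open>s\<close> and at
      \<open>- s\<close>, where the two limit moduli add up to 1.\<close>
    have hs: "norm (h t s) \<le> norm (extremal_factor l s) + \<epsilon> / 3" if s: "Re s = 0" for s
    proof -
      have "norm (h t s) = norm (\<beta> t s * h t s)" using inner[OF s] by (simp add: norm_mult)
      also have "\<dots> = norm (a t s)" using eq[of s t] s by (simp add: a_def)
      also have "\<dots> \<le> norm (extremal_factor l s) + \<epsilon> / 3"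
      proof -
        have "dist (a t s) (extremal_factor l s) < \<epsilon> / 3" using elim(1) s by (simp add: H_def)
        then show ?thesis using norm_triangle_ineq2[of "a t s" "extremal_factor l s"] unfolding dist_norm by linarith
      qed
      finally show ?thesis .
    qed
    have 1: "norm (h t s + h t (- s) - h t (- l)) \<le> 1 + \<epsilon>" if s: "Re s = 0" for s
    proof -
      have "norm (h t s + h t (- s) - h t (- l)) \<le> norm (h t s) + norm (h t (- s)) + norm (h t (- l))"
        using norm_triangle_ineq4[of "h t s + h t (- s)" "h t (- l)"] norm_triangle_ineq[of "h t s" "h t (- s)"] by linarith
      also have "\<dots> \<le> (norm (extremal_factor l s) + \<epsilon> / 3) + (norm (extremal_factor l (- s)) + \<epsilon> / 3) + \<epsilon> / 3"
        using hs[of s] hs[of "- s"] s elim(2) by simp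
      also have "\<dots> = 1 + \<epsilon>" using norm_extremal_factor_axis[OF l s] by simp
      finally show ?thesis .
    qed
    have d1: "(h t has_field_derivative deriv (h t) l) (at l)"
      by (rule holomorphic_derivI[OF hol(4) U(1,2)])
    have d2: "((\<lambda>s. h t (- s)) has_field_derivative deriv (\<lambda>s. h t (- s)) l) (at l)"
      by (rule holomorphic_derivI[OF hol(5) U(1,2)])
    have d3: "(\<beta> t has_field_derivative deriv (\<beta> t) l) (at l)"
      by (rule holomorphic_derivI[OF hol(3) U(1,2)])
    have hl0: "h t l = 0" using eq[of l t] U \<beta>l(2)[of t] by simp
    have "((\<lambda>s. \<beta> t s * h t s) has_field_derivative deriv (\<beta> t) l * h t l + deriv (h t) l * \<beta> t l) (at l)"
      by (rule DERIV_mult[OF d3 d1])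
    then have "(a t has_field_derivative deriv (\<beta> t) l * h t l + deriv (h t) l * \<beta> t l) (at l)"
      by (rule has_field_derivative_transform_within_open[OF _ U(1,2)]) (simp add: a_def eq)
    then have da_eq: "deriv (a t) l = deriv (\<beta> t) l * h t l + deriv (h t) l * \<beta> t l"
      by (rule DERIV_imp_deriv)
    have "extremal_constant l - \<epsilon> / 2 \<le> norm (deriv (a t) l)"
      using elim(3) unfolding dist_real_def by linarith
    also have "deriv (a t) l = \<beta> t l * deriv (\<lambda>s. h t s + h t (- s)) l - \<beta> t l * deriv (\<lambda>s. h t (- s)) l"
      unfolding da_eq DERIV_imp_deriv[OF DERIV_add[OF d1 d2]] by (simp add: hl0 algebra_simps)
    also have "norm \<dots> \<le> norm (\<beta> t l) * norm (deriv (\<lambda>s. h t s + h t (- s)) l) + norm (\<beta> t l) * norm (deriv (\<lambda>s. h t (- s)) l)"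
      unfolding norm_mult[symmetric] by (rule norm_triangle_ineq4)
    also have "norm (\<beta> t l) * norm (deriv (\<lambda>s. h t (- s)) l) \<le> 1 * (\<epsilon> / 2)"
      using elim(4,5) by (intro mult_mono) auto
    finally show ?case using 1 by auto
  qed
qed

text \<open>A real \<open>Sup\<close> is meaningful only for nonempty sets bounded above: the
  witness in \<open>lower\<close> supplies the former, \<open>upper\<close> the latter. The factor
  \<open>1 + \<epsilon>\<close> comes from normalising the competitors.\<close>

lemma tendsto_times_Sup:
  fixes S :: "'i \<Rightarrow> real set" and c :: "'i \<Rightarrow> real"
  assumes c: "\<And>t. c t > 0" and L: "L \<ge> 0"
    and upper: "\<And>\<epsilon>. \<epsilon> > 0 \<Longrightarrow> \<forall>\<^sub>F t in F. \<forall>x\<in>S t. c t * x \<le> L + \<epsilon>"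
    and lower: "\<And>\<epsilon>. \<epsilon> > 0 \<Longrightarrow> \<forall>\<^sub>F t in F. \<exists>x\<in>S t. c t * x \<ge> (L - \<epsilon>) / (1 + \<epsilon>)"
  shows "((\<lambda>t. c t * Sup (S t)) \<longlongrightarrow> L) F"
proof (rule tendstoI)
  fix \<eta> :: real assume \<eta>: "\<eta> > 0"
  \<comment> \<open>Makes \<open>(L - \<epsilon>) / (1 + \<epsilon>)\<close> at least
    \<open>L - \<eta>/2\<close>.\<close>
  define \<epsilon> where "\<epsilon> = \<eta> / (2 * (1 + L))"
  have \<epsilon>: "\<epsilon> > 0" using \<eta> L by (simp add: \<epsilon>_def)
  have "\<epsilon> * (1 + L) = \<eta> / 2" using L by (simp add: \<epsilon>_def field_simps)
  then have "(L - \<eta> / 2) * (1 + \<epsilon>) \<le> L - \<epsilon>" using \<eta> \<epsilon> by (simp add: algebra_simps)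
  then have le: "L - \<eta> / 2 \<le> (L - \<epsilon>) / (1 + \<epsilon>)" using \<epsilon> by (simp add: pos_le_divide_eq)
  have "\<eta> / 2 > 0" using \<eta> by simp
  from upper[OF this] lower[OF \<epsilon>] show "\<forall>\<^sub>F t in F. dist (c t * Sup (S t)) L < \<eta>"
  proof eventually_elim
    case (elim t)
    then obtain x where x: "x \<in> S t" "c t * x \<ge> (L - \<epsilon>) / (1 + \<epsilon>)" by blast
    have up: "y \<le> (L + \<eta> / 2) / c t" if "y \<in> S t" for y
      using elim(1) that c[of t] by (simp add: pos_le_divide_eq mult.commute)
    then have bdd: "bdd_above (S t)" by (intro bdd_aboveI)
    have "Sup (S t) \<le> (L + \<eta> / 2) / c t" using up x by (intro cSup_least) auto
    then have 1: "c t * Sup (S t) \<le> L + \<eta> / 2" using c[of t] by (simp add: pos_le_divide_eq mult.commute)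
    have "c t * x \<le> c t * Sup (S t)" using cSup_upper[OF x(1) bdd] c[of t] by (intro mult_left_mono) auto
    then have "L - \<eta> / 2 \<le> c t * Sup (S t)" using x le by linarith
    then have "\<bar>c t * Sup (S t) - L\<bar> \<le> \<eta> / 2" using 1 by linarith
    then show ?case using \<eta> unfolding dist_real_def by linarith
  qed
qed

section \<open>Entire functions\<close>

text \<open>Composition with \<open>csqrt (- z)\<close> is holomorphic off the nonnegative reals.
  Since \<open>f\<close> is even, the branch \<open>\<i> * csqrt z\<close> gives the same function,
  holomorphic off the nonpositive reals. Only 0 is left, and it is removable by continuity.\<close>

lemma even_entire_function:
  assumes f: "f holomorphic_on UNIV" and even: "\<And>s. f (- s) = f s"
  obtains F where "F holomorphic_on UNIV" "\<And>s. F (- (s\<^sup>2)) = f s"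
proof
  define F where "F = (\<lambda>z. f (csqrt (- z)))"
  have F_eq: "F (- (s\<^sup>2)) = f s" for s
  proof -
    have "csqrt (s\<^sup>2) = s \<or> csqrt (s\<^sup>2) = - s" by (metis power2_csqrt power2_eq_iff)
    then show ?thesis using even by (auto simp: F_def)
  qed
  then show "F (- (s\<^sup>2)) = f s" for s .
  have F_eq': "F z = f (\<i> * csqrt z)" for z
    using F_eq[of "\<i> * csqrt z"] by (simp add: power_mult_distrib)
  have comp: "(\<lambda>z. f (q z)) holomorphic_on S" if "q holomorphic_on S" for q S
    using holomorphic_on_compose_gen[OF that f] by (simp add: o_def)
  have 1: "F holomorphic_on {z. - z \<notin> \<real>\<^sub>\<le>\<^sub>0}"
    unfolding F_def by (intro comp holomorphic_intros) auto
  have 2: "F holomorphic_on {z. z \<notin> \<real>\<^sub>\<le>\<^sub>0}"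
    unfolding F_eq' by (intro comp holomorphic_intros) auto
  have op: "open {z::complex. z \<notin> \<real>\<^sub>\<le>\<^sub>0}" "open {z::complex. - z \<notin> \<real>\<^sub>\<le>\<^sub>0}"
  proof -
    have "open (- \<real>\<^sub>\<le>\<^sub>0 :: complex set)" by (intro open_Compl closed_nonpos_Reals_complex)
    moreover from this have "open (uminus -` (- \<real>\<^sub>\<le>\<^sub>0 :: complex set))"
      by (intro open_vimage continuous_intros closed_nonpos_Reals_complex)
    ultimately show "open {z::complex. z \<notin> \<real>\<^sub>\<le>\<^sub>0}" "open {z::complex. - z \<notin> \<real>\<^sub>\<le>\<^sub>0}"
      by (simp_all add: Compl_eq vimage_def)
  qed
  have "F holomorphic_on {z. - z \<notin> \<real>\<^sub>\<le>\<^sub>0} \<union> {z. z \<notin> \<real>\<^sub>\<le>\<^sub>0}"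
    by (rule holomorphic_on_Un[OF 1 2 op(2,1)])
  moreover have "{z. - z \<notin> \<real>\<^sub>\<le>\<^sub>0} \<union> {z. z \<notin> \<real>\<^sub>\<le>\<^sub>0} = UNIV - {0::complex}"
    by (auto simp: complex_nonpos_Reals_iff complex_eq_iff)
  ultimately have hol: "F holomorphic_on UNIV - {0}" by simp
  have lim: "(F \<longlongrightarrow> F 0) (at 0)"
  proof -
    have "isCont f 0" using f by (simp add: holomorphic_on_imp_continuous_on continuous_on_eq_continuous_at[symmetric] holomorphic_on_imp_differentiable_at field_differentiable_imp_continuous_at)
    moreover have "((\<lambda>z. csqrt (- z)) \<longlongrightarrow> 0) (at 0)"
    proof (rule tendsto_norm_zero_cancel)
      have "((\<lambda>z::complex. sqrt (norm z)) \<longlongrightarrow> sqrt (norm (0::complex))) (at 0)" by (intro tendsto_intros)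
      then show "((\<lambda>z. norm (csqrt (- z))) \<longlongrightarrow> 0) (at 0)" by simp
    qed
    ultimately have "((\<lambda>z. f (csqrt (- z))) \<longlongrightarrow> f 0) (at 0)" by (rule isCont_tendsto_compose)
    then show ?thesis by (simp add: F_def)
  qed
  show "F holomorphic_on UNIV"
    by (rule no_isolated_singularity'[where K="{0}"]) (use hol lim in auto)
qed

text \<open>An entire substitute for \<open>1/w\<close>: the pole is cancelled by a term that is
  exponentially small for \<open>Re w > 0\<close>, at the price of exponential type
  \<open>\<tau>\<close>. The value at 0 is the limit.\<close>

definition exp_quotient :: "real \<Rightarrow> complex \<Rightarrow> complex" where
  "exp_quotient \<tau> w = (if w = 0 then of_real \<tau> else (1 - exp (- (of_real \<tau> * w))) / w)"

lemma holomorphic_exp_quotient: "exp_quotient \<tau> holomorphic_on UNIV"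
proof (rule no_isolated_singularity'[where K="{0}"])
  have "(\<lambda>w. (1 - exp (- (of_real \<tau> * w))) / w) holomorphic_on UNIV - {0}"
    by (intro holomorphic_intros) auto
  then show "exp_quotient \<tau> holomorphic_on UNIV - {0}"
    by (rule holomorphic_transform) (auto simp: exp_quotient_def)
  have "((\<lambda>w::complex. 1 - exp (- (of_real \<tau> * w))) has_field_derivative of_real \<tau>) (at 0)"
    by (auto intro!: derivative_eq_intros)
  then have "((\<lambda>w::complex. (1 - exp (- (of_real \<tau> * w))) / w) \<longlongrightarrow> of_real \<tau>) (at 0)"
    by (simp add: has_field_derivative_iff)
  then have "(exp_quotient \<tau> \<longlongrightarrow> of_real \<tau>) (at 0)"
    by (rule Lim_transform_eventually) (auto simp: eventually_at_filter exp_quotient_def)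
  then show "(exp_quotient \<tau> \<longlongrightarrow> exp_quotient \<tau> z) (at z within UNIV)" if "z \<in> {0}" for z
    using that by (simp add: exp_quotient_def)
qed auto

lemma norm_exp_quotient_minus_le:
  assumes "Re w > 0"
  shows "norm (exp_quotient \<tau> w - 1 / w) \<le> exp (- \<tau> * Re w) / Re w"
proof -
  have "w \<noteq> 0" using assms by auto
  then have "norm (exp_quotient \<tau> w - 1 / w) = exp (- \<tau> * Re w) / norm w"
    by (simp add: exp_quotient_def diff_divide_distrib norm_divide)
  also have "\<dots> \<le> exp (- \<tau> * Re w) / Re w"
    using assms complex_Re_le_cmod[of w] by (intro frac_le) auto
  finally show ?thesis .
qed

text \<open>A mean value inequality on a half-plane keeps the bound uniform as \<open>w\<close>
  approaches 0, where estimating numerator and denominator separately would fail.\<close>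

lemma norm_exp_quotient_le:
  assumes \<tau>: "\<tau> \<ge> 0" and x: "x \<ge> 0" "- x \<le> Re w"
  shows "norm (exp_quotient \<tau> w) \<le> \<tau> * exp (\<tau> * x)"
proof (cases "w = 0")
  case True
  have "\<tau> * 1 \<le> \<tau> * exp (\<tau> * x)" using assms by (intro mult_left_mono) auto
  then show ?thesis using True \<tau> by (simp add: exp_quotient_def)
next
  case False
  define S where "S = {u::complex. - x \<le> Re u}"
  have "convex S" using convex_halfspace_Re_ge[of "-x"] by (simp add: S_def)
  have "norm ((\<lambda>u. exp (- (of_real \<tau> * u))) w - (\<lambda>u. exp (- (of_real \<tau> * u))) 0) \<le> (\<tau> * exp (\<tau> * x)) * norm (w - 0)"
  proof (rule field_differentiable_bound[OF \<open>convex S\<close>])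
    show "((\<lambda>u. exp (- (of_real \<tau> * u))) has_field_derivative - of_real \<tau> * exp (- (of_real \<tau> * u))) (at u within S)" for u
      by (auto intro!: derivative_eq_intros)
    show "norm (- of_real \<tau> * exp (- (of_real \<tau> * u))) \<le> \<tau> * exp (\<tau> * x)" if "u \<in> S" for u
    proof -
      have "\<tau> * (- Re u) \<le> \<tau> * x" using that \<tau> by (intro mult_left_mono) (auto simp: S_def)
      then show ?thesis using \<tau> by (simp add: norm_mult mult_left_mono)
    qed
  qed (use x in \<open>auto simp: S_def\<close>)
  then have "norm (1 - exp (- (of_real \<tau> * w))) \<le> (\<tau> * exp (\<tau> * x)) * norm w"
    by (simp add: norm_minus_commute)
  then show ?thesis using False by (simp add: exp_quotient_def norm_divide pos_divide_le_eq)
qed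

text \<open>The approximated extremal factor contains three such quotients. With type
  \<open>t/4\<close> each, their product has type at most \<open>3t/4\<close>, so after
  multiplication by \<open>exp (t s)\<close> it still decays like \<open>exp (t Re s / 4)\<close> in
  the left half-plane, up to powers of \<open>t\<close>.\<close>

lemma uniform_limit_exp_quotient:
  assumes p: "Re p > 0"
  shows "uniform_limit {s. Re s \<ge> 0} (\<lambda>t s. exp_quotient (t / 4) (s + p)) (\<lambda>s. 1 / (s + p)) at_top"
  unfolding uniform_limit_iff
proof (intro allI impI)
  fix e :: real assume e: "e > 0"
  have "((\<lambda>t. exp (- (t / 4) * Re p) / Re p) \<longlongrightarrow> 0) at_top"
    using p by real_asymp
  then have "\<forall>\<^sub>F t in at_top. exp (- (t / 4) * Re p) / Re p < e" using e by (rule order_tendstoD)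
  then show "\<forall>\<^sub>F t in at_top. \<forall>s\<in>{s. Re s \<ge> 0}. dist (exp_quotient (t / 4) (s + p)) (1 / (s + p)) < e"
    using eventually_ge_at_top[of 0]
  proof eventually_elim
    case (elim t)
    show ?case
    proof
      fix s :: complex assume "s \<in> {s. Re s \<ge> 0}"
      then have s: "Re s \<ge> 0" by simp
      have "dist (exp_quotient (t / 4) (s + p)) (1 / (s + p)) \<le> exp (- (t / 4) * Re (s + p)) / Re (s + p)"
        unfolding dist_norm using s p by (intro norm_exp_quotient_minus_le) auto
      also have "\<dots> \<le> exp (- (t / 4) * Re p) / Re p"
        using s p elim(2) by (intro frac_le) (auto intro!: mult_left_mono divide_right_mono simp: mult_nonneg_nonneg)
      finally show "dist (exp_quotient (t / 4) (s + p)) (1 / (s + p)) < e" using elim by simp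
    qed
  qed
qed

text \<open>The half-plane bound is applied to \<open>F (- s^2) exp (- t s)\<close>; the exponential
  type of \<open>F (- s^2)\<close> makes this at most 1 by Phragmen-Lindelof. The factor
  \<open>2 |l|\<close> is the modulus of the derivative of \<open>- s^2\<close> at
  \<open>l\<close>.\<close>

lemma entire_deriv_upper:
  assumes l: "Re l > 0" and \<epsilon>: "\<epsilon> > 0"
  shows "\<forall>\<^sub>F t in at_top. \<forall>F\<in>entire_bdd t. F (- (l\<^sup>2)) = 0 \<longrightarrow>
    exp (- t * Re l) * (2 * norm l) * norm (deriv F (- (l\<^sup>2))) \<le> extremal_constant l + \<epsilon>"
proof -
  obtain K \<delta> where K: "compact K" "K \<subseteq> {s. Re s > 0}" and \<delta>: "\<delta> > 0"
    and bound: "\<And>g \<beta>. g holomorphic_on {s. Re s > 0} \<Longrightarrow> continuous_on {s. Re s \<ge> 0} g \<Longrightarrow>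
      \<beta> holomorphic_on {s. Re s > 0} \<Longrightarrow> continuous_on {s. Re s \<ge> 0} \<beta> \<Longrightarrow>
      (\<And>s. Re s \<ge> 0 \<Longrightarrow> norm (g s) \<le> 1) \<Longrightarrow> (\<And>s. Re s \<ge> 0 \<Longrightarrow> norm (\<beta> s) \<le> 1) \<Longrightarrow>
      (\<And>s. Re s = 0 \<Longrightarrow> norm (\<beta> s) = 1) \<Longrightarrow>
      (\<And>s. Re s = 0 \<Longrightarrow> g (- s) * \<beta> s = g s * \<beta> (- s)) \<Longrightarrow>
      g l = 0 \<Longrightarrow> (\<And>s. s \<in> K \<Longrightarrow> norm (\<beta> s) \<le> \<delta>) \<Longrightarrow>
      norm (deriv g l) \<le> extremal_constant l + \<epsilon>"
    by (rule half_plane_deriv_bound[OF l \<epsilon>]) blast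
  \<comment> \<open>The positive distance of \<open>K\<close> from the axis makes
    \<open>exp (- t m)\<close> a bound for \<open>\<beta>\<close> on \<open>K\<close>, below
    \<open>\<delta>\<close> for large \<open>t\<close>.\<close>
  have "\<exists>m>0. \<forall>s\<in>K. m \<le> Re s"
  proof (cases "K = {}")
    case False
    obtain s0 where "s0 \<in> K" "\<forall>s\<in>K. Re s0 \<le> Re s"
      using continuous_attains_inf[OF K(1) False linear_continuous_on[OF bounded_linear_Re]] by auto
    then show ?thesis using K(2) by blast
  qed (auto intro: exI[of _ 1])
  then obtain m where m: "m > 0" "\<And>s. s \<in> K \<Longrightarrow> m \<le> Re s" by blast
  have "((\<lambda>t. exp (- (t * m))) \<longlongrightarrow> 0) at_top" using m(1) by real_asymp
  then have "\<forall>\<^sub>F t in at_top. exp (- (t * m)) < \<delta>" using \<delta> by (rule order_tendstoD)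
  then show ?thesis using eventually_ge_at_top[of 0]
  proof eventually_elim
    case (elim t)
    show ?case
    proof (intro ballI impI)
      fix F assume F: "F \<in> entire_bdd t" and Fl: "F (- (l\<^sup>2)) = 0"
      define f where "f = (\<lambda>s. F (- (s\<^sup>2)))"
      have holF: "F holomorphic_on UNIV" using F by (simp add: entire_bdd_def)
      have "(F \<circ> (\<lambda>s. - (s\<^sup>2))) holomorphic_on UNIV"
        by (intro holomorphic_on_compose_gen[OF _ holF] holomorphic_intros) auto
      then have holf: "f holomorphic_on UNIV" by (simp add: f_def o_def)
      have axf: "norm (f s) \<le> 1" if "Re s = 0" for s
      proof -
        have "- (s\<^sup>2) = of_real ((Im s)\<^sup>2)" using that by (simp add: complex_eq_iff power2_eq_square)
        then show ?thesis using F by (simp add: f_def entire_bdd_def del: of_real_power)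
      qed
      have type: "\<exists>C. \<forall>s. norm (f s) \<le> C * exp (L * norm s)" if L: "L > t" for L
      proof -
        obtain C where C: "\<And>z. norm (F z) \<le> C * exp (L * sqrt (norm z))"
          using F L unfolding entire_bdd_def by blast
        have "norm (f s) \<le> C * exp (L * norm s)" for s
          using C[of "- (s\<^sup>2)"] by (simp add: f_def norm_power)
        then show ?thesis by blast
      qed
      have pl: "norm (f s) \<le> exp (t * Re s)" if "Re s \<ge> 0" for s
        using Phragmen_Lindelof_exponential_type[OF holf type axf elim(2) that] .
      define \<beta> where "\<beta> = (\<lambda>s::complex. exp (- (of_real t * s)))"
      have norm_\<beta>: "norm (\<beta> s) = exp (- (t * Re s))" for s by (simp add: \<beta>_def)
      define g where "g = (\<lambda>s. f s * \<beta> s)"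
      have hol\<beta>: "\<beta> holomorphic_on S" for S unfolding \<beta>_def by (intro holomorphic_intros)
      have holg: "g holomorphic_on S" for S
        unfolding g_def using hol\<beta> holf by (auto intro!: holomorphic_intros elim: holomorphic_on_subset)
      have "norm (deriv g l) \<le> extremal_constant l + \<epsilon>"
      proof (rule bound[OF holg _ hol\<beta>])
        show "continuous_on {s. 0 \<le> Re s} g" "continuous_on {s. 0 \<le> Re s} \<beta>"
          using holg hol\<beta> by (auto intro: holomorphic_on_imp_continuous_on)
        fix s :: complex
        show "norm (\<beta> s) \<le> 1" if "0 \<le> Re s" using that elim(2) by (simp add: norm_\<beta>)
        show "norm (g s) \<le> 1" if s: "0 \<le> Re s"
        proof -
          have "norm (g s) \<le> exp (t * Re s) * exp (- (t * Re s))"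
            unfolding g_def norm_mult norm_\<beta> using pl[OF s] by (intro mult_right_mono) auto
          then show ?thesis by (simp flip: exp_add)
        qed
        show "norm (\<beta> s) = 1" if "Re s = 0" using that by (simp add: norm_\<beta>)
        show "g (- s) * \<beta> s = g s * \<beta> (- s)" by (simp add: g_def f_def)
        show "g l = 0" using Fl by (simp add: g_def f_def)
        show "norm (\<beta> s) \<le> \<delta>" if "s \<in> K"
        proof -
          have "t * m \<le> t * Re s" using m that elim(2) by (intro mult_left_mono) auto
          then show ?thesis unfolding norm_\<beta>
            by (intro order_trans[OF _ less_imp_le[OF elim(1)]]) simp
        qed
      qed
      moreover have "deriv g l = deriv F (- (l\<^sup>2)) * (- (2 * l)) * \<beta> l"
      proof -
        have F': "(F has_field_derivative deriv F (- (l\<^sup>2))) (at (- (l\<^sup>2)))"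
          by (rule holomorphic_derivI[OF holF]) auto
        have f': "(f has_field_derivative deriv F (- (l\<^sup>2)) * (- (2 * l))) (at l)"
          unfolding f_def by (rule DERIV_chain2[where g="\<lambda>s. - (s\<^sup>2)" and x=l, OF F']) (auto intro!: derivative_eq_intros)
        have "(\<beta> has_field_derivative deriv \<beta> l) (at l)"
          by (rule holomorphic_derivI[OF hol\<beta>[of UNIV]]) auto
        from DERIV_mult[OF f' this] show ?thesis
          using Fl by (simp add: g_def f_def DERIV_imp_deriv)
      qed
      ultimately show "exp (- t * Re l) * (2 * norm l) * norm (deriv F (- (l\<^sup>2))) \<le> extremal_constant l + \<epsilon>"
        by (simp add: norm_mult norm_\<beta> mult_ac)
    qed
  qed
qed

text \<open>The competitor is even and entire of type at most \<open>t\<close> in \<open>s\<close>,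
  hence of growth \<open>exp (t sqrt |z|)\<close> in \<open>z = - s^2\<close>. Subtracting the small
  constant \<open>h (- l)\<close> and dividing by \<open>1 + \<epsilon>\<close> make it exactly
  admissible.\<close>

lemma entire_deriv_lower:
  assumes l: "Re l > 0" and \<epsilon>: "\<epsilon> > 0"
  shows "\<forall>\<^sub>F t in at_top. \<exists>F\<in>entire_bdd t. F (- (l\<^sup>2)) = 0 \<and>
    (extremal_constant l - \<epsilon>) / (1 + \<epsilon>) \<le> exp (- t * Re l) * (2 * norm l) * norm (deriv F (- (l\<^sup>2)))"
proof -
  define \<omega> where "\<omega> = norm l"
  define \<sigma> where "\<sigma> = Re l"
  have \<sigma>: "\<sigma> > 0" "\<omega> > 0" using l by (auto simp: \<sigma>_def \<omega>_def)
  define e1 where "e1 = (\<lambda>t s. exp_quotient (t / 4) (s + cnj l))"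
  define e2 where "e2 = (\<lambda>t s. exp_quotient (t / 4) (s + of_real \<omega>))"
  define a where "a = (\<lambda>t s. of_real \<sigma> * (e1 t l - e1 t s) * (1 + (l - of_real \<omega>) * e2 t s)\<^sup>2)"
  define \<beta> where "\<beta> = (\<lambda>(t::real) (s::complex). exp (- (of_real t * s)))"
  define h where "h = (\<lambda>t s. exp (of_real t * s) * a t s)"
  \<comment> \<open>What remains of the bound for the three quotients apart from the exponentials:
    polynomial in \<open>t\<close>, so harmless against
    \<open>exp (- t \<sigma> / 8)\<close>.\<close>
  define C where "C = (\<lambda>t. \<sigma> * (t / 2) * (1 + 2 * \<omega> * (t / 4))\<^sup>2)"
  have C_nonneg: "C t \<ge> 0" if "t \<ge> 0" for t unfolding C_def using that \<sigma> by simp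
  have q: "(\<lambda>s. exp_quotient \<tau> (s + p)) holomorphic_on S" for \<tau> p S
  proof -
    have "(exp_quotient \<tau> \<circ> (\<lambda>s. s + p)) holomorphic_on S"
      by (rule holomorphic_on_compose_gen[OF _ holomorphic_exp_quotient]) (auto intro!: holomorphic_intros)
    then show ?thesis by (simp add: o_def)
  qed
  have hol_e: "e1 t holomorphic_on S" "e2 t holomorphic_on S" for t S
    unfolding e1_def e2_def by (rule q)+
  have hol_a: "a t holomorphic_on S" for t S
    unfolding a_def by (intro holomorphic_intros hol_e)
  have hol_h: "h t holomorphic_on S" for t S
    unfolding h_def by (intro holomorphic_intros hol_a)
  have hol_h': "(\<lambda>s. h t (- s)) holomorphic_on S" for t S
  proof -
    have "(h t \<circ> (\<lambda>s. - s)) holomorphic_on S"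
      by (rule holomorphic_on_compose_gen[OF _ hol_h[of t UNIV]]) (auto intro!: holomorphic_intros)
    then show ?thesis by (simp add: o_def)
  qed
  have a_bound: "norm (a t s) \<le> C t * exp (3 / 4 * (t * x))" if t: "t \<ge> 0" and x: "x \<ge> 0" "- x \<le> Re s" for t s x
  proof -
    define E where "E = exp (t / 4 * x)"
    have E1: "E \<ge> 1" using t x by (simp add: E_def)
    have "norm (e1 t s) \<le> t / 4 * E" unfolding e1_def E_def
      using t x l by (intro norm_exp_quotient_le) auto
    moreover have "norm (e1 t l) \<le> t / 4 * exp (t / 4 * 0)" unfolding e1_def
      using t l by (intro norm_exp_quotient_le) auto
    then have "norm (e1 t l) \<le> t / 4 * E" using t E1 mult_left_mono[OF E1, of "t / 4"] by simp
    ultimately have 1: "norm (e1 t l - e1 t s) \<le> t / 2 * E"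
      using norm_triangle_ineq4[of "e1 t l" "e1 t s"] by linarith
    have "norm (e2 t s) \<le> t / 4 * E" unfolding e2_def E_def
      using t x \<sigma> by (intro norm_exp_quotient_le) auto
    moreover have "norm (l - of_real \<omega>) \<le> 2 * \<omega>"
      using norm_triangle_ineq4[of l "of_real \<omega>"] \<sigma> by (simp add: \<omega>_def)
    ultimately have "norm ((l - of_real \<omega>) * e2 t s) \<le> 2 * \<omega> * (t / 4 * E)"
      unfolding norm_mult using \<sigma> by (intro mult_mono) auto
    then have "norm (1 + (l - of_real \<omega>) * e2 t s) \<le> 1 * E + 2 * \<omega> * (t / 4) * E"
      using norm_triangle_ineq[of 1 "(l - of_real \<omega>) * e2 t s"] E1 unfolding norm_one mult.assoc by linarith
    then have 2: "norm (1 + (l - of_real \<omega>) * e2 t s) \<le> (1 + 2 * \<omega> * (t / 4)) * E" by (simp add: algebra_simps)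
    have "norm (a t s) = \<sigma> * norm (e1 t l - e1 t s) * (norm (1 + (l - of_real \<omega>) * e2 t s))\<^sup>2"
      using \<sigma> by (simp add: a_def norm_mult norm_power)
    also have "\<dots> \<le> \<sigma> * (t / 2 * E) * ((1 + 2 * \<omega> * (t / 4)) * E)\<^sup>2"
      using 1 2 \<sigma> t E1 by (intro mult_mono power_mono) auto
    also have "\<dots> = C t * E ^ 3" by (simp add: C_def power_mult_distrib power2_eq_square power3_eq_cube mult_ac)
    also have "E ^ 3 = exp (3 / 4 * (t * x))" by (simp add: E_def flip: exp_of_nat_mult)
    finally show ?thesis .
  qed
  \<comment> \<open>The gain \<open>exp (t Re s)\<close> beats the loss
    \<open>exp (3/4 t |Re s|)\<close> from the three quotients.\<close>
  have h_neg: "norm (h t s) \<le> C t * exp (t / 4 * Re s)" if t: "t \<ge> 0" and s: "Re s \<le> 0" for t s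
  proof -
    have "norm (h t s) \<le> exp (t * Re s) * (C t * exp (3 / 4 * (t * (- Re s))))"
      unfolding h_def norm_mult using a_bound[OF t, of "- Re s" s] s by (intro mult_mono) auto
    also have "\<dots> = C t * exp (t * Re s + 3 / 4 * (t * (- Re s)))" by (simp only: exp_add mult_ac)
    also have "t * Re s + 3 / 4 * (t * (- Re s)) = t / 4 * Re s" by simp
    finally show ?thesis .
  qed
  have h_bound: "norm (h t s) \<le> C t * exp (t * norm s)" if t: "t \<ge> 0" for t s
  proof (cases "Re s \<le> 0")
    case True
    then have "t / 4 * Re s \<le> 0" using t by (simp add: mult_nonneg_nonpos)
    also have "0 \<le> t * norm s" using t by simp
    finally have "C t * exp (t / 4 * Re s) \<le> C t * exp (t * norm s)" using C_nonneg[OF t] by (intro mult_left_mono) auto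
    then show ?thesis using h_neg[OF t True] by simp
  next
    case False
    have "norm (h t s) \<le> exp (t * norm s) * (C t * exp (3 / 4 * (t * 0)))"
      unfolding h_def norm_mult using a_bound[OF t, of 0 s] False t complex_Re_le_cmod[of s]
      by (intro mult_mono) (auto intro: mult_left_mono)
    then show ?thesis by (simp add: mult.commute)
  qed
  \<comment> \<open>The radius keeps \<open>Re s \<ge> \<sigma>/2\<close>, so that
    \<open>h (- s)\<close> tends to 0 uniformly on \<open>U\<close>.\<close>
  define U where "U = ball l (\<sigma> / 2)"
  have U: "Re s \<ge> \<sigma> / 2" if "s \<in> U" for s
    using that abs_Re_le_cmod[of "l - s"] by (auto simp: U_def dist_norm \<sigma>_def)
  have "\<forall>\<^sub>F t in at_top. (\<forall>s. Re s = 0 \<longrightarrow> norm (h t s + h t (- s) - h t (- l)) \<le> 1 + \<epsilon>) \<and>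
    extremal_constant l - \<epsilon> \<le> norm (\<beta> t l) * norm (deriv (\<lambda>s. h t s + h t (- s)) l)"
  proof (rule extremal_family[OF l, where U=U and ?e1.0=e1 and ?e2.0=e2])
    show "open U" "l \<in> U" using \<sigma> by (auto simp: U_def)
    show "U \<subseteq> {s. 0 \<le> Re s}"
    proof
      fix s assume "s \<in> U"
      then show "s \<in> {s. 0 \<le> Re s}" using U[of s] \<sigma> by simp
    qed
    show "uniform_limit {s. 0 \<le> Re s} e1 (\<lambda>s. 1 / (s + cnj l)) at_top"
      unfolding e1_def by (rule uniform_limit_exp_quotient) (use l in simp)
    show "uniform_limit {s. 0 \<le> Re s} e2 (\<lambda>s. 1 / (s + of_real (norm l))) at_top"
      unfolding e2_def \<omega>_def by (rule uniform_limit_exp_quotient) (use l in auto)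
    show "uniform_limit U (\<lambda>t s. h t (- s)) (\<lambda>_. 0) at_top"
      unfolding uniform_limit_iff
    proof (intro allI impI)
      fix e :: real assume e: "e > 0"
      have "((\<lambda>t. C t * exp (- (t / 4) * (\<sigma> / 2))) \<longlongrightarrow> 0) at_top"
        unfolding C_def using \<sigma> by real_asymp
      then have "\<forall>\<^sub>F t in at_top. C t * exp (- (t / 4) * (\<sigma> / 2)) < e" using e by (rule order_tendstoD)
      then show "\<forall>\<^sub>F t in at_top. \<forall>s\<in>U. dist (h t (- s)) 0 < e"
        using eventually_ge_at_top[of 0]
      proof eventually_elim
        case (elim t)
        show ?case
        proof
          fix s assume s: "s \<in> U"
          have "norm (h t (- s)) \<le> C t * exp (t / 4 * Re (- s))"
            using elim U[OF s] \<sigma> by (intro h_neg) auto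
          also have "\<dots> \<le> C t * exp (- (t / 4) * (\<sigma> / 2))"
          proof -
            have "t / 4 * (\<sigma> / 2) \<le> t / 4 * Re s" using U[OF s] elim(2) by (intro mult_left_mono) auto
            then show ?thesis using C_nonneg[OF elim(2)] by (intro mult_left_mono) auto
          qed
          finally show "dist (h t (- s)) 0 < e" using elim by simp
        qed
      qed
    qed
    show "\<beta> t s * h t s = of_real (Re l) * (e1 t l - e1 t s) * (1 + (l - of_real (norm l)) * e2 t s)\<^sup>2" for t s
      by (simp add: \<beta>_def h_def a_def \<sigma>_def \<omega>_def exp_minus)
    show "\<forall>\<^sub>F t in at_top. norm (\<beta> t l) \<le> 1"
      using eventually_ge_at_top[of 0] by eventually_elim (use l in \<open>simp add: \<beta>_def\<close>)
    show "\<beta> t holomorphic_on U" for t unfolding \<beta>_def by (intro holomorphic_intros)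
  qed (use hol_e hol_h hol_h' \<epsilon> in \<open>auto simp: \<beta>_def\<close>)
  then show ?thesis using eventually_ge_at_top[of 0]
  proof eventually_elim
    case (elim t)
    define f where "f = (\<lambda>s. (h t s + h t (- s) - h t (- l)) / of_real (1 + \<epsilon>))"
    have "of_real (1 + \<epsilon>) \<noteq> (0::complex)" using \<epsilon> by (simp del: of_real_add)
    then have holf: "f holomorphic_on UNIV"
      unfolding f_def by (intro holomorphic_intros hol_h hol_h')
    obtain F where F: "F holomorphic_on UNIV" "\<And>s. F (- (s\<^sup>2)) = f s"
      using even_entire_function[OF holf] by (auto simp: f_def add.commute)
    have norm_f: "norm (f s) = norm (h t s + h t (- s) - h t (- l)) / (1 + \<epsilon>)" for s
      using \<epsilon> unfolding f_def norm_divide norm_of_real by simp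
    define B where "B = (2 * C t + norm (h t (- l))) / (1 + \<epsilon>)"
    have B: "B \<ge> 0" using C_nonneg[OF elim(2)] \<epsilon> by (simp add: B_def)
    have f_bound: "norm (f s) \<le> B * exp (t * norm s)" for s
    proof -
      have "norm (h t s + h t (- s) - h t (- l)) \<le> norm (h t s) + norm (h t (- s)) + norm (h t (- l))"
        using norm_triangle_ineq4[of "h t s + h t (- s)" "h t (- l)"] norm_triangle_ineq[of "h t s" "h t (- s)"] by linarith
      also have "\<dots> \<le> C t * exp (t * norm s) + C t * exp (t * norm s) + norm (h t (- l)) * exp (t * norm s)"
        using h_bound[OF elim(2), of s] h_bound[OF elim(2), of "- s"] elim(2)
        by (intro add_mono) (auto simp: mult_le_cancel_left1)
      finally show ?thesis unfolding norm_f B_def using \<epsilon> by (simp add: divide_right_mono algebra_simps)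
    qed
    have sq: "z = - ((csqrt (- z))\<^sup>2)" for z by simp
    have "F \<in> entire_bdd t"
      unfolding entire_bdd_def
    proof (intro CollectI conjI allI impI F(1))
      fix L :: real assume L: "L > t"
      have "norm (F z) \<le> B * exp (L * sqrt (norm z))" for z
      proof -
        have "F z = f (csqrt (- z))" by (metis F(2) sq)
        then have "norm (F z) \<le> B * exp (t * sqrt (norm z))" using f_bound[of "csqrt (- z)"] by simp
        also have "\<dots> \<le> B * exp (L * sqrt (norm z))"
          using B L by (intro mult_left_mono) (auto intro: mult_right_mono)
        finally show ?thesis .
      qed
      then show "\<exists>C. \<forall>z. norm (F z) \<le> C * exp (L * sqrt (norm z))" by blast
    next
      fix x :: real assume x: "0 \<le> x"
      \<comment> \<open>The imaginary axis is mapped onto the nonnegative reals by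
        \<open>- s^2\<close>, so the bound on the axis is the one required.\<close>
      have "of_real x = - ((\<i> * of_real (sqrt x))\<^sup>2)" using x by (simp add: power_mult_distrib flip: of_real_power)
      then have "F (of_real x) = f (\<i> * of_real (sqrt x))" using F(2) by metis
      moreover have "norm (f (\<i> * of_real (sqrt x))) \<le> 1"
        unfolding norm_f using elim(1) \<epsilon> by simp
      ultimately show "norm (F (of_real x)) \<le> 1" by simp
    qed
    moreover have "h t l = 0" by (simp add: h_def a_def)
    then have "F (- (l\<^sup>2)) = 0" by (simp add: F(2) f_def)
    moreover have "(extremal_constant l - \<epsilon>) / (1 + \<epsilon>) \<le> exp (- t * Re l) * (2 * norm l) * norm (deriv F (- (l\<^sup>2)))"
    proof -
      have F': "(F has_field_derivative deriv F (- (l\<^sup>2))) (at (- (l\<^sup>2)))"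
        by (rule holomorphic_derivI[OF F(1)]) auto
      have "((\<lambda>s. F (- (s\<^sup>2))) has_field_derivative deriv F (- (l\<^sup>2)) * (- (2 * l))) (at l)"
        by (rule DERIV_chain2[where g="\<lambda>s. - (s\<^sup>2)" and x=l, OF F']) (auto intro!: derivative_eq_intros)
      then have 1: "deriv f l = deriv F (- (l\<^sup>2)) * (- (2 * l))"
        by (simp add: F(2) DERIV_imp_deriv)
      have "((\<lambda>s. h t s + h t (- s)) has_field_derivative deriv (\<lambda>s. h t s + h t (- s)) l) (at l)"
        by (rule holomorphic_derivI[where S=UNIV]) (auto intro!: holomorphic_intros hol_h hol_h')
      from DERIV_cdivide[OF DERIV_diff[OF this DERIV_const[of "h t (- l)"]], of "of_real (1 + \<epsilon>)"]
      have "(f has_field_derivative deriv (\<lambda>s. h t s + h t (- s)) l / of_real (1 + \<epsilon>)) (at l)"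
        by (simp add: f_def del: of_real_add)
      then have "deriv F (- (l\<^sup>2)) * (- (2 * l)) = deriv (\<lambda>s. h t s + h t (- s)) l / of_real (1 + \<epsilon>)"
        using 1 by (simp add: DERIV_imp_deriv)
      then have "norm (deriv F (- (l\<^sup>2)) * (- (2 * l))) = norm (deriv (\<lambda>s. h t s + h t (- s)) l) / (1 + \<epsilon>)"
        using \<epsilon> by (simp add: norm_divide del: of_real_add)
      moreover have "exp (- t * Re l) * (2 * norm l) * norm (deriv F (- (l\<^sup>2)))
          = norm (\<beta> t l) * norm (deriv F (- (l\<^sup>2)) * (- (2 * l)))"
        by (simp add: norm_mult \<beta>_def mult_ac)
      ultimately have "exp (- t * Re l) * (2 * norm l) * norm (deriv F (- (l\<^sup>2)))
          = norm (\<beta> t l) * norm (deriv (\<lambda>s. h t s + h t (- s)) l) / (1 + \<epsilon>)"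
        by simp
      also have "\<dots> \<ge> (extremal_constant l - \<epsilon>) / (1 + \<epsilon>)"
        using elim(1) \<epsilon> by (intro divide_right_mono) auto
      finally show ?thesis .
    qed
    ultimately show ?case by blast
  qed
qed

theorem A_entire_tendsto:
  assumes l: "Re l > 0"
  shows "((\<lambda>t. exp (- t * Re l) * A_entire t (- (l\<^sup>2)) * 2 * norm l) \<longlongrightarrow> extremal_constant l) at_top"
proof -
  define S where "S = (\<lambda>t. {norm (deriv F (- (l\<^sup>2))) | F. F \<in> entire_bdd t \<and> F (- (l\<^sup>2)) = 0})"
  have "((\<lambda>t. exp (- t * Re l) * (2 * norm l) * Sup (S t)) \<longlongrightarrow> extremal_constant l) at_top"
  proof (rule tendsto_times_Sup)
    show "exp (- t * Re l) * (2 * norm l) > 0" for t using l by (intro mult_pos_pos) auto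
    show "extremal_constant l \<ge> 0" using l by (simp add: extremal_constant_def)
    fix \<epsilon> :: real assume \<epsilon>: "\<epsilon> > 0"
    show "\<forall>\<^sub>F t in at_top. \<forall>x\<in>S t. exp (- t * Re l) * (2 * norm l) * x \<le> extremal_constant l + \<epsilon>"
      using entire_deriv_upper[OF l \<epsilon>] by eventually_elim (auto simp: S_def)
    show "\<forall>\<^sub>F t in at_top. \<exists>x\<in>S t. (extremal_constant l - \<epsilon>) / (1 + \<epsilon>) \<le> exp (- t * Re l) * (2 * norm l) * x"
      using entire_deriv_lower[OF l \<epsilon>] by eventually_elim (auto simp: S_def)
  qed
  then show ?thesis by (simp add: A_entire_def S_def mult_ac)
qed

section \<open>Polynomials\<close>

definition half_plane_blaschke :: "complex \<Rightarrow> complex \<Rightarrow> complex" where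
  "half_plane_blaschke p s = (s - p) / (s + cnj p)"

lemma half_plane_add_cnj_nonzero:
  assumes "Re p > 0" "Re s \<ge> 0"
  shows "s + cnj p \<noteq> 0" "s + p \<noteq> 0"
  using assms by (auto simp: complex_eq_iff)

lemma norm_half_plane_blaschke_square:
  assumes "Re p > 0" "Re s \<ge> 0"
  shows "(norm (half_plane_blaschke p s))\<^sup>2 = 1 - 4 * Re s * Re p / (norm (s + cnj p))\<^sup>2"
proof -
  have ne: "norm (s + cnj p) \<noteq> 0" using half_plane_add_cnj_nonzero[OF assms] by simp
  have "(norm (s - p))\<^sup>2 = (norm (s + cnj p))\<^sup>2 - 4 * Re s * Re p"
    unfolding cmod_power2 by (simp add: power2_eq_square algebra_simps)
  then show ?thesis using ne
    unfolding half_plane_blaschke_def norm_divide power_divide by (simp add: diff_divide_distrib)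
qed

lemma norm_half_plane_blaschke:
  assumes "Re p > 0"
  shows "Re s > 0 \<Longrightarrow> norm (half_plane_blaschke p s) < 1"
    and "Re s = 0 \<Longrightarrow> norm (half_plane_blaschke p s) = 1"
    and "Re s \<ge> 0 \<Longrightarrow> norm (half_plane_blaschke p s) \<le> 1"
proof -
  show 1: "norm (half_plane_blaschke p s) < 1" if s: "Re s > 0"
  proof -
    have "(norm (s + cnj p))\<^sup>2 > 0" using half_plane_add_cnj_nonzero[OF assms, of s] s by simp
    then have "(norm (half_plane_blaschke p s))\<^sup>2 < 1"
      using norm_half_plane_blaschke_square[OF assms, of s] s assms by simp
    then show ?thesis by (simp add: abs_square_less_1)
  qed
  show 2: "norm (half_plane_blaschke p s) = 1" if s: "Re s = 0"
  proof -
    have "(norm (half_plane_blaschke p s))\<^sup>2 = 1"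
      using norm_half_plane_blaschke_square[OF assms, of s] s by simp
    then show ?thesis by (simp add: power2_eq_1_iff) (smt (verit) norm_ge_zero)
  qed
  show "norm (half_plane_blaschke p s) \<le> 1" if "Re s \<ge> 0"
    using 1 2 that by (cases "Re s = 0") auto
qed

text \<open>On a compact subset of the open half-plane the maximum is attained and below 1, so
  powers of the Blaschke factor become uniformly small there.\<close>

lemma norm_half_plane_blaschke_compact:
  assumes p: "Re p > 0" and K: "compact K" "K \<subseteq> {s. Re s > 0}"
  obtains q where "0 \<le> q" "q < 1" "\<And>s. s \<in> K \<Longrightarrow> norm (half_plane_blaschke p s) \<le> q"
proof (cases "K = {}")
  case False
  have "continuous_on K (\<lambda>s. norm (half_plane_blaschke p s))"
    unfolding half_plane_blaschke_def using half_plane_add_cnj_nonzero[OF p] K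
    by (intro continuous_intros) (auto simp: subset_iff less_imp_le)
  then obtain s0 where "s0 \<in> K" "\<forall>s\<in>K. norm (half_plane_blaschke p s) \<le> norm (half_plane_blaschke p s0)"
    using continuous_attains_sup[OF K(1) False] by blast
  then show ?thesis using norm_half_plane_blaschke(1)[OF p, of s0] K
    by (intro that[of "norm (half_plane_blaschke p s0)"]) auto
qed (use that[of 0] in auto)

lemma poly_eq_sum_le:
  fixes P :: "complex poly"
  assumes "degree P \<le> n"
  shows "poly P z = (\<Sum>k\<le>n. coeff P k * z ^ k)"
proof -
  have "(\<Sum>k\<le>n. coeff P k * z ^ k) = (\<Sum>k\<le>degree P. coeff P k * z ^ k)"
    using assms by (intro sum.mono_neutral_right) (auto simp: coeff_eq_0)
  then show ?thesis by (simp add: poly_altdef)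
qed

text \<open>Interval and arc are both covered by \<open>\<kappa> + \<tau> / (s^2 - l0^2)\<close>:
  even in \<open>s\<close>, with \<open>l0\<close> as the preimage of infinity in the right
  half-plane, and with limit \<open>\<kappa>\<close> as \<open>s \<rightarrow> \<infinity>\<close>,
  the point of \<open>E\<close> that the finite axis does not reach.\<close>

locale quadratic_map =
  fixes l0 \<kappa> \<tau> :: complex
  assumes l0: "Re l0 > 0" and \<tau>: "\<tau> \<noteq> 0"
begin

definition Z :: "complex \<Rightarrow> complex" where "Z s = \<kappa> + \<tau> / (s\<^sup>2 - l0\<^sup>2)"

abbreviation "u \<equiv> half_plane_blaschke l0"

lemma square_neq:
  assumes "Re s \<ge> 0" "s \<noteq> l0"
  shows "s\<^sup>2 - l0\<^sup>2 \<noteq> 0"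
proof -
  have "s\<^sup>2 - l0\<^sup>2 = (s - l0) * (s + l0)" by (simp add: power2_eq_square algebra_simps)
  then show ?thesis using assms half_plane_add_cnj_nonzero(2)[OF l0, of s] by simp
qed

lemma axis_neq: "Re s = 0 \<Longrightarrow> s \<noteq> l0" using l0 by auto

lemma Z_deriv:
  assumes "Re l > 0" "l \<noteq> l0"
  shows "(Z has_field_derivative deriv Z l) (at l)" "deriv Z l \<noteq> 0"
proof -
  have ne: "l\<^sup>2 - l0\<^sup>2 \<noteq> 0" using square_neq assms by auto
  have d: "(Z has_field_derivative - (\<tau> * (2 * l)) / (l\<^sup>2 - l0\<^sup>2)\<^sup>2) (at l)"
    unfolding Z_def[abs_def] using ne by (auto intro!: derivative_eq_intros simp: power2_eq_square)
  then have e: "deriv Z l = - (\<tau> * (2 * l)) / (l\<^sup>2 - l0\<^sup>2)\<^sup>2" by (rule DERIV_imp_deriv)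
  show "(Z has_field_derivative deriv Z l) (at l)" using d unfolding e .
  show "deriv Z l \<noteq> 0" unfolding e using ne \<tau> assms by auto
qed

text \<open>A polynomial of degree at most \<open>n\<close> composed with \<open>Z\<close> has a
  pole of order at most \<open>n\<close> at \<open>l0\<close>, which \<open>u^n\<close> cancels. The
  product is bounded on the half-plane and by 1 on the axis, hence by 1 throughout.\<close>

lemma poly_deriv_upper:
  assumes l: "Re l > 0" "l \<noteq> l0" and \<epsilon>: "\<epsilon> > 0" and E: "Z ` {s. Re s = 0} \<subseteq> E"
  shows "\<forall>\<^sub>F n in sequentially. \<forall>P\<in>polys_bdd n E. poly P (Z l) = 0 \<longrightarrow>
    norm (u l) ^ n * norm (deriv Z l) * norm (poly (pderiv P) (Z l)) \<le> extremal_constant l + \<epsilon>"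
proof -
  obtain K \<delta> where K: "compact K" "K \<subseteq> {s. Re s > 0}" and \<delta>: "\<delta> > 0"
    and bound: "\<And>g \<beta>. g holomorphic_on {s. Re s > 0} \<Longrightarrow> continuous_on {s. Re s \<ge> 0} g \<Longrightarrow>
      \<beta> holomorphic_on {s. Re s > 0} \<Longrightarrow> continuous_on {s. Re s \<ge> 0} \<beta> \<Longrightarrow>
      (\<And>s. Re s \<ge> 0 \<Longrightarrow> norm (g s) \<le> 1) \<Longrightarrow> (\<And>s. Re s \<ge> 0 \<Longrightarrow> norm (\<beta> s) \<le> 1) \<Longrightarrow>
      (\<And>s. Re s = 0 \<Longrightarrow> norm (\<beta> s) = 1) \<Longrightarrow>
      (\<And>s. Re s = 0 \<Longrightarrow> g (- s) * \<beta> s = g s * \<beta> (- s)) \<Longrightarrow>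
      g l = 0 \<Longrightarrow> (\<And>s. s \<in> K \<Longrightarrow> norm (\<beta> s) \<le> \<delta>) \<Longrightarrow>
      norm (deriv g l) \<le> extremal_constant l + \<epsilon>"
    by (rule half_plane_deriv_bound[OF l(1) \<epsilon>]) blast
  obtain q where q: "0 \<le> q" "q < 1" "\<And>s. s \<in> K \<Longrightarrow> norm (u s) \<le> q"
    using norm_half_plane_blaschke_compact[OF l0 K] by metis
  have "\<forall>\<^sub>F n in sequentially. q ^ n < \<delta>"
    using q \<delta> by (intro order_tendstoD(2)[OF LIMSEQ_power_zero]) auto
  then show ?thesis
  proof eventually_elim
    case (elim n)
    show ?case
    proof (intro ballI impI)
      fix P assume "P \<in> polys_bdd n E" and Pl: "poly P (Z l) = 0"
      then have deg: "degree P \<le> n" and PE: "\<And>z. z \<in> E \<Longrightarrow> norm (poly P z) \<le> 1"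
        by (auto simp: polys_bdd_def)
      \<comment> \<open>\<open>Z u\<close> with the common factor \<open>s - l0\<close> cancelled.
        Defining \<open>g\<close> through it gives the right value at \<open>l0\<close>, where
        \<open>Z\<close> itself divides by zero.\<close>
      define Zu where "Zu = (\<lambda>s. \<kappa> * u s + \<tau> / ((s + l0) * (s + cnj l0)))"
      define g where "g = (\<lambda>s. \<Sum>k\<le>n. coeff P k * Zu s ^ k * u s ^ (n - k))"
      have Zu: "Zu s = Z s * u s" if "Re s \<ge> 0" "s \<noteq> l0" for s
      proof -
        have "s\<^sup>2 - l0\<^sup>2 = (s - l0) * (s + l0)" by (simp add: power2_eq_square algebra_simps)
        then have "\<tau> / (s\<^sup>2 - l0\<^sup>2) * u s = \<tau> / ((s + l0) * (s + cnj l0))"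
          using that by (simp add: half_plane_blaschke_def)
        then show ?thesis by (simp add: Zu_def Z_def distrib_right)
      qed
      have g_eq: "g s = poly P (Z s) * u s ^ n" if "Re s \<ge> 0" "s \<noteq> l0" for s
        unfolding g_def poly_eq_sum_le[OF deg] sum_distrib_right
      proof (rule sum.cong)
        fix k assume "k \<in> {..n}"
        then have "u s ^ n = u s ^ k * u s ^ (n - k)" by (simp flip: power_add)
        then show "coeff P k * Zu s ^ k * u s ^ (n - k) = coeff P k * Z s ^ k * u s ^ n"
          by (simp add: Zu[OF that] power_mult_distrib)
      qed simp
      have hol_u: "u holomorphic_on {s. Re s > 0}"
        unfolding half_plane_blaschke_def[abs_def] using half_plane_add_cnj_nonzero[OF l0]
        by (intro holomorphic_intros) auto
      have cont_u: "continuous_on {s. Re s \<ge> 0} u"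
        unfolding half_plane_blaschke_def[abs_def] using half_plane_add_cnj_nonzero[OF l0]
        by (intro continuous_intros) auto
      have hol_g: "g holomorphic_on {s. Re s > 0}"
        unfolding g_def Zu_def using half_plane_add_cnj_nonzero[OF l0]
        by (intro holomorphic_intros hol_u) auto
      have cont_g: "continuous_on {s. Re s \<ge> 0} g"
        unfolding g_def Zu_def using half_plane_add_cnj_nonzero[OF l0]
        by (intro continuous_intros cont_u) auto
      have u1: "norm (u s) \<le> 1" if "Re s \<ge> 0" for s using norm_half_plane_blaschke(3)[OF l0 that] .
      \<comment> \<open>Any finite bound will do, since Phragmen-Lindelof improves it to 1.\<close>
      define B where "B = norm \<kappa> + norm \<tau> / (Re l0 * Re l0)"
      have Zu_le: "norm (Zu s) \<le> B" if s: "Re s \<ge> 0" for s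
      proof -
        have "Re l0 * Re l0 \<le> norm (s + l0) * norm (s + cnj l0)"
          using complex_Re_le_cmod[of "s + l0"] complex_Re_le_cmod[of "s + cnj l0"] s l0
          by (intro mult_mono) auto
        then have "norm (\<tau> / ((s + l0) * (s + cnj l0))) \<le> norm \<tau> / (Re l0 * Re l0)"
          unfolding norm_divide norm_mult using l0 by (intro frac_le) auto
        moreover have "norm (\<kappa> * u s) \<le> norm \<kappa>" using u1[OF s] by (simp add: norm_mult mult_left_le)
        ultimately show ?thesis
          unfolding Zu_def B_def by (intro order_trans[OF norm_triangle_ineq]) simp
      qed
      have g_bdd: "norm (g s) \<le> (\<Sum>k\<le>n. norm (coeff P k) * B ^ k * 1)" if s: "Re s \<ge> 0" for s
        unfolding g_def
      proof (rule sum_norm_le)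
        fix k
        show "norm (coeff P k * Zu s ^ k * u s ^ (n - k)) \<le> norm (coeff P k) * B ^ k * 1"
          unfolding norm_mult norm_power using Zu_le[OF s] u1[OF s] order_trans[OF norm_ge_zero Zu_le[OF s]]
          by (intro mult_mono power_mono power_le_one) auto
      qed
      have g_axis: "norm (g s) \<le> 1" if s: "Re s = 0" for s
      proof -
        have "norm (g s) = norm (poly P (Z s))"
          using s axis_neq[OF s] norm_half_plane_blaschke(2)[OF l0 s] by (simp add: g_eq norm_mult norm_power)
        then show ?thesis using PE E s by auto
      qed
      have "norm (deriv g l) \<le> extremal_constant l + \<epsilon>"
      proof (rule bound[where \<beta>="\<lambda>s. u s ^ n"])
        show "g holomorphic_on {s. 0 < Re s}" "continuous_on {s. 0 \<le> Re s} g" by fact+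
        show "(\<lambda>s. u s ^ n) holomorphic_on {s. 0 < Re s}" by (intro holomorphic_intros hol_u)
        show "continuous_on {s. 0 \<le> Re s} (\<lambda>s. u s ^ n)" by (intro continuous_intros cont_u)
        fix s :: complex
        show "norm (g s) \<le> 1" if "0 \<le> Re s"
          by (rule Phragmen_Lindelof_half_plane_bounded[OF hol_g cont_g g_bdd g_axis that])
        show "norm (u s ^ n) \<le> 1" if "0 \<le> Re s" using u1[OF that] by (simp add: norm_power power_le_one)
        show "norm (u s ^ n) = 1" if "Re s = 0" using norm_half_plane_blaschke(2)[OF l0 that] by (simp add: norm_power)
        show "g (- s) * u s ^ n = g s * u (- s) ^ n" if s: "Re s = 0"
        proof -
          have "Z (- s) = Z s" by (simp add: Z_def)
          then show ?thesis using s axis_neq[of s] axis_neq[of "- s"] by (simp add: g_eq)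
        qed
        show "g l = 0" using l Pl by (simp add: g_eq)
        show "norm (u s ^ n) \<le> \<delta>" if "s \<in> K"
          using power_mono[OF q(3)[OF that], of n] elim by (simp add: norm_power)
      qed
      moreover have "deriv g l = poly (pderiv P) (Z l) * deriv Z l * u l ^ n"
      proof -
        have P': "((\<lambda>s. poly P (Z s)) has_field_derivative poly (pderiv P) (Z l) * deriv Z l) (at l)"
          by (rule DERIV_chain2[OF poly_DERIV Z_deriv(1)[OF l]])
        have u': "((\<lambda>s. u s ^ n) has_field_derivative deriv (\<lambda>s. u s ^ n) l) (at l)"
          by (rule holomorphic_derivI[where S="{s. Re s > 0}"])
            (use l hol_u in \<open>auto intro!: holomorphic_intros simp: open_halfspace_Re_gt\<close>)
        have "open ({s. Re s > 0} - {l0})" by (intro open_Diff open_halfspace_Re_gt) auto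
        from has_field_derivative_transform_within_open[OF DERIV_mult[OF P' u'] this, of g]
        show ?thesis using l Pl by (simp add: g_eq DERIV_imp_deriv)
      qed
      ultimately show "norm (u l) ^ n * norm (deriv Z l) * norm (poly (pderiv P) (Z l)) \<le> extremal_constant l + \<epsilon>"
        by (simp add: norm_mult norm_power mult_ac)
    qed
  qed
qed

section \<open>Geometric series for the simple poles\<close>

definition pole_sum :: "complex \<Rightarrow> nat \<Rightarrow> complex \<Rightarrow> complex" where
  "pole_sum p m s = (1 - u s) / (l0 + p) * (\<Sum>k<m. (half_plane_blaschke (cnj l0) p * u s) ^ k)"

text \<open>The truncated series multiplied by \<open>X^m\<close> and rewritten in
  \<open>X = 1/u\<close>. As a polynomial it can also be evaluated at the reflected point, where
  \<open>X\<close> is no longer the reciprocal of \<open>u s\<close>.\<close>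

definition pole_poly :: "complex \<Rightarrow> nat \<Rightarrow> complex poly" where
  "pole_poly p m = smult (1 / (l0 + p)) ([:-1, 1:] * (\<Sum>k<m. monom (half_plane_blaschke (cnj l0) p ^ k) (m - 1 - k)))"

text \<open>The full series of moduli, times the bound 2 for the prefactor \<open>1 - u\<close> or
  \<open>X - 1\<close>; independent of \<open>m\<close>.\<close>

definition pole_bound :: "complex \<Rightarrow> real" where
  "pole_bound p = 2 / norm (l0 + p) * (1 / (1 - norm (half_plane_blaschke (cnj l0) p)))"

lemma norm_q: "Re p > 0 \<Longrightarrow> norm (half_plane_blaschke (cnj l0) p) < 1"
  using norm_half_plane_blaschke(1)[of "cnj l0" p] l0 by simp

lemma pole_bound_nonneg: "Re p > 0 \<Longrightarrow> pole_bound p \<ge> 0"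
  using norm_q[of p] by (simp add: pole_bound_def)

lemma norm_geometric_sum_le:
  fixes q :: complex and v :: "nat \<Rightarrow> complex"
  assumes "norm q < 1" "\<And>k. k < m \<Longrightarrow> norm (v k) \<le> 1"
  shows "norm (\<Sum>k<m. q ^ k * v k) \<le> 1 / (1 - norm q)"
proof -
  have "norm (\<Sum>k<m. q ^ k * v k) \<le> (\<Sum>k<m. norm q ^ k)"
    using assms by (intro sum_norm_le) (auto simp: norm_mult norm_power intro: mult_left_le)
  also have "\<dots> = (1 - norm q ^ m) / (1 - norm q)" using assms by (simp add: sum_gp_strict)
  also have "\<dots> \<le> 1 / (1 - norm q)" using assms by (intro divide_right_mono) auto
  finally show ?thesis .
qed

lemma degree_pole_poly: "degree (pole_poly p m) \<le> m"
proof (cases "m = 0")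
  case False
  have "degree (\<Sum>k<m. monom (half_plane_blaschke (cnj l0) p ^ k) (m - 1 - k)) \<le> m - 1"
    by (intro degree_sum_le) (auto intro: order_trans[OF degree_monom_le])
  then have "degree ([:-1, 1:] * (\<Sum>k<m. monom (half_plane_blaschke (cnj l0) p ^ k) (m - 1 - k))) \<le> 1 + (m - 1)"
    by (intro order_trans[OF degree_mult_le] add_mono) auto
  then show ?thesis using False unfolding pole_poly_def by (intro order_trans[OF degree_smult_le]) auto
qed (simp add: pole_poly_def)

lemma poly_pole_poly:
  assumes X: "X * u s = 1"
  shows "poly (pole_poly p m) X = X ^ m * pole_sum p m s"
proof -
  define q where "q = half_plane_blaschke (cnj l0) p"
  have "(X - 1) * (q ^ k * X ^ (m - 1 - k)) = X ^ m * ((1 - u s) * (q * u s) ^ k)" if "k < m" for k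
  proof -
    have "m = (m - 1 - k) + k + 1" using that by simp
    then have "X ^ m = X ^ ((m - 1 - k) + k + 1)" by (rule arg_cong)
    also have "\<dots> = X ^ (m - 1 - k) * X ^ k * X" by (simp only: power_add power_one_right)
    finally have "X ^ m * ((1 - u s) * (q * u s) ^ k) = X ^ (m - 1 - k) * ((X * u s) ^ k) * q ^ k * (X - X * u s)"
      by (simp add: power_mult_distrib algebra_simps)
    then show ?thesis unfolding X by simp
  qed
  then have "(X - 1) * (\<Sum>k<m. q ^ k * X ^ (m - 1 - k)) = X ^ m * ((1 - u s) * (\<Sum>k<m. (q * u s) ^ k))"
    by (simp add: sum_distrib_left)
  moreover have "poly (pole_poly p m) X = 1 / (l0 + p) * ((X - 1) * (\<Sum>k<m. q ^ k * X ^ (m - 1 - k)))"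
    unfolding pole_poly_def poly_smult poly_mult poly_sum poly_monom q_def by simp
  ultimately show ?thesis
    by (simp add: pole_sum_def flip: q_def)
qed

lemma norm_pole_poly_le:
  assumes p: "Re p > 0" and X: "norm X \<le> 1"
  shows "norm (poly (pole_poly p m) X) \<le> pole_bound p"
proof -
  define q where "q = half_plane_blaschke (cnj l0) p"
  have "norm (\<Sum>k<m. q ^ k * X ^ (m - 1 - k)) \<le> 1 / (1 - norm q)"
    using norm_q[OF p] X by (intro norm_geometric_sum_le) (auto simp: q_def norm_power power_le_one)
  moreover have "norm (X - 1) \<le> 2" using norm_triangle_ineq4[of X 1] X by simp
  ultimately have "norm (X - 1) * norm (\<Sum>k<m. q ^ k * X ^ (m - 1 - k)) \<le> 2 * (1 / (1 - norm q))"
    by (intro mult_mono) auto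
  then have "norm (X - 1) * norm (\<Sum>k<m. q ^ k * X ^ (m - 1 - k)) / norm (l0 + p) \<le> 2 * (1 / (1 - norm q)) / norm (l0 + p)"
    by (intro divide_right_mono) auto
  moreover have "poly (pole_poly p m) X = 1 / (l0 + p) * ((X - 1) * (\<Sum>k<m. q ^ k * X ^ (m - 1 - k)))"
    unfolding pole_poly_def poly_smult poly_mult poly_sum poly_monom q_def by simp
  ultimately show ?thesis
    by (simp add: pole_bound_def norm_divide norm_mult mult.commute flip: q_def)
qed

lemma norm_pole_sum_le:
  assumes p: "Re p > 0" and s: "Re s \<ge> 0"
  shows "norm (pole_sum p m s) \<le> pole_bound p"
proof -
  define q where "q = half_plane_blaschke (cnj l0) p"
  have u1: "norm (u s) \<le> 1" by (rule norm_half_plane_blaschke(3)[OF l0 s])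
  have "norm (\<Sum>k<m. q ^ k * u s ^ k) \<le> 1 / (1 - norm q)"
    using norm_q[OF p] u1 by (intro norm_geometric_sum_le) (auto simp: q_def norm_power power_le_one)
  moreover have "norm (1 - u s) \<le> 2" using norm_triangle_ineq4[of 1 "u s"] u1 by simp
  ultimately have "norm (1 - u s) * norm (\<Sum>k<m. q ^ k * u s ^ k) \<le> 2 * (1 / (1 - norm q))"
    by (intro mult_mono) auto
  then have "norm (1 - u s) * norm (\<Sum>k<m. q ^ k * u s ^ k) / norm (l0 + p) \<le> 2 * (1 / (1 - norm q)) / norm (l0 + p)"
    by (intro divide_right_mono) auto
  then show ?thesis
    by (simp add: pole_sum_def pole_bound_def norm_divide norm_mult power_mult_distrib mult.commute flip: q_def)
qed

text \<open>With \<open>q = (p - cnj l0) / (p + l0)\<close>, of modulus below 1, the reciprocal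
  \<open>1/(s + p)\<close> equals \<open>(1 - u) / (l0 + p)\<close> times
  \<open>1 / (1 - q u)\<close>. The error is the tail of this geometric series after
  \<open>m\<close> terms.\<close>

lemma pole_sum_error:
  assumes p: "Re p > 0" and s: "Re s \<ge> 0"
  shows "norm (pole_sum p m s - 1 / (s + p)) \<le> pole_bound p * norm (half_plane_blaschke (cnj l0) p) ^ m"
proof -
  define q where "q = half_plane_blaschke (cnj l0) p"
  have q1: "norm q < 1" using norm_q[OF p] by (simp add: q_def)
  have u1: "norm (u s) \<le> 1" by (rule norm_half_plane_blaschke(3)[OF l0 s])
  have qu: "norm (q * u s) \<le> norm q" using u1 by (simp add: norm_mult mult_left_le)
  have ne1: "1 - q * u s \<noteq> 0" using qu q1 by auto
  have nz: "s + cnj l0 \<noteq> 0" "p + l0 \<noteq> 0" "s + p \<noteq> 0"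
    using half_plane_add_cnj_nonzero[OF l0 s] half_plane_add_cnj_nonzero[OF l0, of p] half_plane_add_cnj_nonzero[OF p s] p by auto
  have ll: "l0 + cnj l0 \<noteq> 0" using l0 by (auto simp: complex_eq_iff)
  have 1: "1 - u s = (l0 + cnj l0) / (s + cnj l0)"
    unfolding half_plane_blaschke_def using nz by (simp add: field_simps)
  have 2: "1 - q * u s = (s + p) * (l0 + cnj l0) / ((p + l0) * (s + cnj l0))"
  proof -
    have "1 - q * u s = 1 - ((p - cnj l0) * (s - l0)) / ((p + l0) * (s + cnj l0))"
      by (simp add: q_def half_plane_blaschke_def)
    also have "\<dots> = ((p + l0) * (s + cnj l0) - (p - cnj l0) * (s - l0)) / ((p + l0) * (s + cnj l0))"
      using nz by (simp only: diff_divide_distrib) simp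
    also have "(p + l0) * (s + cnj l0) - (p - cnj l0) * (s - l0) = (s + p) * (l0 + cnj l0)"
      by (simp add: algebra_simps)
    finally show ?thesis .
  qed
  have eq: "1 / (s + p) = (1 - u s) / (l0 + p) * (1 / (1 - q * u s))"
    unfolding 1 2 using nz ll by (simp add: add.commute)
  have "pole_sum p m s - 1 / (s + p) = (1 - u s) / (l0 + p) * ((\<Sum>k<m. (q * u s) ^ k) - 1 / (1 - q * u s))"
    unfolding eq pole_sum_def q_def[symmetric] by (simp add: algebra_simps)
  also have "(\<Sum>k<m. (q * u s) ^ k) - 1 / (1 - q * u s) = - ((q * u s) ^ m / (1 - q * u s))"
    using ne1 by (simp add: sum_gp_strict diff_divide_distrib)
  finally have "norm (pole_sum p m s - 1 / (s + p)) = norm (1 - u s) / norm (l0 + p) * (norm (q * u s) ^ m / norm (1 - q * u s))"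
    by (simp add: norm_mult norm_divide norm_power)
  also have "\<dots> \<le> 2 / norm (l0 + p) * (norm q ^ m / (1 - norm q))"
  proof (intro mult_mono frac_le divide_right_mono)
    show "norm (1 - u s) \<le> 2" using norm_triangle_ineq4[of 1 "u s"] u1 by simp
    show "norm (q * u s) ^ m \<le> norm q ^ m" using qu by (intro power_mono) auto
    show "1 - norm q \<le> norm (1 - q * u s)" using norm_triangle_ineq2[of 1 "q * u s"] qu by simp
  qed (use q1 nz in \<open>auto simp: add.commute\<close>)
  finally show ?thesis by (simp add: pole_bound_def q_def)
qed

text \<open>The divisor 6 is a degree budget: the three approximated factors use
  \<open>3 (n div 6) \<le> n/2\<close>, and the power of \<open>X\<close> left over, at least
  \<open>n/2\<close>, makes \<open>h (- s)\<close> decay.\<close>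

lemma uniform_limit_pole_sum:
  assumes p: "Re p > 0"
  shows "uniform_limit {s. Re s \<ge> 0} (\<lambda>n. pole_sum p (n div 6)) (\<lambda>s. 1 / (s + p)) sequentially"
  unfolding uniform_limit_iff
proof (intro allI impI)
  fix e :: real assume e: "e > 0"
  have "filterlim (\<lambda>n::nat. n div 6) at_top sequentially"
    by (rule filterlim_at_top_div_const_nat) simp
  then have "(\<lambda>n. norm (half_plane_blaschke (cnj l0) p) ^ (n div 6)) \<longlonglongrightarrow> 0"
    using norm_q[OF p] by (intro filterlim_compose[OF LIMSEQ_power_zero]) auto
  then have "(\<lambda>n. pole_bound p * norm (half_plane_blaschke (cnj l0) p) ^ (n div 6)) \<longlonglongrightarrow> 0"
    by (rule tendsto_mult_right_zero)
  then have "\<forall>\<^sub>F n in sequentially. pole_bound p * norm (half_plane_blaschke (cnj l0) p) ^ (n div 6) < e"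
    using e by (rule order_tendstoD)
  then show "\<forall>\<^sub>F n in sequentially. \<forall>s\<in>{s. Re s \<ge> 0}. dist (pole_sum p (n div 6) s) (1 / (s + p)) < e"
  proof eventually_elim
    case (elim n)
    then show ?case using pole_sum_error[OF p] unfolding dist_norm by (auto intro: le_less_trans)
  qed
qed

section \<open>Symmetric polynomials in \<open>xmap s\<close> and \<open>xmap (- s)\<close>\<close>

definition "xmap s = (s + cnj l0) / (s - l0)"

text \<open>Sum and product of \<open>xmap s\<close> and \<open>xmap (- s)\<close> are even with at
  most simple poles at \<open>\<plusminus> l0\<close>, hence affine in \<open>Z s\<close>; the
  two-term recurrence for power sums then raises the degree by one per step. For the interval the
  product is 1 and these are the Chebyshev polynomials \<open>2 T_k (z/2)\<close>.\<close>

lemma power_sum_poly: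
  "\<exists>p. degree p \<le> k \<and> (\<forall>s. s\<^sup>2 \<noteq> l0\<^sup>2 \<longrightarrow> poly p (Z s) = xmap s ^ k + xmap (- s) ^ k)"
proof -
  define c1 where "c1 = 2 * (l0 * cnj l0 + l0\<^sup>2) / \<tau>"
  define c2 where "c2 = (l0\<^sup>2 - (cnj l0)\<^sup>2) / \<tau>"
  define S1 where "S1 = [:2 - c1 * \<kappa>, c1:]"
  define S2 where "S2 = [:1 - c2 * \<kappa>, c2:]"
  have S: "poly S1 (Z s) = xmap s + xmap (- s)" "poly S2 (Z s) = xmap s * xmap (- s)" if "s\<^sup>2 \<noteq> l0\<^sup>2" for s
  proof -
    have f: "s\<^sup>2 - l0\<^sup>2 = (s - l0) * (s + l0)" by (simp add: power2_eq_square algebra_simps)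
    have ne: "s - l0 \<noteq> 0" "s + l0 \<noteq> 0" "- s - l0 \<noteq> 0" using that by (auto simp: power2_eq_iff add_eq_0_iff)
    have x': "xmap (- s) = (s - cnj l0) / (s + l0)"
      using ne by (simp add: xmap_def field_simps)
    have "poly S1 (Z s) = 2 + c1 * (\<tau> / (s\<^sup>2 - l0\<^sup>2))" by (simp add: S1_def Z_def algebra_simps)
    also have "\<dots> = 2 + 2 * (l0 * cnj l0 + l0\<^sup>2) / ((s - l0) * (s + l0))" using \<tau> by (simp add: c1_def f)
    also have "\<dots> = (2 * ((s - l0) * (s + l0)) + 2 * (l0 * cnj l0 + l0\<^sup>2)) / ((s - l0) * (s + l0))"
      using ne by (simp only: add_divide_distrib) simp
    also have "2 * ((s - l0) * (s + l0)) + 2 * (l0 * cnj l0 + l0\<^sup>2)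
        = (s + cnj l0) * (s + l0) + (s - cnj l0) * (s - l0)"
      by (simp add: algebra_simps power2_eq_square)
    also have "\<dots> / ((s - l0) * (s + l0)) = xmap s + xmap (- s)"
      unfolding x' xmap_def[of s] using add_frac_eq[OF ne(1,2), of "s + cnj l0" "s - cnj l0"] by simp
    finally show "poly S1 (Z s) = xmap s + xmap (- s)" .
    have "poly S2 (Z s) = 1 + c2 * (\<tau> / (s\<^sup>2 - l0\<^sup>2))" by (simp add: S2_def Z_def algebra_simps)
    also have "\<dots> = 1 + (l0\<^sup>2 - (cnj l0)\<^sup>2) / ((s - l0) * (s + l0))" using \<tau> by (simp add: c2_def f)
    also have "\<dots> = ((s - l0) * (s + l0) + (l0\<^sup>2 - (cnj l0)\<^sup>2)) / ((s - l0) * (s + l0))"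
      using ne by (simp only: add_divide_distrib) simp
    also have "(s - l0) * (s + l0) + (l0\<^sup>2 - (cnj l0)\<^sup>2) = (s + cnj l0) * (s - cnj l0)"
      by (simp add: algebra_simps power2_eq_square)
    also have "\<dots> / ((s - l0) * (s + l0)) = xmap s * xmap (- s)"
      unfolding x' xmap_def[of s] by simp
    finally show "poly S2 (Z s) = xmap s * xmap (- s)" .
  qed
  have deg: "degree S1 \<le> 1" "degree S2 \<le> 1" by (auto simp: S1_def S2_def)
  show ?thesis
  proof (induction k rule: induct_nat_012)
    case 0
    show ?case by (rule exI[of _ "[:2:]"]) simp
  next
    case 1
    show ?case by (rule exI[of _ S1]) (use S deg in auto)
  next
    case (ge2 k)
    then obtain p p' where p: "degree p \<le> k" "\<And>s. s\<^sup>2 \<noteq> l0\<^sup>2 \<Longrightarrow> poly p (Z s) = xmap s ^ k + xmap (- s) ^ k"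
      and p': "degree p' \<le> Suc k" "\<And>s. s\<^sup>2 \<noteq> l0\<^sup>2 \<Longrightarrow> poly p' (Z s) = xmap s ^ Suc k + xmap (- s) ^ Suc k"
      by blast
    show ?case
    proof (intro exI[of _ "S1 * p' - S2 * p"] conjI allI impI)
      have "degree (S1 * p') \<le> 1 + Suc k" using deg p' by (intro order_trans[OF degree_mult_le] add_mono) auto
      moreover have "degree (S2 * p) \<le> 1 + k" using deg p by (intro order_trans[OF degree_mult_le] add_mono) auto
      ultimately show "degree (S1 * p' - S2 * p) \<le> Suc (Suc k)" by (intro degree_diff_le) auto
      fix s assume s: "s\<^sup>2 \<noteq> l0\<^sup>2"
      show "poly (S1 * p' - S2 * p) (Z s) = xmap s ^ Suc (Suc k) + xmap (- s) ^ Suc (Suc k)"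
        by (simp add: S[OF s] p(2)[OF s] p'(2)[OF s] algebra_simps)
    qed
  qed
qed

text \<open>Turns the even function \<open>h s + h (- s)\<close>, with \<open>h\<close> a polynomial
  in \<open>xmap s\<close>, into a polynomial in \<open>Z s\<close> without raising the
  degree.\<close>

lemma symmetric_poly:
  assumes "degree Q \<le> n"
  obtains P where "degree P \<le> n" "\<And>s. s\<^sup>2 \<noteq> l0\<^sup>2 \<Longrightarrow> poly P (Z s) = poly Q (xmap s) + poly Q (xmap (- s))"
proof -
  obtain p where p: "\<And>k. degree (p k) \<le> k" "\<And>k s. s\<^sup>2 \<noteq> l0\<^sup>2 \<Longrightarrow> poly (p k) (Z s) = xmap s ^ k + xmap (- s) ^ k"
    using power_sum_poly by metis
  show ?thesis
  proof (rule that[of "\<Sum>k\<le>n. smult (coeff Q k) (p k)"])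
    show "degree (\<Sum>k\<le>n. smult (coeff Q k) (p k)) \<le> n"
      by (intro degree_sum_le) (auto intro: order_trans[OF degree_smult_le] order_trans[OF p(1)])
    fix s assume s: "s\<^sup>2 \<noteq> l0\<^sup>2"
    show "poly (\<Sum>k\<le>n. smult (coeff Q k) (p k)) (Z s) = poly Q (xmap s) + poly Q (xmap (- s))"
      unfolding poly_eq_sum_le[OF assms]
      by (simp add: poly_sum p(2)[OF s] distrib_left sum.distrib)
  qed
qed

lemma xmap_u: "Re s \<ge> 0 \<Longrightarrow> s \<noteq> l0 \<Longrightarrow> xmap s * u s = 1"
  using half_plane_add_cnj_nonzero[OF l0, of s] by (simp add: xmap_def half_plane_blaschke_def)

text \<open>The reason why \<open>h (- s)\<close> is negligible: at the reflected point
  \<open>1/u\<close> is itself a Blaschke factor, of modulus below 1 in the open half-plane.\<close>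

lemma xmap_minus: "Re s \<ge> 0 \<Longrightarrow> xmap (- s) = half_plane_blaschke (cnj l0) s"
  using half_plane_add_cnj_nonzero[OF l0, of s] minus_divide_divide[of "s - cnj l0" "s + l0"]
  by (simp add: xmap_def half_plane_blaschke_def)

text \<open>The approximated extremal factor is a polynomial in \<open>u\<close>; divided by
  \<open>u^n\<close> it becomes a polynomial in \<open>1/u\<close> of degree at most
  \<open>n\<close>, and symmetrising it yields an admissible polynomial in \<open>Z s\<close>, up to
  the same correction and normalisation as for entire functions.\<close>

lemma poly_deriv_lower:
  assumes l: "Re l > 0" "l \<noteq> l0" and \<epsilon>: "\<epsilon> > 0" and E: "E \<subseteq> insert \<kappa> (Z ` {s. Re s = 0})"
  shows "\<forall>\<^sub>F n in sequentially. \<exists>P\<in>polys_bdd n E. poly P (Z l) = 0 \<and>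
    (extremal_constant l - \<epsilon>) / (1 + \<epsilon>) \<le> norm (u l) ^ n * norm (deriv Z l) * norm (poly (pderiv P) (Z l))"
proof -
  define \<omega> where "\<omega> = complex_of_real (norm l)"
  define \<sigma> where "\<sigma> = complex_of_real (Re l)"
  have \<omega>: "Re \<omega> > 0" using l by (auto simp: \<omega>_def)
  have cl: "Re (cnj l) > 0" using l by simp
  define e1 where "e1 = (\<lambda>n. pole_sum (cnj l) (n div 6))"
  define e2 where "e2 = (\<lambda>n. pole_sum \<omega> (n div 6))"
  \<comment> \<open>Each of the three factors is multiplied by \<open>X^(n div 6)\<close> to clear
    its negative powers of \<open>X\<close>; the leftover power brings the total degree up to
    \<open>n\<close>.\<close>
  define Q where "Q = (\<lambda>n. monom 1 (n - 3 * (n div 6)) *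
    (smult \<sigma> (monom (e1 n l) (n div 6) - pole_poly (cnj l) (n div 6)) *
      (monom 1 (n div 6) + smult (l - \<omega>) (pole_poly \<omega> (n div 6)))\<^sup>2))"
  define h where "h = (\<lambda>n s. poly (Q n) (xmap s))"
  define \<beta> where "\<beta> = (\<lambda>n s. u s ^ n)"
  have Q_eq: "poly (Q n) X = X ^ (n - 3 * (n div 6)) * (\<sigma> * (e1 n l * X ^ (n div 6) - poly (pole_poly (cnj l) (n div 6)) X)
      * (X ^ (n div 6) + (l - \<omega>) * poly (pole_poly \<omega> (n div 6)) X)\<^sup>2)" for n X
    by (simp add: Q_def poly_monom)
  have degQ: "degree (Q n) \<le> n" for n
  proof -
    define m where "m = n div 6"
    have "degree (smult \<sigma> (monom (e1 n l) m - pole_poly (cnj l) m)) \<le> m"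
      by (intro order_trans[OF degree_smult_le] degree_diff_le degree_monom_le degree_pole_poly)
    moreover have "degree ((monom 1 m + smult (l - \<omega>) (pole_poly \<omega> m))\<^sup>2) \<le> m + m"
      unfolding power2_eq_square
      by (intro order_trans[OF degree_mult_le] add_mono degree_add_le degree_monom_le order_trans[OF degree_smult_le] degree_pole_poly)
    ultimately have "degree (Q n) \<le> (n - 3 * m) + (m + (m + m))"
      unfolding Q_def m_def[symmetric]
      by (intro order_trans[OF degree_mult_le] add_mono degree_monom_le)
    also have "\<dots> = n" by (simp add: m_def)
    finally show ?thesis .
  qed
  have eq: "\<beta> n s * h n s = \<sigma> * (e1 n l - e1 n s) * (1 + (l - \<omega>) * e2 n s)\<^sup>2"
    if "Re s \<ge> 0" "s \<noteq> l0" for n s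
  proof -
    define m where "m = n div 6"
    define X where "X = xmap s"
    have X: "X * u s = 1" using xmap_u[OF that] by (simp add: X_def)
    have "h n s = X ^ (n - 3 * m) * (\<sigma> * (e1 n l * X ^ m - X ^ m * e1 n s) * (X ^ m + (l - \<omega>) * (X ^ m * e2 n s))\<^sup>2)"
      unfolding h_def Q_eq X_def[symmetric] m_def[symmetric] poly_pole_poly[OF X] e1_def e2_def ..
    also have "\<dots> = (X ^ (n - 3 * m) * X ^ (m + (m + m))) * (\<sigma> * (e1 n l - e1 n s) * (1 + (l - \<omega>) * e2 n s)\<^sup>2)"
      by (simp add: power_add power2_eq_square algebra_simps)
    also have "X ^ (n - 3 * m) * X ^ (m + (m + m)) = X ^ n"
    proof -
      have "n - 3 * m + (m + (m + m)) = n" by (simp add: m_def)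
      then show ?thesis by (metis power_add)
    qed
    finally have "\<beta> n s * h n s = (X * u s) ^ n * (\<sigma> * (e1 n l - e1 n s) * (1 + (l - \<omega>) * e2 n s)\<^sup>2)"
      by (simp add: \<beta>_def power_mult_distrib mult_ac)
    then show ?thesis unfolding X by simp
  qed
  \<comment> \<open>The closed ball has to avoid \<open>l0\<close>, where \<open>u\<close> vanishes
    and \<open>xmap\<close> has its pole.\<close>
  have "open ({s. Re s > 0} - {l0})" by (intro open_Diff open_halfspace_Re_gt) auto
  then obtain r where r: "r > 0" "cball l r \<subseteq> {s. Re s > 0} - {l0}"
    using l by (auto simp: open_contains_cball)
  define U where "U = ball l r"
  have U: "Re s > 0" "s \<noteq> l0" if "s \<in> U" for s
  proof -
    have "s \<in> cball l r" using that by (simp add: U_def)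
    then have "s \<in> {s. Re s > 0} - {l0}" using r(2) by blast
    then show "Re s > 0" "s \<noteq> l0" by auto
  qed
  have cnjl0: "Re (cnj l0) > 0" using l0 by simp
  obtain q where q: "0 \<le> q" "q < 1" "\<And>s. s \<in> cball l r \<Longrightarrow> norm (half_plane_blaschke (cnj l0) s) \<le> q"
    using norm_half_plane_blaschke_compact[OF cnjl0, of "cball l r"] r by auto
  define B where "B = Re l * (pole_bound (cnj l) + pole_bound (cnj l)) * (1 + norm (l - \<omega>) * pole_bound \<omega>)\<^sup>2"
  have h_neg: "norm (h n (- s)) \<le> q ^ (n div 6) * B" if s: "s \<in> U" for n s
  proof -
    define m where "m = n div 6"
    define X where "X = xmap (- s)"
    have "norm X \<le> q" unfolding X_def using q(3)[of s] s xmap_minus[of s] U[OF s] by (auto simp: U_def)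
    then have X: "norm X \<le> q" "norm X \<le> 1" using q by auto
    have Xm: "norm (X ^ m) \<le> 1" using X by (simp add: norm_power power_le_one)
    have "norm (e1 n l) \<le> pole_bound (cnj l)" unfolding e1_def using l cl by (intro norm_pole_sum_le) auto
    then have "norm (e1 n l * X ^ m) \<le> pole_bound (cnj l) * 1"
      unfolding norm_mult using Xm pole_bound_nonneg[OF cl] by (intro mult_mono) auto
    then have 1: "norm (e1 n l * X ^ m - poly (pole_poly (cnj l) m) X) \<le> pole_bound (cnj l) + pole_bound (cnj l)"
      using norm_pole_poly_le[OF cl X(2), of m]
      by (intro order_trans[OF norm_triangle_ineq4] add_mono) auto
    have 2: "norm (X ^ m + (l - \<omega>) * poly (pole_poly \<omega> m) X) \<le> 1 + norm (l - \<omega>) * pole_bound \<omega>"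
      using Xm norm_pole_poly_le[OF \<omega> X(2), of m]
      by (intro order_trans[OF norm_triangle_ineq] add_mono) (auto simp: norm_mult intro: mult_left_mono)
    have "m \<le> n - 3 * m" by (simp add: m_def)
    then have "norm X ^ (n - 3 * m) \<le> norm X ^ m" using X by (intro power_decreasing) auto
    also have "\<dots> \<le> q ^ m" using X by (intro power_mono) auto
    finally have 3: "norm (X ^ (n - 3 * m)) \<le> q ^ m" by (simp add: norm_power)
    have "norm (\<sigma> * (e1 n l * X ^ m - poly (pole_poly (cnj l) m) X) * (X ^ m + (l - \<omega>) * poly (pole_poly \<omega> m) X)\<^sup>2) \<le> B"
      unfolding B_def norm_mult norm_power using 1 2 l pole_bound_nonneg[OF cl]
      by (intro mult_mono power_mono) (auto simp: \<sigma>_def)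
    then show ?thesis
      unfolding h_def Q_eq X_def[symmetric] m_def[symmetric] norm_mult[of "X ^ (n - 3 * m)"]
      using 3 q by (intro mult_mono) auto
  qed
  have hol_u: "u holomorphic_on U"
    unfolding half_plane_blaschke_def[abs_def] using half_plane_add_cnj_nonzero[OF l0] U
    by (intro holomorphic_intros) (auto simp: less_imp_le)
  have hol_e: "e1 n holomorphic_on U" "e2 n holomorphic_on U" for n
    unfolding e1_def e2_def pole_sum_def[abs_def]
    using half_plane_add_cnj_nonzero(2)[OF l0, of "cnj l"] half_plane_add_cnj_nonzero(2)[OF l0, of \<omega>] cl \<omega>
    by (auto intro!: holomorphic_intros hol_u simp: add.commute)
  have poly_hol: "(\<lambda>s. poly p (f s)) holomorphic_on U" if "f holomorphic_on U" for p f
    unfolding poly_altdef using that by (intro holomorphic_intros)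
  have hol_h: "h n holomorphic_on U" "(\<lambda>s. h n (- s)) holomorphic_on U" for n
  proof -
    show "h n holomorphic_on U"
      unfolding h_def xmap_def using U(2) by (intro poly_hol holomorphic_intros) auto
    have "- s - l0 \<noteq> 0" if "s \<in> U" for s
      using half_plane_add_cnj_nonzero(2)[OF l0, of s] U(1)[OF that] by (auto simp: algebra_simps add_eq_0_iff)
    then show "(\<lambda>s. h n (- s)) holomorphic_on U"
      unfolding h_def xmap_def by (intro poly_hol holomorphic_intros) auto
  qed
  have div6: "filterlim (\<lambda>n::nat. n div 6) at_top sequentially"
    by (rule filterlim_at_top_div_const_nat) simp
  have "\<forall>\<^sub>F n in sequentially. (\<forall>s. Re s = 0 \<longrightarrow> norm (h n s + h n (- s) - h n (- l)) \<le> 1 + \<epsilon>) \<and>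
    extremal_constant l - \<epsilon> \<le> norm (\<beta> n l) * norm (deriv (\<lambda>s. h n s + h n (- s)) l)"
  proof (rule extremal_family[OF l(1), where U=U and ?e1.0=e1 and ?e2.0=e2])
    show "open U" "l \<in> U" using r by (auto simp: U_def)
    show "U \<subseteq> {s. 0 \<le> Re s}" using U(1) by (auto simp: less_imp_le)
    show "uniform_limit {s. 0 \<le> Re s} e1 (\<lambda>s. 1 / (s + cnj l)) sequentially"
      unfolding e1_def by (rule uniform_limit_pole_sum[OF cl])
    show "uniform_limit {s. 0 \<le> Re s} e2 (\<lambda>s. 1 / (s + of_real (norm l))) sequentially"
      unfolding e2_def \<omega>_def[symmetric] by (rule uniform_limit_pole_sum[OF \<omega>])
    show "uniform_limit U (\<lambda>n s. h n (- s)) (\<lambda>_. 0) sequentially"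
      unfolding uniform_limit_iff
    proof (intro allI impI)
      fix e :: real assume e: "e > 0"
      have "(\<lambda>n. q ^ (n div 6)) \<longlonglongrightarrow> 0"
        using q by (intro filterlim_compose[OF LIMSEQ_power_zero div6]) auto
      then have "(\<lambda>n. q ^ (n div 6) * B) \<longlonglongrightarrow> 0" by (rule tendsto_mult_left_zero)
      then have "\<forall>\<^sub>F n in sequentially. q ^ (n div 6) * B < e" using e by (rule order_tendstoD)
      then show "\<forall>\<^sub>F n in sequentially. \<forall>s\<in>U. dist (h n (- s)) 0 < e"
        by eventually_elim (use h_neg in \<open>auto intro: le_less_trans\<close>)
    qed
    show "\<beta> n s * h n s = of_real (Re l) * (e1 n l - e1 n s) * (1 + (l - of_real (norm l)) * e2 n s)\<^sup>2"
      if "s \<in> U \<or> Re s = 0" for n s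
      using eq[of s n] that U[of s] axis_neq[of s] by (auto simp: \<sigma>_def \<omega>_def)
    show "norm (\<beta> n s) = 1" if "Re s = 0" for n s
      using norm_half_plane_blaschke(2)[OF l0 that] by (simp add: \<beta>_def norm_power)
    show "\<forall>\<^sub>F n in sequentially. norm (\<beta> n l) \<le> 1"
      using norm_half_plane_blaschke(3)[OF l0, of l] l by (simp add: \<beta>_def norm_power power_le_one)
    show "\<beta> n l \<noteq> 0" for n
      using xmap_u[of l] l by (auto simp: \<beta>_def)
    show "\<beta> n holomorphic_on U" for n unfolding \<beta>_def by (intro holomorphic_intros hol_u)
  qed (use hol_e hol_h \<epsilon> in auto)
  then show ?thesis
  proof eventually_elim
    case (elim n)
    obtain P0 where P0: "degree P0 \<le> n" "\<And>s. s\<^sup>2 \<noteq> l0\<^sup>2 \<Longrightarrow> poly P0 (Z s) = h n s + h n (- s)"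
      using symmetric_poly[OF degQ[of n]] unfolding h_def by metis
    define P where "P = smult (1 / of_real (1 + \<epsilon>)) (P0 - [:h n (- l):])"
    have P_eq: "poly P (Z s) = (h n s + h n (- s) - h n (- l)) / of_real (1 + \<epsilon>)" if "Re s \<ge> 0" "s \<noteq> l0" for s
      using P0(2)[of s] square_neq[OF that] by (simp add: P_def)
    have norm_eps: "norm (of_real (1 + \<epsilon>) :: complex) = 1 + \<epsilon>" using \<epsilon> by (simp del: of_real_add)
    have P_axis: "norm (poly P (Z s)) \<le> 1" if s: "Re s = 0" for s
      using elim s axis_neq[OF s] \<epsilon> by (simp add: P_eq norm_divide norm_eps del: of_real_add)
    \<comment> \<open>\<open>\<kappa>\<close> is not attained on the axis but is the limit of
      \<open>Z\<close> along it, so the bound passes over by continuity.\<close>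
    have P_\<kappa>: "norm (poly P \<kappa>) \<le> 1"
    proof (rule Lim_norm_ubound[where net="at_top :: real filter" and f="\<lambda>y. poly P (Z (\<i> * of_real y))"])
      have "((\<lambda>y. \<tau> / ((\<i> * of_real y)\<^sup>2 - l0\<^sup>2)) \<longlongrightarrow> 0) (at_top :: real filter)"
      proof (rule tendsto_divide_0[OF tendsto_const filterlim_norm_at_top_imp_at_infinity])
        show "filterlim (\<lambda>y::real. norm ((\<i> * of_real y)\<^sup>2 - l0\<^sup>2)) at_top at_top"
        proof (rule filterlim_at_top_mono)
          show "filterlim (\<lambda>y::real. y\<^sup>2 - (norm l0)\<^sup>2) at_top at_top" by real_asymp
          show "\<forall>\<^sub>F y in at_top. y\<^sup>2 - (norm l0)\<^sup>2 \<le> norm ((\<i> * of_real y)\<^sup>2 - l0\<^sup>2)"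
          proof (intro always_eventually allI)
            fix y :: real
            show "y\<^sup>2 - (norm l0)\<^sup>2 \<le> norm ((\<i> * of_real y)\<^sup>2 - l0\<^sup>2)"
              using norm_triangle_ineq2[of "(\<i> * of_real y)\<^sup>2" "l0\<^sup>2"] by (simp add: norm_power norm_mult power_mult_distrib)
          qed
        qed
      qed
      then have "((\<lambda>y. Z (\<i> * of_real y)) \<longlongrightarrow> \<kappa> + 0) (at_top :: real filter)"
        unfolding Z_def by (intro tendsto_intros)
      then show "((\<lambda>y. poly P (Z (\<i> * of_real y))) \<longlongrightarrow> poly P \<kappa>) (at_top :: real filter)"
        by (intro tendsto_poly) simp
      show "\<forall>\<^sub>F y in at_top. norm (poly P (Z (\<i> * of_real y))) \<le> 1"
        by (intro always_eventually allI P_axis) simp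
    qed simp
    have "degree P \<le> n"
      unfolding P_def using P0(1) by (intro order_trans[OF degree_smult_le] degree_diff_le) auto
    then have "P \<in> polys_bdd n E" using E P_axis P_\<kappa> by (auto simp: polys_bdd_def)
    moreover have "h n l = 0"
      using eq[of l n] xmap_u[of l] l by (auto simp: \<beta>_def)
    then have "poly P (Z l) = 0" using l by (simp add: P_eq)
    moreover have "(extremal_constant l - \<epsilon>) / (1 + \<epsilon>) \<le> norm (u l) ^ n * norm (deriv Z l) * norm (poly (pderiv P) (Z l))"
    proof -
      have U': "open U" "l \<in> U" using r by (auto simp: U_def)
      have d: "((\<lambda>s. h n s + h n (- s)) has_field_derivative deriv (\<lambda>s. h n s + h n (- s)) l) (at l)"
        by (rule holomorphic_derivI[OF _ U']) (intro holomorphic_intros hol_h)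
      from DERIV_cdivide[OF DERIV_diff[OF this DERIV_const[of "h n (- l)"]], of "of_real (1 + \<epsilon>)"]
      have "((\<lambda>s. poly P (Z s)) has_field_derivative (deriv (\<lambda>s. h n s + h n (- s)) l - 0) / of_real (1 + \<epsilon>)) (at l)"
        by (rule has_field_derivative_transform_within_open[OF _ U']) (use U in \<open>simp add: P_eq less_imp_le\<close>)
      moreover have "((\<lambda>s. poly P (Z s)) has_field_derivative poly (pderiv P) (Z l) * deriv Z l) (at l)"
        by (rule DERIV_chain2[OF poly_DERIV Z_deriv(1)[OF l]])
      ultimately have "poly (pderiv P) (Z l) * deriv Z l = (deriv (\<lambda>s. h n s + h n (- s)) l - 0) / of_real (1 + \<epsilon>)"
        by (metis DERIV_unique)
      then have "norm (poly (pderiv P) (Z l) * deriv Z l) = norm (deriv (\<lambda>s. h n s + h n (- s)) l) / (1 + \<epsilon>)"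
        by (simp only: norm_divide norm_eps diff_0_right)
      moreover have "norm (u l) ^ n * norm (deriv Z l) * norm (poly (pderiv P) (Z l))
          = norm (\<beta> n l) * norm (poly (pderiv P) (Z l) * deriv Z l)"
        by (simp add: \<beta>_def norm_mult norm_power)
      ultimately have "norm (u l) ^ n * norm (deriv Z l) * norm (poly (pderiv P) (Z l))
          = norm (\<beta> n l) * norm (deriv (\<lambda>s. h n s + h n (- s)) l) / (1 + \<epsilon>)" by simp
      also have "\<dots> \<ge> (extremal_constant l - \<epsilon>) / (1 + \<epsilon>)"
        using elim \<epsilon> by (intro divide_right_mono) auto
      finally show ?thesis .
    qed
    ultimately show ?case by blast
  qed
qed

theorem A_poly_tendsto:
  assumes l: "Re l > 0" "l \<noteq> l0"
    and E: "Z ` {s. Re s = 0} \<subseteq> E" "E \<subseteq> insert \<kappa> (Z ` {s. Re s = 0})"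
  shows "(\<lambda>n. norm (u l) ^ n * A_poly n (Z l) E * norm (deriv Z l)) \<longlonglongrightarrow> extremal_constant l"
proof -
  define S where "S = (\<lambda>n. {norm (poly (pderiv P) (Z l)) | P. P \<in> polys_bdd n E \<and> poly P (Z l) = 0})"
  have "((\<lambda>n. norm (u l) ^ n * norm (deriv Z l) * Sup (S n)) \<longlongrightarrow> extremal_constant l) sequentially"
  proof (rule tendsto_times_Sup)
    show "norm (u l) ^ n * norm (deriv Z l) > 0" for n
      using xmap_u[of l] Z_deriv(2)[OF l] l by (intro mult_pos_pos zero_less_power) auto
    show "extremal_constant l \<ge> 0" using l by (simp add: extremal_constant_def)
    fix \<epsilon> :: real assume \<epsilon>: "\<epsilon> > 0"
    show "\<forall>\<^sub>F n in sequentially. \<forall>x\<in>S n. norm (u l) ^ n * norm (deriv Z l) * x \<le> extremal_constant l + \<epsilon>"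
      using poly_deriv_upper[OF l \<epsilon> E(1)] by eventually_elim (auto simp: S_def)
    show "\<forall>\<^sub>F n in sequentially. \<exists>x\<in>S n. (extremal_constant l - \<epsilon>) / (1 + \<epsilon>) \<le> norm (u l) ^ n * norm (deriv Z l) * x"
      using poly_deriv_lower[OF l \<epsilon> E(2)] by eventually_elim (auto simp: S_def)
  qed
  then show ?thesis by (simp add: A_poly_def S_def mult_ac)
qed

end

section \<open>Identification of \<open>Upsilon\<close> and of the two polynomial cases\<close>

lemma Upsilon_eq_extremal_constant:
  assumes l: "Re l > 0"
  shows "Upsilon l = of_real (extremal_constant l)"
proof -
  define c where "c = csqrt l"
  have c2: "c\<^sup>2 = l" by (simp add: c_def)
  have cc: "c * cnj c = of_real (norm l)"
    by (simp only: complex_norm_square[symmetric] norm_power[symmetric] c2)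
  have ll: "l + cnj l = of_real (2 * Re l)" by (simp add: complex_eq_iff)
  \<comment> \<open>The square roots disappear because \<open>c^2 = l\<close> and
    \<open>c * cnj c = |l|\<close> turn the square into \<open>2 (|l| + Re l)\<close>.\<close>
  have "(c + cnj c)\<^sup>2 = c\<^sup>2 + cnj (c\<^sup>2) + 2 * (c * cnj c)" by (simp add: power2_eq_square algebra_simps)
  also have "\<dots> = of_real (2 * Re l) + 2 * of_real (norm l)" by (simp only: c2 cc ll)
  finally have sq: "(c + cnj c)\<^sup>2 = of_real (2 * (norm l + Re l))" by simp
  have "Upsilon l = (1 / (l + cnj l)) * (2 * (c * cnj c) / (c + cnj c)\<^sup>2)"
    by (simp add: Upsilon_def c_def mult.assoc)
  also have "\<dots> = of_real ((1 / (2 * Re l)) * (2 * norm l / (2 * (norm l + Re l))))"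
    unfolding ll sq cc by simp
  also have "(1 / (2 * Re l)) * (2 * norm l / (2 * (norm l + Re l))) = extremal_constant l"
    by (simp add: extremal_constant_def)
  finally show ?thesis .
qed

text \<open>At the pole \<open>p\<close> two formulas for the same map may take different default
  values, so equality is available only off \<open>p\<close>.\<close>

lemma deriv_cong_half_plane:
  assumes "Re l > 0" "l \<noteq> p" "\<And>s. Re s > 0 \<Longrightarrow> s \<noteq> p \<Longrightarrow> f s = g s"
  shows "deriv f l = deriv g l"
proof (rule deriv_cong_ev)
  have "open ({s. Re s > 0} - {p})" by (intro open_Diff open_halfspace_Re_gt) auto
  then have "\<forall>\<^sub>F s in nhds l. s \<in> {s. Re s > 0} - {p}" using assms by (intro eventually_nhds_in_open) auto
  then show "\<forall>\<^sub>F s in nhds l. f s = g s" by eventually_elim (use assms in auto)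
qed simp

text \<open>The endpoint 2 is missing because it corresponds to
  \<open>s = \<infinity>\<close>.\<close>

lemma zmap_axis: "zmap ` {s. Re s = 0} = complex_of_real ` {-2..<2}"
proof (intro set_eqI iffI)
  fix z assume "z \<in> zmap ` {s. Re s = 0}"
  then obtain s where s: "Re s = 0" "z = zmap s" by auto
  define y where "y = (Im s)\<^sup>2"
  have y: "y \<ge> 0" by (simp add: y_def)
  have "s\<^sup>2 = of_real (- y)" using s by (simp add: y_def complex_eq_iff power2_eq_square)
  then have "z = of_real (2 * (- y + 1) / (- y - 1))" by (simp add: s zmap_def)
  moreover have "-2 \<le> 2 * (- y + 1) / (- y - 1)" "2 * (- y + 1) / (- y - 1) < 2"
    using y by (auto simp: field_simps)
  ultimately show "z \<in> complex_of_real ` {-2..<2}" by (metis atLeastLessThan_iff image_eqI)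
next
  fix z assume "z \<in> complex_of_real ` {-2..<2}"
  then obtain x where x: "-2 \<le> x" "x < 2" "z = of_real x" by auto
  \<comment> \<open>Solving \<open>zmap s = x\<close> for \<open>s^2\<close> gives
    \<open>- (2 + x) / (2 - x)\<close>, which is nonpositive on \<open>[-2, 2)\<close>.\<close>
  define s where "s = \<i> * of_real (sqrt ((2 + x) / (2 - x)))"
  have s2: "s\<^sup>2 = of_real (- ((2 + x) / (2 - x)))"
  proof -
    have "s\<^sup>2 = of_real (- ((sqrt ((2 + x) / (2 - x)))\<^sup>2))" by (simp add: s_def power_mult_distrib)
    also have "(sqrt ((2 + x) / (2 - x)))\<^sup>2 = (2 + x) / (2 - x)" using x by simp
    finally show ?thesis .
  qed
  have "zmap s = of_real (2 * (- ((2 + x) / (2 - x)) + 1) / (- ((2 + x) / (2 - x)) - 1))"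
    unfolding zmap_def s2 by simp
  also have "2 * (- ((2 + x) / (2 - x)) + 1) / (- ((2 + x) / (2 - x)) - 1) = x"
  proof -
    have "- ((2 + x) / (2 - x)) + 1 = - 2 * x / (2 - x)" "- ((2 + x) / (2 - x)) - 1 = - 4 / (2 - x)"
      using x by (auto simp: field_simps)
    then show ?thesis using x by simp
  qed
  finally show "z \<in> zmap ` {s. Re s = 0}" using x by (intro image_eqI[of _ _ s]) (auto simp: s_def)
qed

text \<open>The parameters come from
  \<open>2 (s^2 + 1) / (s^2 - 1) = 2 + 4 / (s^2 - 1)\<close>.\<close>

interpretation interval: quadratic_map 1 2 4
  by standard auto

lemma zmap_eq_Z: "s\<^sup>2 \<noteq> 1 \<Longrightarrow> zmap s = interval.Z s"
  by (simp add: zmap_def interval.Z_def field_simps)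

lemma axis_square_neq_1: "Re s = 0 \<Longrightarrow> s\<^sup>2 \<noteq> 1"
  by (auto simp: power2_eq_1_iff)

theorem A_poly_interval_tendsto:
  assumes l: "Re l > 0" "l \<noteq> 1"
  shows "(\<lambda>n. norm ((l - 1) / (l + 1)) ^ n * A_poly n (zmap l) (complex_of_real ` {-2..2}) * norm (deriv zmap l))
    \<longlonglongrightarrow> extremal_constant l"
proof -
  have sq: "s\<^sup>2 \<noteq> 1" if "Re s > 0" "s \<noteq> 1" for s using that by (auto simp: power2_eq_1_iff)
  have axis: "interval.Z ` {s. Re s = 0} = complex_of_real ` {-2..<2}"
    unfolding zmap_axis[symmetric] using zmap_eq_Z axis_square_neq_1 by (intro image_cong) auto
  have "deriv zmap l = deriv interval.Z l"
    by (rule deriv_cong_half_plane[OF l]) (use sq zmap_eq_Z in auto)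
  moreover have "zmap l = interval.Z l" using sq[OF l] by (rule zmap_eq_Z)
  moreover have "complex_of_real ` {-2..2} = insert 2 (complex_of_real ` {-2..<2})"
  proof -
    have "{-2..2} = insert 2 {-2..<2::real}" by auto
    then show ?thesis by simp
  qed
  ultimately show ?thesis
    using interval.A_poly_tendsto[OF l, of "complex_of_real ` {-2..2}"]
    by (simp add: axis half_plane_blaschke_def subset_insertI)
qed

theorem A_poly_arc_tendsto:
  assumes l: "Re l > 0" "l \<noteq> l0" and y0: "y0 > 0"
    and l0: "l0\<^sup>2 = (\<i> * of_real y0 - 2) / (\<i> * of_real y0 + 2)" "Re l0 > 0"
  shows "(\<lambda>n. norm ((l - l0) / (l + cnj l0)) ^ n * A_poly n (zetamap y0 l) (ET y0) * norm (deriv (zetamap y0) l))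
    \<longlonglongrightarrow> extremal_constant l"
proof -
  define a where "a = \<i> * complex_of_real y0"
  \<comment> \<open>\<open>\<kappa>\<close> is the value of \<open>\<zeta>\<close> at
    \<open>z = 2\<close>, that is, at \<open>s = \<infinity>\<close>; \<open>\<tau>\<close> is what
    remains of the numerator after subtracting \<open>\<kappa>\<close> times the denominator, over
    the leading coefficient \<open>2 + a\<close>.\<close>
  define \<kappa> where "\<kappa> = (2 - a) / (2 + a)"
  define \<tau> where "\<tau> = 8 * a / (2 + a)\<^sup>2"
  have a2: "2 + a \<noteq> 0" "a \<noteq> 0" using y0 by (auto simp: a_def complex_eq_iff)
  interpret arc: quadratic_map l0 \<kappa> \<tau>
    by standard (use l0 a2 in \<open>auto simp: \<tau>_def\<close>)
  \<comment> \<open>Equivalently, the denominator of \<open>zetamap\<close> vanishes at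
    \<open>\<plusminus> l0\<close>, where \<open>z = - a\<close>.\<close>
  have al: "(2 + a) * l0\<^sup>2 = a - 2" using a2 l0 by (simp add: a_def add.commute)
  have Z: "zetamap y0 s = arc.Z s" if s: "s\<^sup>2 - l0\<^sup>2 \<noteq> 0" for s
  proof -
    have den: "2 * (s\<^sup>2 + 1) + a * (s\<^sup>2 - 1) = (2 + a) * (s\<^sup>2 - l0\<^sup>2)"
      unfolding right_diff_distrib[of "2 + a"] al by (simp add: algebra_simps)
    have num: "2 * (s\<^sup>2 + 1) - a * (s\<^sup>2 - 1) = (2 - a) * (s\<^sup>2 - l0\<^sup>2) + 8 * a / (2 + a)"
    proof -
      have "(2 - a) * l0\<^sup>2 + 2 + a = 8 * a / (2 + a) + 0 * a"
      proof -
        have "(2 + a) * ((2 - a) * l0\<^sup>2 + 2 + a) = (2 - a) * ((2 + a) * l0\<^sup>2) + (2 + a)\<^sup>2"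
          by (simp add: algebra_simps power2_eq_square)
        also have "\<dots> = 8 * a" unfolding al by (simp add: algebra_simps power2_eq_square)
        finally show ?thesis using a2 by (simp add: field_simps)
      qed
      then show ?thesis by (simp add: algebra_simps)
    qed
    have "zetamap y0 s = ((2 - a) * (s\<^sup>2 - l0\<^sup>2) + 8 * a / (2 + a)) / ((2 + a) * (s\<^sup>2 - l0\<^sup>2))"
      unfolding zetamap_def a_def[symmetric] num den ..
    also have "\<dots> = \<kappa> + \<tau> / (s\<^sup>2 - l0\<^sup>2)"
      unfolding add_divide_distrib using s a2 by (simp add: \<kappa>_def \<tau>_def power2_eq_square)
    also have "\<dots> = arc.Z s" by (rule arc.Z_def[symmetric])
    finally show ?thesis .
  qed
  \<comment> \<open>The Moebius map from \<open>z\<close> to \<open>\<zeta>\<close>; it carries the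
    description of the axis image from the interval to the arc.\<close>
  define M where "M = (\<lambda>z. (z - a) / (z + a))"
  have M: "zetamap y0 s = M (zmap s)" if s: "Re s = 0" for s
  proof -
    have ne: "s\<^sup>2 - 1 \<noteq> 0" using axis_square_neq_1[OF s] by simp
    have "zmap s - a = (2 * (s\<^sup>2 + 1) - a * (s\<^sup>2 - 1)) / (s\<^sup>2 - 1)"
      "zmap s + a = (2 * (s\<^sup>2 + 1) + a * (s\<^sup>2 - 1)) / (s\<^sup>2 - 1)"
      using ne by (simp_all add: zmap_def diff_divide_distrib add_divide_distrib)
    then show ?thesis using ne by (simp add: M_def zetamap_def a_def)
  qed
  have "arc.Z ` {s. Re s = 0} = zetamap y0 ` {s. Re s = 0}"
    using Z arc.square_neq arc.axis_neq by (intro image_cong) auto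
  also have "\<dots> = M ` zmap ` {s. Re s = 0}" unfolding image_image using M by (intro image_cong) auto
  finally have axis: "arc.Z ` {s. Re s = 0} = (\<lambda>x. M (of_real x)) ` {-2..<2}"
    by (simp add: zmap_axis image_image)
  have ET: "ET y0 = (\<lambda>x. M (of_real x)) ` {-2..2}"
    by (auto simp: ET_def M_def a_def)
  also have "{-2..2} = insert 2 {-2..<2::real}" by auto
  finally have "ET y0 = insert \<kappa> (arc.Z ` {s. Re s = 0})"
    unfolding axis by (simp add: M_def \<kappa>_def)
  moreover have "deriv (zetamap y0) l = deriv arc.Z l"
    by (rule deriv_cong_half_plane[OF l]) (use Z arc.square_neq in auto)
  moreover have "zetamap y0 l = arc.Z l" using Z arc.square_neq l by auto
  ultimately show ?thesis
    using arc.A_poly_tendsto[OF l, of "ET y0"]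
    by (simp add: half_plane_blaschke_def subset_insertI)
qed

theorem theorem1p6:
  fixes l :: complex
  assumes "Re l > 0"
  shows
    "((\<lambda>t::real. complex_of_real (exp (- t * Re l) * A_entire t (- (l^2)) * 2 * norm l))
        \<longlongrightarrow> Upsilon l) at_top
     \<and> (l \<noteq> 1 \<longrightarrow>
        ((\<lambda>n::nat. complex_of_real (norm ((l - 1) / (l + 1)) ^ n
              * A_poly n (zmap l) (complex_of_real ` {-2..2}) * norm (deriv zmap l)))
          \<longlongrightarrow> Upsilon l) sequentially)
     \<and> (\<forall>(y0::real) (l0::complex). y0 > 0 \<and> l0^2 = (\<i> * of_real y0 - 2) / (\<i> * of_real y0 + 2)
          \<and> Re l0 > 0 \<and> l \<noteq> l0 \<longrightarrow>
        ((\<lambda>n::nat. complex_of_real (norm ((l - l0) / (l + cnj l0)) ^ n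
              * A_poly n (zetamap y0 l) (ET y0) * norm (deriv (zetamap y0) l)))
          \<longlongrightarrow> Upsilon l) sequentially)"
  unfolding Upsilon_eq_extremal_constant[OF assms] tendsto_of_real_iff
  using A_entire_tendsto[OF assms] A_poly_interval_tendsto[OF assms] A_poly_arc_tendsto[OF assms]
  by blast

end
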